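(* Let $\omega\in\mathbb T^1\setminus\mathbb Q$ and $f\in\mathcal V_\omega$, with SNA $\phi^+$ and SNR $\phi^-$. Then the measures $\mu_{\phi^+}$ and $\mu_{\phi^-}$ on $\mathbb T^2$ are $1$-rectifiable.
   Context: Notation: $\mathbb T^1=\mathbb R/\mathbb Z$, $d$ the usual distance on $\mathbb T^1$, $\pi_1,\pi_2$ the coordinate projections of $\mathbb T^2=\mathbb T^1\times\mathbb T^1$, $\mathrm{Leb}$ Lebesgue measure on $\mathbb T^1$. Skew products: for irrational $\omega$, $\mathcal F_\omega$ is the set of $C^1$-diffeomorphisms $f$ of $\mathbb T^2$ homotopic to the identity of the form $f(\theta,x)=(\theta+\omega,f_\theta(x))$. Write $f^k_\theta(x)=\pi_2(f^k(\theta,x))$ for $k\in\mathbb Z$. Invariant graphs: a measurable $\phi:\mathbb T^1\to\mathbb T^1$ is an invariant graph if $f_\theta(\phi(\theta))=\phi(\theta+\omega)$ for Lebesgue-a.e. $\theta$; graphs agreeing a.e. are identified. Its Lyapunov exponent is $\lambda(\phi)=\int_{\mathbb T^1}\log|\partial_xf_\theta(\phi(\theta))|\,d\theta$. It is an SNA (resp. SNR) if $\lambda(\phi)<0$ (resp. $>0$) and there is no continuous function a.e. equal to $\phi$. The associated measure is $\mu_\phi(A)=\mathrm{Leb}(\pi_1(A\cap\Phi))$, $\Phi=\{(\theta,\phi(\theta))\}$. The class $\mathcal V_\omega$: $f\in\mathcal F_\omega$ belongs to $\mathcal V_\omega$ if the following hold for some choice of data. (i) There are disjoint closed intervals $C=[c^-,c^+]$,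 $E=[e^-,e^+]\subseteq\mathbb T^1$ and a set $\mathcal I_0\subseteq\mathbb T^1$ which is a union of $\mathcal N$ disjoint open intervals, and constants $\alpha>4$, $S>0$, such that: $f_\theta(x)\in\mathrm{int}(C)$ whenever $x\notin(e^-,e^+)$ and $\theta\notin\mathcal I_0$; for all $\theta,\theta',x,x'$: $\alpha^{-2}d(x,x')\le d(f_\theta(x),f_\theta(x'))\le\alpha^2d(x,x')$ and $d(f_\theta(x),f_{\theta'}(x))\le S\,d(\theta,\theta')$; $|\partial_xf_\theta(x)|\le\alpha^{-1}$ for $x\in C$; $|\partial_xf_\theta(x)|\ge\alpha$ for $x\in E$. (ii) Integers $\kappa\ge2$, $K_0\ge1$, $K_n=K_0\kappa^n$, $b_0=1$, $b_n=(1-1/K_{n-1})b_{n-1}$, with $b=\lim_n b_n>\sqrt{5/6}$. A super-exponentially increasing integer sequence $(M_n)_{n\ge0}$ with $M_0\ge2$ and $M_{n+1}\le2\alpha^{M_n/16}$. A non-increasing positive sequence $(\varepsilon_n)$ with $\varepsilon_0\le1$ and $\varepsilon_{n+1}\le2\alpha^{-M_n/4}/s$ for a fixed $s>0$. Moreover $\alpha\ge\alpha_*$ and $\varepsilon_0\le\varepsilon_*$, where $\alpha_*>1,\varepsilon_*>0$ are thresholds guaranteeing $\sum_{n\ge0}(2K_nM_n+1)\mathcal N\varepsilon_n\le\sum_{n\ge0}\varepsilon_n^{1/2}<1/16$; and each component of $\mathcal I_0$ has length $<\varepsilon_0$. (iii) Critical regions: recursively $\mathcal A_n=(\mathcal I_n-(M_n-1)\omega)\times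 C$, $\mathcal B_n=(\mathcal I_n+(M_n+1)\omega)\times E$, $\mathcal I_{n+1}=\mathrm{int}\,\pi_1\big(f^{M_n-1}(\mathcal A_n)\cap f^{-(M_n+1)}(\mathcal B_n)\big)$. Let $\mathcal W_n^+=\bigcup_{j=0}^n\bigcup_{l=1}^{M_j+1}(\mathcal I_j+l\omega)$, $\mathcal W_n^-=\bigcup_{j=0}^n\bigcup_{l=-(M_j-1)}^{0}(\mathcal I_j+l\omega)$, $\mathcal W_{-1}^\pm=\emptyset$. For every $n\in\mathbb N$: $\mathcal I_j\ne\emptyset$ for $j\le n$; $\mathcal I_j\cap\bigcup_{k=1}^{2K_jM_j}(\mathcal I_j+k\omega)=\emptyset$ for $j=0,\dots,n$; $\big((\mathcal I_j-(M_j-1)\omega)\cup(\mathcal I_j+(M_j+1)\omega)\big)\cap(\mathcal W_{j-1}^+\cup\mathcal W_{j-1}^-)=\emptyset$ for $j=1,\dots,n$; and $\mathcal I_n$ has exactly $\mathcal N$ connected components, each of length $<\varepsilon_n$. (iv) $f$ has an SNA $\phi^+$ and an SNR $\phi^-$, and $\mu_{\phi^+},\mu_{\phi^-}$ are the only $f$-invariant ergodic probability measures. (v) $f$ is minimal. Rectifiability: $\mathcal H^1$ is the one-dimensional Hausdorff measure on $\mathbb T^2$. A Borel set $A\subseteq\mathbb T^2$ is countably $1$-rectifiable if there are Lipschitz maps $g_i:A_i\subseteq\mathbb R\to\mathbb T^2$ with $\mathcal H^1(A\setminus\bigcup_ig_i(A_i))=0$. A finite Borel measure $\mu$ is $1$-rectifiable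 if $\mu=\Theta\,\mathcal H^1|_A$ for a countably $1$-rectifiable $A$ and a Borel density $\Theta:A\to[0,\infty)$. *)

theory Defs
  imports "HOL-Analysis.Analysis"
begin

definition int_diff :: "real \<Rightarrow> real \<Rightarrow> bool" where
  "int_diff x y \<longleftrightarrow> x - y \<in> \<int>"

lemma equivp_int_diff: "equivp int_diff"
proof (rule equivpI)
  show "reflp int_diff" by (auto simp: reflp_def int_diff_def)
  show "symp int_diff"
    by (auto simp: symp_def int_diff_def) (metis Ints_minus minus_diff_eq)
  show "transp int_diff"
    unfolding transp_def int_diff_def
    by (metis Ints_add diff_add_cancel diff_diff_eq2)
qed

quotient_type T1 = real / int_diff
  by (rule equivp_int_diff)

lemma round_add_Ints: "k \<in> \<int> \<Longrightarrow> of_int (round (u + k)) = of_int (round u) + (k::real)"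
proof -
  assume "k \<in> \<int>"
  then obtain m where m: "k = of_int m" by (auto elim: Ints_cases)
  have "round (u + of_int m) = round u + m"
    unfolding round_def by (metis add.commute add.left_commute floor_add_int)
  then show ?thesis using m by simp
qed

lift_definition rotT :: "real \<Rightarrow> T1 \<Rightarrow> T1" is "\<lambda>t x. x + t"
proof -
  fix t x y :: real assume "int_diff x y"
  then show "int_diff (x + t) (y + t)" unfolding int_diff_def by simp
qed

instantiation T1 :: metric_space
begin

lift_definition dist_T1 :: "T1 \<Rightarrow> T1 \<Rightarrow> real"
  is "\<lambda>x y. \<bar>x - y - of_int (round (x - y))\<bar>"
proof -
  fix x x' y y' :: real
  assume "int_diff x x'" "int_diff y y'"
  then have "(x - x') - (y - y') \<in> \<int>" unfolding int_diff_def by (rule Ints_diff)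
  moreover have "(x - y) - (x' - y') = (x - x') - (y - y')" by simp
  ultimately have k: "(x - y) - (x' - y') \<in> \<int>" by metis
  have "x - y = (x' - y') + ((x - y) - (x' - y'))" by simp
  then have "of_int (round (x - y)) = of_int (round (x' - y')) + ((x - y) - (x' - y'))"
    using round_add_Ints[OF k] by metis
  then show "\<bar>x - y - of_int (round (x - y))\<bar> = \<bar>x' - y' - of_int (round (x' - y'))\<bar>"
    by simp
qed

definition uniformity_T1 :: "(T1 \<times> T1) filter" where
  "uniformity_T1 = (INF e\<in>{0 <..}. principal {(x, y). dist x y < e})"

definition open_T1 :: "T1 set \<Rightarrow> bool" where
  "open_T1 U \<longleftrightarrow> (\<forall>x\<in>U. eventually (\<lambda>(x', y). x' = x \<longrightarrow> y \<in> U) uniformity)"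

instance
proof (standard, goal_cases)
  case 1 show ?case by (rule uniformity_T1_def)
next
  case (2 U) show ?case by (rule open_T1_def)
next
  case (3 x y) then show ?case
  proof transfer
    fix x y :: real
    show "\<bar>x - y - of_int (round (x - y))\<bar> = 0 \<longleftrightarrow> int_diff x y"
    proof
      assume "\<bar>x - y - of_int (round (x - y))\<bar> = 0"
      then have "x - y = of_int (round (x - y))" by simp
      then show "int_diff x y" unfolding int_diff_def by (metis Ints_of_int)
    next
      assume "int_diff x y"
      then obtain m where "x - y = of_int m" unfolding int_diff_def by (auto elim: Ints_cases)
      then show "\<bar>x - y - of_int (round (x - y))\<bar> = 0" by simp
    qed
  qed
next
  case (4 x y z) then show ?case
  proof transfer
    fix x y z :: real
    have "\<bar>(x - y) - of_int (round (x - y))\<bar> \<le> \<bar>(x - y) - of_int (round (x - z) - round (y - z))\<bar>"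
      by (rule round_diff_minimal)
    also have "\<dots> \<le> \<bar>x - z - of_int (round (x - z))\<bar> + \<bar>y - z - of_int (round (y - z))\<bar>"
      by simp
    finally show "\<bar>x - y - of_int (round (x - y))\<bar>
        \<le> \<bar>x - z - of_int (round (x - z))\<bar> + \<bar>y - z - of_int (round (y - z))\<bar>" .
  qed
qed

end

definition rep :: "T1 \<Rightarrow> real" where "rep = rep_T1"

definition C1_map :: "(real \<times> real \<Rightarrow> real) \<Rightarrow> bool" where
  "C1_map g \<longleftrightarrow> (\<exists>D :: (real \<times> real) \<Rightarrow> ((real \<times> real) \<Rightarrow>\<^sub>L real).
      (\<forall>p. (g has_derivative blinfun_apply (D p)) (at p)) \<and> continuous_on UNIV D)"

text \<open>f in F_omega, given by the lift G of its fibre maps: the lift of f to R^2 is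
  F(t,y) = (t + omega, G t y); f homotopic to the identity means G is 1-periodic in t
  and G t (y+1) = G t y + 1; f is a C^1 diffeomorphism iff F is a C^1 diffeomorphism.\<close>
definition F_omega :: "real \<Rightarrow> (real \<Rightarrow> real \<Rightarrow> real) \<Rightarrow> bool" where
  "F_omega \<omega> G \<longleftrightarrow>
     (\<forall>t y. G (t + 1) y = G t y) \<and> (\<forall>t y. G t (y + 1) = G t y + 1) \<and>
     C1_map (\<lambda>p. G (fst p) (snd p)) \<and>
     (\<exists>H. (\<forall>t y. H t (G t y) = y \<and> G t (H t y) = y) \<and> C1_map (\<lambda>p. H (fst p) (snd p)))"

definition fib :: "(real \<Rightarrow> real \<Rightarrow> real) \<Rightarrow> T1 \<Rightarrow> T1 \<Rightarrow> T1" where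
  "fib G \<theta> x = abs_T1 (G (rep \<theta>) (rep x))"

definition dfib :: "(real \<Rightarrow> real \<Rightarrow> real) \<Rightarrow> T1 \<Rightarrow> T1 \<Rightarrow> real" where
  "dfib G \<theta> x = deriv (G (rep \<theta>)) (rep x)"

definition fmap :: "real \<Rightarrow> (real \<Rightarrow> real \<Rightarrow> real) \<Rightarrow> T1 \<times> T1 \<Rightarrow> T1 \<times> T1" where
  "fmap \<omega> G p = (rotT \<omega> (fst p), fib G (fst p) (snd p))"

definition LebT :: "T1 measure" where
  "LebT = completion (distr (restrict_space lborel {0..<1}) borel abs_T1)"

definition inv_graph :: "real \<Rightarrow> (real \<Rightarrow> real \<Rightarrow> real) \<Rightarrow> (T1 \<Rightarrow> T1) \<Rightarrow> bool" where
  "inv_graph \<omega> G \<phi> \<longleftrightarrow> \<phi> \<in> measurable LebT borel \<and>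
     (AE \<theta> in LebT. fib G \<theta> (\<phi> \<theta>) = \<phi> (rotT \<omega> \<theta>))"

definition lyap :: "(real \<Rightarrow> real \<Rightarrow> real) \<Rightarrow> (T1 \<Rightarrow> T1) \<Rightarrow> real" where
  "lyap G \<phi> = (\<integral>\<theta>. ln \<bar>dfib G \<theta> (\<phi> \<theta>)\<bar> \<partial>LebT)"

definition ae_continuous :: "(T1 \<Rightarrow> T1) \<Rightarrow> bool" where
  "ae_continuous \<phi> \<longleftrightarrow> (\<exists>\<psi>. continuous_on UNIV \<psi> \<and> (AE \<theta> in LebT. \<phi> \<theta> = \<psi> \<theta>))"

definition SNA :: "real \<Rightarrow> (real \<Rightarrow> real \<Rightarrow> real) \<Rightarrow> (T1 \<Rightarrow> T1) \<Rightarrow> bool" where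
  "SNA \<omega> G \<phi> \<longleftrightarrow> inv_graph \<omega> G \<phi> \<and> lyap G \<phi> < 0 \<and> \<not> ae_continuous \<phi>"

definition SNR :: "real \<Rightarrow> (real \<Rightarrow> real \<Rightarrow> real) \<Rightarrow> (T1 \<Rightarrow> T1) \<Rightarrow> bool" where
  "SNR \<omega> G \<phi> \<longleftrightarrow> inv_graph \<omega> G \<phi> \<and> lyap G \<phi> > 0 \<and> \<not> ae_continuous \<phi>"

definition graph_measure :: "(T1 \<Rightarrow> T1) \<Rightarrow> (T1 \<times> T1) measure" where
  "graph_measure \<phi> = distr LebT borel (\<lambda>\<theta>. (\<theta>, \<phi> \<theta>))"

definition inv_ergodic :: "real \<Rightarrow> (real \<Rightarrow> real \<Rightarrow> real) \<Rightarrow> (T1 \<times> T1) measure \<Rightarrow> bool" where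
  "inv_ergodic \<omega> G \<mu> \<longleftrightarrow> sets \<mu> = sets borel \<and> emeasure \<mu> (space \<mu>) = 1 \<and>
     distr \<mu> borel (fmap \<omega> G) = \<mu> \<and>
     (\<forall>A \<in> sets borel. fmap \<omega> G -` A = A \<longrightarrow> emeasure \<mu> A = 0 \<or> emeasure \<mu> A = 1)"

definition minimal_map :: "('a::topological_space \<Rightarrow> 'a) \<Rightarrow> bool" where
  "minimal_map f \<longleftrightarrow> (\<forall>K. closed K \<and> K \<noteq> {} \<and> f ` K = K \<longrightarrow> K = UNIV)"

definition cl_arc :: "real \<Rightarrow> real \<Rightarrow> T1 set" where "cl_arc a b = abs_T1 ` {a..b}"
definition op_arc :: "real \<Rightarrow> real \<Rightarrow> T1 set" where "op_arc a b = abs_T1 ` {a<..<b}"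

definition shiftT :: "real \<Rightarrow> int \<Rightarrow> T1 set \<Rightarrow> T1 set" where
  "shiftT \<omega> l S = rotT (of_int l * \<omega>) ` S"

primrec crit :: "real \<Rightarrow> (real \<Rightarrow> real \<Rightarrow> real) \<Rightarrow> T1 set \<Rightarrow> T1 set \<Rightarrow> T1 set
                  \<Rightarrow> (nat \<Rightarrow> nat) \<Rightarrow> nat \<Rightarrow> T1 set" where
  "crit \<omega> G C E I0 M 0 = I0"
| "crit \<omega> G C E I0 M (Suc n) =
     (let I = crit \<omega> G C E I0 M n;
          A = shiftT \<omega> (- (int (M n) - 1)) I \<times> C;
          B = shiftT \<omega> (int (M n) + 1) I \<times> E
      in interior (fst ` (((fmap \<omega> G ^^ (M n - 1)) ` A) \<inter> ((fmap \<omega> G ^^ (M n + 1)) -` B))))"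

definition Wp :: "real \<Rightarrow> (nat \<Rightarrow> T1 set) \<Rightarrow> (nat \<Rightarrow> nat) \<Rightarrow> nat \<Rightarrow> T1 set" where
  "Wp \<omega> I M n = (\<Union>j\<le>n. \<Union>l\<in>{1..int (M j) + 1}. shiftT \<omega> l (I j))"

definition Wm :: "real \<Rightarrow> (nat \<Rightarrow> T1 set) \<Rightarrow> (nat \<Rightarrow> nat) \<Rightarrow> nat \<Rightarrow> T1 set" where
  "Wm \<omega> I M n = (\<Union>j\<le>n. \<Union>l\<in>{- (int (M j) - 1)..0}. shiftT \<omega> l (I j))"

definition superexp :: "(nat \<Rightarrow> nat) \<Rightarrow> bool" where
  "superexp M \<longleftrightarrow> strict_mono M \<and> (\<forall>C::real. \<forall>\<^sub>F n in sequentially. C ^ n \<le> real (M n))"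

definition Vcond_i :: "(real \<Rightarrow> real \<Rightarrow> real) \<Rightarrow> real \<Rightarrow> real \<Rightarrow> real \<Rightarrow> real
     \<Rightarrow> nat \<Rightarrow> (nat \<Rightarrow> real) \<Rightarrow> (nat \<Rightarrow> real) \<Rightarrow> real \<Rightarrow> real \<Rightarrow> bool" where
  "Vcond_i G cm cp em ep N a b \<alpha> S \<longleftrightarrow>
    cm < cp \<and> cp < cm + 1 \<and> em < ep \<and> ep < em + 1 \<and> cl_arc cm cp \<inter> cl_arc em ep = {} \<and>
    (\<forall>i<N. a i < b i \<and> b i \<le> a i + 1) \<and>
    disjoint_family_on (\<lambda>i. op_arc (a i) (b i)) {..<N} \<and>
    \<alpha> > 4 \<and> S > 0 \<and>
    (\<forall>\<theta> x. x \<notin> op_arc em ep \<and> \<theta> \<notin> (\<Union>i<N. op_arc (a i) (b i))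
        \<longrightarrow> fib G \<theta> x \<in> interior (cl_arc cm cp)) \<and>
    (\<forall>\<theta> x x'. dist x x' / \<alpha>\<^sup>2 \<le> dist (fib G \<theta> x) (fib G \<theta> x') \<and>
               dist (fib G \<theta> x) (fib G \<theta> x') \<le> \<alpha>\<^sup>2 * dist x x') \<and>
    (\<forall>\<theta> \<theta>' x. dist (fib G \<theta> x) (fib G \<theta>' x) \<le> S * dist \<theta> \<theta>') \<and>
    (\<forall>\<theta> x. x \<in> cl_arc cm cp \<longrightarrow> \<bar>dfib G \<theta> x\<bar> \<le> 1 / \<alpha>) \<and>
    (\<forall>\<theta> x. x \<in> cl_arc em ep \<longrightarrow> \<bar>dfib G \<theta> x\<bar> \<ge> \<alpha>)"

definition Kseq :: "nat \<Rightarrow> nat \<Rightarrow> nat \<Rightarrow> nat" where "Kseq K0 \<kappa> n = K0 * \<kappa> ^ n"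

definition Vcond_ii :: "nat \<Rightarrow> (nat \<Rightarrow> real) \<Rightarrow> (nat \<Rightarrow> real) \<Rightarrow> real
     \<Rightarrow> nat \<Rightarrow> nat \<Rightarrow> (nat \<Rightarrow> nat) \<Rightarrow> (nat \<Rightarrow> real) \<Rightarrow> real \<Rightarrow> bool" where
  "Vcond_ii N a b \<alpha> \<kappa> K0 M \<epsilon> s \<longleftrightarrow>
    \<kappa> \<ge> 2 \<and> K0 \<ge> 1 \<and>
    (\<exists>bl::real. (\<lambda>n. \<Prod>j<n. 1 - 1 / real (Kseq K0 \<kappa> j)) \<longlonglongrightarrow> bl \<and> bl > sqrt (5/6)) \<and>
    superexp M \<and> M 0 \<ge> 2 \<and> (\<forall>n. real (M (Suc n)) \<le> 2 * \<alpha> powr (real (M n) / 16)) \<and>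
    (\<forall>n. \<epsilon> n > 0) \<and> decseq \<epsilon> \<and> \<epsilon> 0 \<le> 1 \<and> s > 0 \<and>
    (\<forall>n. \<epsilon> (Suc n) \<le> 2 * \<alpha> powr (- real (M n) / 4) / s) \<and>
    (\<Sum>n. ennreal ((2 * real (Kseq K0 \<kappa> n) * real (M n) + 1) * real N * \<epsilon> n))
        \<le> (\<Sum>n. ennreal (sqrt (\<epsilon> n))) \<and>
    (\<Sum>n. ennreal (sqrt (\<epsilon> n))) < ennreal (1/16) \<and>
    (\<forall>i<N. b i - a i < \<epsilon> 0)"

definition Vcond_iii :: "real \<Rightarrow> nat \<Rightarrow> (nat \<Rightarrow> T1 set) \<Rightarrow> (nat \<Rightarrow> nat) \<Rightarrow> (nat \<Rightarrow> nat)
     \<Rightarrow> (nat \<Rightarrow> real) \<Rightarrow> bool" where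
  "Vcond_iii \<omega> N I K M \<epsilon> \<longleftrightarrow>
    (\<forall>j. I j \<noteq> {}) \<and>
    (\<forall>j. I j \<inter> (\<Union>k\<in>{1..2 * K j * M j}. shiftT \<omega> (int k) (I j)) = {}) \<and>
    (\<forall>j\<ge>1. (shiftT \<omega> (- (int (M j) - 1)) (I j) \<union> shiftT \<omega> (int (M j) + 1) (I j))
              \<inter> (Wp \<omega> I M (j - 1) \<union> Wm \<omega> I M (j - 1)) = {}) \<and>
    (\<forall>n. finite (components (I n)) \<and> card (components (I n)) = N \<and>
         (\<forall>c\<in>components (I n). measure LebT c < \<epsilon> n))"

definition in_V :: "real \<Rightarrow> (real \<Rightarrow> real \<Rightarrow> real) \<Rightarrow> (T1 \<Rightarrow> T1) \<Rightarrow> (T1 \<Rightarrow> T1) \<Rightarrow> bool" where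
  "in_V \<omega> G \<phi>p \<phi>m \<longleftrightarrow> F_omega \<omega> G \<and>
   (\<exists>(cm::real) (cp::real) (em::real) (ep::real) (N::nat) (a::nat \<Rightarrow> real) (b::nat \<Rightarrow> real)
      (\<alpha>::real) (S::real) (\<kappa>::nat) (K0::nat) (M::nat \<Rightarrow> nat) (\<epsilon>::nat \<Rightarrow> real) (s::real).
      Vcond_i G cm cp em ep N a b \<alpha> S \<and>
      Vcond_ii N a b \<alpha> \<kappa> K0 M \<epsilon> s \<and>
      Vcond_iii \<omega> N (crit \<omega> G (cl_arc cm cp) (cl_arc em ep) (\<Union>i<N. op_arc (a i) (b i)) M)
        (Kseq K0 \<kappa>) M \<epsilon>) \<and>
   \<comment> \<open>(iv)\<close>
   SNA \<omega> G \<phi>p \<and> SNR \<omega> G \<phi>m \<and>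
   {\<mu>. inv_ergodic \<omega> G \<mu>} = {graph_measure \<phi>p, graph_measure \<phi>m} \<and>
   \<comment> \<open>(v)\<close>
   minimal_map (fmap \<omega> G)"

definition H1_outer :: "'a::metric_space set \<Rightarrow> ennreal" where
  "H1_outer A = (SUP \<delta>\<in>{0::real<..}.
      INF U\<in>{U :: nat \<Rightarrow> 'a set. A \<subseteq> (\<Union>i. U i) \<and> (\<forall>i. bounded (U i) \<and> diameter (U i) \<le> \<delta>)}.
        (\<Sum>i. ennreal (diameter (U i))))"

definition H1 :: "'a::metric_space measure" where
  "H1 = measure_of UNIV (sets borel) H1_outer"

definition countably_1_rectifiable :: "'a::metric_space set \<Rightarrow> bool" where
  "countably_1_rectifiable A \<longleftrightarrow>
     (\<exists>(As :: nat \<Rightarrow> real set) (g :: nat \<Rightarrow> real \<Rightarrow> 'a).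
        (\<forall>i. \<exists>L. lipschitz_on L (As i) (g i)) \<and> H1_outer (A - (\<Union>i. g i ` As i)) = 0)"

definition rectifiable_1_measure :: "'a::metric_space measure \<Rightarrow> bool" where
  "rectifiable_1_measure \<mu> \<longleftrightarrow>
     (\<exists>A (\<Theta> :: 'a \<Rightarrow> real). A \<in> sets borel \<and> countably_1_rectifiable A \<and>
        \<Theta> \<in> borel_measurable borel \<and> (\<forall>x\<in>A. \<Theta> x \<ge> 0) \<and>
        \<mu> = density H1 (\<lambda>x. indicator A x * ennreal (\<Theta> x)))"

end

theory Submission
  imports Defs
begin

text \<open>
  The rate of contraction along a fibred orbit is governed by the visits of the base orbit to the
  critical sets \<open>I\<^sub>n\<close>: away from a window of length comparable to \<open>M\<^sub>n\<close> after each visit the orbit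
  stays in the contracting strip \<open>C\<close>. For almost every \<open>\<theta>\<close> the backward base orbit does not meet \<open>I\<^sub>j\<close>
  up to time \<open>2 K\<^sub>j M\<^sub>j\<close> for all \<open>j \<ge> P\<close>, with \<open>P\<close> depending on \<open>\<theta>\<close> (Borel--Cantelli). For two such points with the same \<open>P\<close> the
  non-contracting times have frequency below \<open>1/3\<close>, so the contraction \<open>1/\<alpha>\<close> beats the expansion
  \<open>\<alpha>\<^sup>2\<close>, and following both backward orbits shows that \<open>\<phi>\<^sup>+\<close> is Lipschitz on the set of these points.
  Hence \<open>\<mu>\<close> lives on countably many Lipschitz graphs; it is absolutely continuous with respect
  to \<open>\<H>\<^sup>1\<close> there, because the projection to the base does not increase distances, and a
  Radon--Nikodym density exists.

  That \<open>\<phi>\<^sup>+\<close> really lies in \<open>C\<close> off the windows follows from \<open>\<lambda>(\<phi>\<^sup>+) < 0\<close>: otherwise \<open>\<phi>\<^sup>+\<close>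
  would lie in the expanding strip \<open>E\<close> over a set of measure at least \<open>15/16\<close>. Ergodicity of the
  rotation is read off from the ergodicity of \<open>\<mu>\<close>. The repeller is the attractor of the inverse
  map, with \<open>C\<close> and \<open>E\<close> exchanged.\<close>

section \<open>The circle\<close>

text \<open>The constants come from counting exponents of \<open>\<alpha>\<close>. A non-contracting
  step costs at most 2 and a contracting one gains 1, so x non-contracting times among k leave the
  exponent 3 x - k; this is the origin of 1/3. Visits to \<open>J j\<close> are more than
  \<open>2 * K j * M j\<close> steps apart and each spoils at most \<open>M j + 3\<close> times, a
  share of at most \<open>7/5 / K j\<close> up to a constant. Since the limit of the products
  exceeds sqrt (5/6) > 10/11, the numbers \<open>1 / K j\<close> sum to at most 1/10. This gives the
  share 7/50 for one orbit, 7/25 for two, and the rate \<open>\<alpha> powr (-4/25)\<close>. The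
  additive constants arise only from the levels below \<open>P\<close>, so they depend on
  \<open>P\<close> alone and the Lipschitz constant is uniform on each piece. The two orbits are
  compared from ever earlier times, where nothing is known except that distances on the circle are
  bounded. Hence only the past of the base points is controlled, and a visit of the graph to the
  strip has to be found in the past as well.\<close>

lemma abs_T1_eq_iff: "abs_T1 x = abs_T1 y \<longleftrightarrow> x - y \<in> \<int>"
  using Quotient3_rel_abs[OF Quotient3_T1] T1.abs_eq_iff by (auto simp: int_diff_def)

text \<open>The left end \<open>c\<close> is left free because \<open>same_copy\<close> needs lifts
  in a prescribed translate of the unit interval.\<close>

lemma T1_cases: obtains u where "x = abs_T1 u" "u \<in> {c..<c+1}"
proof -
  obtain v where v: "x = abs_T1 v" by (induct x) auto
  show thesis
  proof
    show "x = abs_T1 (c + frac (v - c))"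
      unfolding v abs_T1_eq_iff by (simp add: frac_def)
    show "c + frac (v - c) \<in> {c..<c+1}" by (simp add: frac_lt_1)
  qed
qed

lemma abs_T1_rep [simp]: "abs_T1 (rep x) = x"
  unfolding rep_def by (rule Quotient3_abs_rep[OF Quotient3_T1])

lemma abs_T1_add_int [simp]: "abs_T1 (u + of_int k) = abs_T1 u"
  by (simp add: abs_T1_eq_iff)

lemma abs_T1_eqE:
  assumes "abs_T1 x = abs_T1 y" obtains k :: int where "x = y + of_int k"
  using assms unfolding abs_T1_eq_iff by (auto elim!: Ints_cases simp: algebra_simps)

lemma rotT_abs [simp]: "rotT c (abs_T1 u) = abs_T1 (u + c)"
  by (rule rotT.abs_eq)

lemma rotT_rotT [simp]: "rotT c (rotT c' x) = rotT (c + c') x"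
  by (cases x rule: T1_cases[of _ 0]) (simp add: ac_simps)

lemma rotT_0 [simp]: "rotT 0 x = x"
  by (cases x rule: T1_cases[of _ 0]) simp

lemma dist_abs_T1: "dist (abs_T1 u) (abs_T1 v) = \<bar>u - v - of_int (round (u - v))\<bar>"
  by (rule dist_T1.abs_eq)

lemma dist_abs_T1_le: "dist (abs_T1 u) (abs_T1 v) \<le> \<bar>u - v\<bar>"
  using round_diff_minimal[of "u - v" 0] by (simp add: dist_abs_T1)

lemma dist_T1_le_half: "dist x (y::T1) \<le> 1/2"
  by (cases x rule: T1_cases[of _ 0], cases y rule: T1_cases[of _ 0])
     (use of_int_round_abs_le in \<open>simp add: dist_abs_T1 abs_minus_commute\<close>)

lemma dist_abs_T1_eq: "\<bar>u - v\<bar> \<le> 1/2 \<Longrightarrow> dist (abs_T1 u) (abs_T1 v) = \<bar>u - v\<bar>"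
proof -
  assume h: "\<bar>u - v\<bar> \<le> 1/2"
  let ?k = "round (u - v)"
  have "\<bar>u - v\<bar> \<le> \<bar>u - v - of_int k\<bar>" for k :: int
  proof (cases "k = 0")
    case False
    then have "\<bar>real_of_int k\<bar> \<ge> 1" by linarith
    then show ?thesis using h by linarith
  qed simp
  then show ?thesis using dist_abs_T1_le[of u v] unfolding dist_abs_T1 by (meson order_antisym)
qed

text \<open>Removing the nearest integer from the difference of two lifts realises the circle
  distance. The lift \<open>u\<close> stays fixed, so that a ball around its class is covered by a
  ball around \<open>u\<close>.\<close>

lemma dist_T1_lift:
  obtains v where "y = abs_T1 v" "\<bar>u - v\<bar> = dist (abs_T1 u) y"
proof (cases y rule: T1_cases[of _ 0])
  case (1 w)
  show thesis
    by (rule that[of "w + of_int (round (u - w))"]) (simp_all add: 1 dist_abs_T1 algebra_simps)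
qed

lemma dist_rotT [simp]: "dist (rotT c x) (rotT c y) = dist x y"
  by (cases x rule: T1_cases[of _ 0], cases y rule: T1_cases[of _ 0]) (simp add: dist_abs_T1)

lemma rotT_eq_iff: "rotT c x = y \<longleftrightarrow> x = rotT (- c) y"
  by auto

lemma rotT_image_iff: "x \<in> rotT c ` A \<longleftrightarrow> rotT (- c) x \<in> A"
  by (metis (no_types) image_iff rotT_eq_iff minus_minus)

lemma continuous_rotT [continuous_intros]: "continuous_on A (rotT c)"
  by (rule lipschitz_on_continuous_on[of 1]) (simp add: lipschitz_on_def)

lemma lipschitz_abs_T1: "1-lipschitz_on A abs_T1"
  by (simp add: lipschitz_on_def dist_abs_T1_le dist_real_def)

lemma continuous_abs_T1 [continuous_intros]: "continuous_on A abs_T1"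
  using lipschitz_abs_T1 by (rule lipschitz_on_continuous_on)

lemma open_abs_T1: "open U \<Longrightarrow> open (abs_T1 ` U)"
  unfolding open_dist
proof clarify
  fix u assume h: "\<forall>x\<in>U. \<exists>e>0. \<forall>y. dist y x < e \<longrightarrow> y \<in> U" "u \<in> U"
  then obtain e where e: "e > 0" "\<And>v. dist v u < e \<Longrightarrow> v \<in> U" by blast
  show "\<exists>e>0. \<forall>y. dist y (abs_T1 u) < e \<longrightarrow> y \<in> abs_T1 ` U"
  proof (intro exI conjI allI impI)
    fix y assume "dist y (abs_T1 u) < e"
    moreover obtain v where "y = abs_T1 v" "\<bar>u - v\<bar> = dist (abs_T1 u) y" by (rule dist_T1_lift)
    ultimately show "y \<in> abs_T1 ` U" using e(2)[of v] by (auto simp: dist_real_def dist_commute abs_minus_commute)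
  qed (rule e)
qed

lemma open_op_arc: "open (op_arc a b)"
  unfolding op_arc_def by (intro open_abs_T1) auto

lemma compact_cl_arc: "compact (cl_arc a b)"
  unfolding cl_arc_def by (intro compact_continuous_image continuous_abs_T1) auto

text \<open>Arcs with rational end points form a base. The countable base makes pairs and distances
  of Borel functions into the circle Borel measurable.\<close>

instance T1 :: second_countable_topology
proof
  define B where "B = (\<lambda>(p, q). abs_T1 ` {p<..<q}) ` (\<rat> \<times> \<rat>)"
  have "topological_basis B"
  proof (rule topological_basisI)
    fix O' :: "T1 set" and x assume O': "open O'" "x \<in> O'"
    obtain u where u: "x = abs_T1 u" by (rule T1_cases)
    from O' obtain e where e: "e > 0" "\<And>y. dist y x < e \<Longrightarrow> y \<in> O'" unfolding open_dist by blast
    obtain p where p: "p \<in> \<rat>" "u - e < p" "p < u" using Rats_dense_in_real[of "u - e" u] e by auto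
    obtain q where q: "q \<in> \<rat>" "u < q" "q < u + e" using Rats_dense_in_real[of u "u + e"] e by auto
    have "abs_T1 ` {p<..<q} \<subseteq> O'"
    proof clarify
      fix v assume "v \<in> {p<..<q}"
      then have "\<bar>v - u\<bar> < e" using p q by auto
      then show "abs_T1 v \<in> O'" using dist_abs_T1_le[of v u] by (intro e) (simp add: u)
    qed
    moreover have "x \<in> abs_T1 ` {p<..<q}" using p q u by auto
    ultimately show "\<exists>B'\<in>B. x \<in> B' \<and> B' \<subseteq> O'" using p q by (force simp: B_def)
  qed (auto simp: B_def intro!: open_abs_T1)
  moreover have "countable B" unfolding B_def by (intro countable_image countable_SIGMA countable_rat)
  ultimately show "\<exists>B :: T1 set set. countable B \<and> open = generate_topology B"
    using topological_basis_imp_subbasis by blast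
qed

section \<open>Lebesgue measure on the circle\<close>

text \<open>The measure before completion. Measures of Borel sets are computed with it and then
  carried over to \<open>LebT\<close>.\<close>

definition LebT0 :: "T1 measure" where
  "LebT0 = distr (restrict_space lborel {0..<1}) borel abs_T1"

lemma LebT_eq: "LebT = completion LebT0"
  by (simp add: LebT_def LebT0_def)

lemma sets_LebT0 [simp]: "sets LebT0 = sets borel" and space_LebT0 [simp]: "space LebT0 = UNIV"
  by (simp_all add: LebT0_def)

lemma space_LebT [simp]: "space LebT = UNIV"
  by (simp add: LebT_eq)

lemma borel_imp_LebT: "A \<in> sets borel \<Longrightarrow> A \<in> sets LebT"
  by (simp add: LebT_eq sets_completionI_sets)

lemma measurable_abs_T1 [measurable]: "abs_T1 \<in> borel_measurable borel"
  by (intro borel_measurable_continuous_onI continuous_abs_T1)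

lemma measurable_rotT [measurable]: "rotT c \<in> borel_measurable borel"
  by (intro borel_measurable_continuous_onI continuous_rotT)

lemma emeasure_LebT0:
  assumes "A \<in> sets borel"
  shows "emeasure LebT0 A = emeasure lborel (abs_T1 -` A \<inter> {0..<1})"
proof -
  have "abs_T1 \<in> measurable (restrict_space lborel {0..<1}) borel"
    by (intro measurable_restrict_space1) (simp add: measurable_abs_T1)
  then show ?thesis using assms
    by (simp add: LebT0_def emeasure_distr space_restrict_space emeasure_restrict_space)
qed

lemma emeasure_LebT_borel: "A \<in> sets borel \<Longrightarrow> emeasure LebT A = emeasure LebT0 A"
  by (simp add: LebT_eq emeasure_completion)

lemma emeasure_LebT_UNIV [simp]: "emeasure LebT UNIV = 1"
  by (simp add: emeasure_LebT_borel emeasure_LebT0)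

interpretation LebT: finite_measure LebT
  by standard simp

lemma emeasure_lborel_shift:
  assumes "P \<in> sets borel"
  shows "emeasure lborel ((\<lambda>u::real. u + c) -` P) = emeasure lborel P"
proof -
  have "emeasure lborel P = emeasure (distr lborel borel ((+) c)) P"
    by (simp add: lborel_distr_plus)
  also have "\<dots> = emeasure lborel ((+) c -` P)"
    using assms by (subst emeasure_distr) auto
  also have "(+) c -` P = (\<lambda>u. u + c) -` P" by (auto simp: add.commute)
  finally show ?thesis by simp
qed

text \<open>A shift by the integer part of \<open>a\<close> reduces to a left end in [0, 1); the
  piece beyond 1 is then moved back by one period.\<close>

lemma emeasure_periodic:
  fixes P :: "real set"
  assumes P: "P \<in> sets borel" and per: "\<And>u (k::int). u + of_int k \<in> P \<longleftrightarrow> u \<in> P"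
  shows "emeasure lborel (P \<inter> {a..<a+1}) = emeasure lborel (P \<inter> {0..<1})"
proof -
  have 1: "emeasure lborel (P \<inter> {a..<a+1}) = emeasure lborel (P \<inter> {frac a..<frac a + 1})"
  proof -
    have "(\<lambda>u. u + of_int \<lfloor>a\<rfloor>) -` (P \<inter> {a..<a+1}) = P \<inter> {frac a..<frac a + 1}"
      by (auto simp: per frac_def)
    then show ?thesis using emeasure_lborel_shift[of "P \<inter> {a..<a+1}" "of_int \<lfloor>a\<rfloor>"] P by simp
  qed
  define f where "f = frac a"
  have f: "0 \<le> f" "f < 1" by (auto simp: f_def frac_lt_1)
  have "P \<inter> {f..<f+1} = (P \<inter> {f..<1}) \<union> (P \<inter> {1..<f+1})" using f by auto
  also have "emeasure lborel \<dots> = emeasure lborel (P \<inter> {f..<1}) + emeasure lborel (P \<inter> {1..<f+1})"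
    using P by (intro plus_emeasure[symmetric]) auto
  also have "emeasure lborel (P \<inter> {1..<f+1}) = emeasure lborel (P \<inter> {0..<f})"
  proof -
    have "(\<lambda>u. u + 1) -` (P \<inter> {1..<f+1}) = P \<inter> {0..<f}"
      using per[of _ 1] by auto
    then show ?thesis using emeasure_lborel_shift[of "P \<inter> {1..<f+1}" 1] P by simp
  qed
  also have "emeasure lborel (P \<inter> {f..<1}) + emeasure lborel (P \<inter> {0..<f}) =
    emeasure lborel ((P \<inter> {f..<1}) \<union> (P \<inter> {0..<f}))"
    using P by (intro plus_emeasure) auto
  also have "(P \<inter> {f..<1}) \<union> (P \<inter> {0..<f}) = P \<inter> {0..<1}" using f by auto
  finally show ?thesis using 1 by (simp add: f_def)
qed

lemma emeasure_LebT0_rotT: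
  assumes A: "A \<in> sets borel"
  shows "emeasure LebT0 (rotT c -` A) = emeasure LebT0 A"
proof -
  have rA: "rotT c -` A \<in> sets borel" using measurable_sets_borel[OF measurable_rotT A] .
  define P where "P = abs_T1 -` A"
  have P: "P \<in> sets borel" unfolding P_def using measurable_sets_borel[OF measurable_abs_T1 A] .
  have per: "u + of_int k \<in> P \<longleftrightarrow> u \<in> P" for u and k :: int by (simp add: P_def)
  have "emeasure LebT0 (rotT c -` A) = emeasure lborel ((\<lambda>u. u + c) -` (P \<inter> {c..<c+1}))"
    unfolding emeasure_LebT0[OF rA] by (rule arg_cong[where f="emeasure lborel"]) (auto simp: P_def)
  also have "\<dots> = emeasure lborel (P \<inter> {c..<c+1})"
    using P by (intro emeasure_lborel_shift) auto
  also have "\<dots> = emeasure LebT0 A"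
    unfolding emeasure_periodic[OF P per] emeasure_LebT0[OF A] by (simp add: P_def)
  finally show ?thesis .
qed

lemma null_sets_LebT_rotT: "A \<in> null_sets LebT \<Longrightarrow> rotT c -` A \<in> null_sets LebT"
proof -
  assume "A \<in> null_sets LebT"
  then obtain N where N: "N \<in> null_sets LebT0" "A \<subseteq> N"
    by (auto simp: LebT_eq null_sets_completion_iff2)
  then have "rotT c -` N \<in> null_sets LebT0"
    using measurable_sets_borel[OF measurable_rotT, of N c] emeasure_LebT0_rotT[of N c]
    by (auto simp: null_sets_def)
  then show ?thesis using N unfolding LebT_eq null_sets_completion_iff2 by blast
qed

lemma AE_LebT_rotT: "AE \<theta> in LebT. P \<theta> \<Longrightarrow> AE \<theta> in LebT. P (rotT c \<theta>)"
proof -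
  assume "AE \<theta> in LebT. P \<theta>"
  then obtain N where N: "N \<in> null_sets LebT" "{\<theta>. \<not> P \<theta>} \<subseteq> N"
    by (auto simp: eventually_ae_filter)
  show ?thesis
    by (rule AE_I'[OF null_sets_LebT_rotT[OF N(1), of c]]) (use N(2) in auto)
qed

text \<open>Graphs over sets of the completed algebra need not be Borel, and ergodicity is available
  for Borel sets only; such sets are therefore replaced by a Borel subset of the same
  measure.\<close>

lemma sets_LebT_sandwich:
  assumes "A \<in> sets LebT"
  obtains B where "B \<in> sets borel" "B \<subseteq> A" "A - B \<in> null_sets LebT"
proof -
  obtain S N N' where h: "A = S \<union> N" "N \<subseteq> N'" "N' \<in> null_sets LebT0" "S \<in> sets LebT0"
    using assms unfolding LebT_eq by (rule sets_completionE)
  have "A - S \<subseteq> N'" using h by auto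
  then have "A - S \<in> null_sets LebT" using h(3) unfolding LebT_eq null_sets_completion_iff2 by blast
  then show thesis using h by (intro that[of S]) auto
qed

lemma emeasure_LebT_rotT:
  assumes A: "A \<in> sets LebT"
  shows "rotT c -` A \<in> sets LebT" "emeasure LebT (rotT c -` A) = emeasure LebT A"
proof -
  obtain B where B: "B \<in> sets borel" "B \<subseteq> A" "A - B \<in> null_sets LebT"
    by (rule sets_LebT_sandwich[OF A])
  have eq: "A = B \<union> (A - B)" and eq': "rotT c -` A = rotT c -` B \<union> rotT c -` (A - B)" using B(2) by auto
  have rB: "rotT c -` B \<in> sets borel" using measurable_sets_borel[OF measurable_rotT B(1)] .
  note rN = null_sets_LebT_rotT[OF B(3), of c]
  show "rotT c -` A \<in> sets LebT" unfolding eq' using rN borel_imp_LebT[OF rB] by auto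
  have "emeasure LebT (rotT c -` A) = emeasure LebT (rotT c -` B)"
    unfolding eq' using rN rB by (intro emeasure_Un_null_set borel_imp_LebT)
  also have "\<dots> = emeasure LebT B"
    using B(1) rB by (simp add: emeasure_LebT_borel emeasure_LebT0_rotT)
  also have "\<dots> = emeasure LebT A"
    using emeasure_Un_null_set[OF borel_imp_LebT[OF B(1)] B(3)] eq by simp
  finally show "emeasure LebT (rotT c -` A) = emeasure LebT A" .
qed

lemma emeasure_LebT_cball_le:
  assumes "r \<ge> 0"
  shows "emeasure LebT (cball x r) \<le> ennreal (2 * r)"
proof -
  obtain u where u: "x = abs_T1 u" by (rule T1_cases)
  have cb: "cball x r \<in> sets borel" by auto
  \<comment> \<open>The centre is moved to 1/2, since every representative in \<open>{0..<1}\<close>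
    is within 1/2 of it and there the circle distance is the ordinary one.\<close>
  have "rotT (u - 1/2) -` cball x r = cball (abs_T1 (1/2)) r"
  proof (rule set_eqI)
    fix y
    have "x = rotT (u - 1/2) (abs_T1 (1/2))" by (simp add: u)
    then have "dist x (rotT (u - 1/2) y) = dist (abs_T1 (1/2)) y" by (metis dist_rotT)
    then show "y \<in> rotT (u - 1/2) -` cball x r \<longleftrightarrow> y \<in> cball (abs_T1 (1/2)) r" by simp
  qed
  then have "emeasure LebT (cball x r) = emeasure LebT0 (cball (abs_T1 (1/2)) r)"
    using emeasure_LebT_rotT(2)[OF borel_imp_LebT[OF cb], of "u - 1/2"] by (simp add: emeasure_LebT_borel)
  also have "\<dots> = emeasure lborel (abs_T1 -` cball (abs_T1 (1/2)) r \<inter> {0..<1})"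
    by (simp add: emeasure_LebT0)
  also have "\<dots> \<le> emeasure lborel {1/2 - r..1/2 + r}"
  proof (rule emeasure_mono)
    show "abs_T1 -` cball (abs_T1 (1/2)) r \<inter> {0..<1} \<subseteq> {1/2 - r..1/2 + r}"
    proof
      fix t assume t: "t \<in> abs_T1 -` cball (abs_T1 (1/2)) r \<inter> {0..<1}"
      then have "\<bar>1/2 - t\<bar> \<le> 1/2" unfolding abs_le_iff by simp
      then have "dist (abs_T1 (1/2)) (abs_T1 t) = \<bar>1/2 - t\<bar>" by (rule dist_abs_T1_eq)
      then show "t \<in> {1/2 - r..1/2 + r}" using t by auto
    qed
  qed auto
  also have "\<dots> = ennreal (2 * r)" using assms by simp
  finally show ?thesis .
qed

section \<open>One-dimensional Hausdorff measure\<close>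

lemma sum_lessThan_double:
  fixes f :: "nat \<Rightarrow> 'a::comm_monoid_add"
  shows "(\<Sum>k<2 * n. f k) = (\<Sum>k<n. f (2 * k)) + (\<Sum>k<n. f (2 * k + 1))"
  by (induction n) (simp_all add: ac_simps)

text \<open>\<open>X - F\<close> is cut into layers \<open>D n\<close> by the distance to
  \<open>F\<close>. Layers of equal parity are separated from each other, so the values
  \<open>H (D n)\<close> sum to at most \<open>2 * H X\<close> and have small tails. Up to such a
  tail \<open>X - F\<close> equals \<open>Fn N\<close>, which has positive distance from
  \<open>F\<close>.\<close>

lemma metric_outer_measure_closed:
  fixes H :: "'a::metric_space set \<Rightarrow> ennreal"
  assumes oms: "outer_measure_space UNIV H"
    and metric: "\<And>A B e. e > 0 \<Longrightarrow> (\<And>x y. x \<in> A \<Longrightarrow> y \<in> B \<Longrightarrow> e \<le> dist x y) \<Longrightarrow> H A + H B \<le> H (A \<union> B)"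
    and F: "closed F"
  shows "H (X \<inter> F) + H (X - F) \<le> H X"
\<comment> \<open>Both excluded cases are trivial but harmful later: \<open>infdist\<close> to the
  empty set is 0 by convention, and \<open>enn2real\<close> sends \<open>top\<close> to 0.\<close>
proof (cases "F = {} \<or> H X = top")
  case True
  have "H {} = 0" using oms by (simp add: outer_measure_space_def positive_def)
  then show ?thesis using True by (auto simp: top_greatest)
next
  case False
  then have ne: "F \<noteq> {}" and fin: "H X < top" by (auto simp: less_top)
  have mono: "A \<subseteq> B \<Longrightarrow> H A \<le> H B" for A B
    using oms by (simp add: outer_measure_space_def increasing_def)
  have csub: "H (\<Union>i. A i) \<le> (\<Sum>i. H (A i))" if "disjoint_family A" for A :: "nat \<Rightarrow> 'a set"
    using oms that by (simp add: outer_measure_space_def countably_subadditive_def)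
  have empty: "H {} = 0" using oms by (simp add: outer_measure_space_def positive_def)
  have sub2: "H (A \<union> B) \<le> H A + H B" if "A \<inter> B = {}" for A B
  proof -
    have "H (A \<union> B) \<le> H (\<Union>i::nat. if i = 0 then A else if i = 1 then B else {})"
      by (intro mono) (auto split: if_splits)
    also have "\<dots> \<le> (\<Sum>i::nat. H (if i = 0 then A else if i = 1 then B else {}))"
      using that by (intro csub) (auto simp: disjoint_family_on_def)
    also have "\<dots> = (\<Sum>i\<in>{0,1::nat}. H (if i = 0 then A else if i = 1 then B else {}))"
      by (rule suminf_finite) (auto simp: empty)
    finally show ?thesis by simp
  qed
  define d where "d x = infdist x F" for x
  define r where "r n = 1 / real (Suc n)" for n
  define Fn where "Fn n = {x \<in> X. d x \<ge> r n}" for n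
  define D where "D n = {x \<in> X. r (Suc n) \<le> d x \<and> d x < r n}" for n
  have r: "r n > 0" "r (Suc n) < r n" for n by (auto simp: r_def field_simps)
  have r_mono: "m \<le> n \<Longrightarrow> r n \<le> r m" for m n by (auto simp: r_def field_simps)
  have d_dist: "d x \<le> d y + dist x y" for x y unfolding d_def by (rule infdist_triangle)
  have FnX: "H (X \<inter> F) + H (Fn n) \<le> H X" for n
  proof -
    have "H (X \<inter> F) + H (Fn n) \<le> H ((X \<inter> F) \<union> Fn n)"
    proof (rule metric[OF r(1)[of n]])
      fix x y assume "x \<in> X \<inter> F" "y \<in> Fn n"
      then have "d x = 0" "d y \<ge> r n" by (auto simp: Fn_def d_def)
      then show "r n \<le> dist x y" using d_dist[of y x] by (simp add: dist_commute)
    qed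
    also have "\<dots> \<le> H X" by (intro mono) (auto simp: Fn_def)
    finally show ?thesis .
  qed
  \<comment> \<open>\<open>p\<close> is the parity. The skipped layer in between provides the gap
    \<open>?e\<close> that the metric hypothesis asks for.\<close>
  have layers: "(\<Sum>k<m. H (D (2 * k + p))) \<le> H (\<Union>k<m. D (2 * k + p))" for m p
  proof (induction m)
    case (Suc m)
    have "(\<Sum>k<Suc m. H (D (2 * k + p))) \<le> H (\<Union>k<m. D (2 * k + p)) + H (D (2 * m + p))"
      using Suc by (simp add: add_right_mono)
    also have "\<dots> \<le> H ((\<Union>k<m. D (2 * k + p)) \<union> D (2 * m + p))"
    proof (cases m)
      case 0 then show ?thesis by (simp add: empty)
    next
      case (Suc m')
      let ?e = "r (2 * m' + p + 1) - r (2 * m' + p + 2)"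
      show ?thesis
      proof (rule metric[of ?e])
        show "?e > 0" using r(2)[of "2 * m' + p + 1"] by simp
        fix x y assume "x \<in> (\<Union>k<m. D (2 * k + p))" and y: "y \<in> D (2 * m + p)"
        then obtain k where k: "k \<le> m'" "x \<in> D (2 * k + p)" using Suc by (auto simp: less_Suc_eq_le)
        have "r (2 * m' + p + 1) \<le> r (2 * k + p + 1)" by (rule r_mono) (use k in simp)
        also have "\<dots> \<le> d x" using k by (simp add: D_def)
        finally have "r (2 * m' + p + 1) \<le> d x" .
        moreover have "d y < r (2 * m' + p + 2)" using y Suc by (simp add: D_def)
        ultimately show "?e \<le> dist x y" using d_dist[of x y] by simp
      qed
    qed
    also have "(\<Union>k<m. D (2 * k + p)) \<union> D (2 * m + p) = (\<Union>k<Suc m. D (2 * k + p))"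
      by (auto simp: less_Suc_eq)
    finally show ?case .
  qed (simp add: empty)
  have half: "(\<Sum>k<m. H (D (2 * k + p))) \<le> H X" for m p
    by (rule order_trans[OF layers mono]) (auto simp: D_def)
  have Dfin: "H (D k) < top" for k
    by (rule le_less_trans[OF mono fin]) (auto simp: D_def)
  define h where "h k = enn2real (H (D k))" for k
  have hH: "ennreal (h k) = H (D k)" for k using Dfin[of k] by (simp add: h_def)
  have h0: "h k \<ge> 0" for k by (simp add: h_def)
  have summ: "summable h"
  proof (rule bounded_imp_summable)
    fix n
    show "h n \<ge> 0" by (simp add: h_def)
    have "ennreal (\<Sum>k\<le>n. h k) = (\<Sum>k\<le>n. H (D k))"
      unfolding hH[symmetric] by (rule sum_ennreal[symmetric]) (simp add: h_def)
    also have "\<dots> \<le> (\<Sum>k<2 * Suc n. H (D k))" by (intro sum_mono2) auto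
    also have "\<dots> = (\<Sum>k<Suc n. H (D (2 * k))) + (\<Sum>k<Suc n. H (D (2 * k + 1)))"
      by (rule sum_lessThan_double)
    also have "\<dots> \<le> H X + H X"
      using half[of 0 "Suc n"] half[of 1 "Suc n"] by (intro add_mono) simp_all
    also have "\<dots> = ennreal (2 * enn2real (H X))"
      using fin by (cases "H X") (auto simp: ennreal_plus[symmetric] simp del: ennreal_plus)
    finally show "(\<Sum>k\<le>n. h k) \<le> 2 * enn2real (H X)"
      by (simp add: ennreal_le_iff)
  qed
  show ?thesis
  proof (rule ennreal_le_epsilon)
    fix e :: real assume e: "0 < e"
    obtain N where N: "\<And>n. n \<ge> N \<Longrightarrow> norm (\<Sum>i. h (i + n)) < e"
      using suminf_exist_split[OF e summ] by metis
    have cover: "X - F \<subseteq> Fn N \<union> (\<Union>i. D (i + N))"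
    proof
      fix x assume x: "x \<in> X - F"
      then have "d x > 0" unfolding d_def using F ne
        by (metis DiffD2 in_closed_iff_infdist_zero infdist_nonneg less_eq_real_def)
      then obtain m where m: "r m \<le> d x"
        unfolding r_def using nat_approx_posE less_imp_le by metis
      show "x \<in> Fn N \<union> (\<Union>i. D (i + N))"
      proof (cases "d x \<ge> r N")
        case True then show ?thesis using x by (auto simp: Fn_def)
      next
        case False
        define k where "k = (LEAST k. r k \<le> d x)"
        have k: "r k \<le> d x" unfolding k_def using m by (rule LeastI)
        have "k > N"
        proof (rule ccontr)
          assume "\<not> N < k" then show False using r_mono[of k N] k False by simp
        qed
        then obtain j where j: "k = Suc j" "j \<ge> N" by (cases k) auto
        have "\<not> r j \<le> d x" using not_less_Least[of j "\<lambda>k. r k \<le> d x"] j by (simp add: k_def)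
        then have "x \<in> D ((j - N) + N)" using k j x by (auto simp: D_def)
        then show ?thesis by blast
      qed
    qed
    \<comment> \<open>Countable subadditivity of \<open>outer_measure_space\<close> is stated for
      disjoint families only.\<close>
    have D_disj: "D m \<inter> D n = {}" if "m < n" for m n
      using r_mono[of "Suc m" n] that by (auto simp: D_def)
    then have "disjoint_family (\<lambda>i. D (i + N))"
      unfolding disjoint_family_on_def by (metis Int_commute add_right_cancel linorder_neqE_nat)
    moreover have "Fn N \<inter> (\<Union>i. D (i + N)) = {}"
    proof -
      have "Fn N \<inter> D (i + N) = {}" for i using r_mono[of N "i + N"] by (auto simp: Fn_def D_def)
      then show ?thesis by blast
    qed
    ultimately have "H (X - F) \<le> H (Fn N) + (\<Sum>i. H (D (i + N)))"
      using mono[OF cover] sub2[of "Fn N" "\<Union>i. D (i + N)"] csub[of "\<lambda>i. D (i + N)"]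
      by (meson add_left_mono order_trans)
    also have "(\<Sum>i. H (D (i + N))) = ennreal (\<Sum>i. h (i + N))"
      unfolding hH[symmetric] using summ h0 by (intro suminf_ennreal2) (simp_all add: summable_iff_shift)
    also have "\<dots> \<le> ennreal e" using N[of N] by (intro ennreal_leI) auto
    finally have "H (X - F) \<le> H (Fn N) + ennreal e" by (simp add: add_left_mono)
    then have "H (X \<inter> F) + H (X - F) \<le> H (X \<inter> F) + (H (Fn N) + ennreal e)" by (rule add_left_mono)
    also have "\<dots> \<le> H X + ennreal e" using FnX[of N] by (simp add: add.assoc[symmetric] add_right_mono)
    finally show "H (X \<inter> F) + H (X - F) \<le> H X + ennreal e" .
  qed
qed

text \<open>\<open>measure_of\<close> yields the zero measure unless the given set function is a
  measure on the generated algebra. Closed sets belong to the Caratheodory system of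
  \<open>H\<close>, hence all Borel sets do, and there \<open>H\<close> is countably
  additive.\<close>

lemma metric_outer_measure_borel:
  fixes H :: "'a::metric_space set \<Rightarrow> ennreal"
  assumes oms: "outer_measure_space UNIV H"
    and metric: "\<And>A B e. e > 0 \<Longrightarrow> (\<And>x y. x \<in> A \<Longrightarrow> y \<in> B \<Longrightarrow> e \<le> dist x y) \<Longrightarrow> H A + H B \<le> H (A \<union> B)"
    and A: "A \<in> sets borel"
  shows "emeasure (measure_of UNIV (sets borel) H) A = H A"
proof -
  interpret sigma_algebra "UNIV :: 'a set" UNIV
    using sigma_algebra_Pow[of "UNIV :: 'a set"] by simp
  let ?L = "lambda_system UNIV UNIV H"
  have ms: "measure_space UNIV ?L H" by (rule caratheodory_lemma[OF oms])
  then have sa: "sigma_algebra UNIV ?L" and ca: "countably_additive ?L H" and pos: "positive ?L H"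
    by (auto simp: measure_space_def)
  have cl: "F \<in> ?L" if "closed F" for F
    unfolding lambda_system_eq
  proof (safe)
    fix X
    have "X \<subseteq> (\<Union>i::nat. if i = 0 then X \<inter> F else if i = 1 then X - F else {})"
      by (auto split: if_splits)
    then have "H X \<le> H (\<Union>i::nat. if i = 0 then X \<inter> F else if i = 1 then X - F else {})"
      using oms by (simp only: outer_measure_space_def increasing_def) blast
    also have "\<dots> \<le> (\<Sum>i::nat. H (if i = 0 then X \<inter> F else if i = 1 then X - F else {}))"
    proof -
      have "disjoint_family (\<lambda>i::nat. if i = 0 then X \<inter> F else if i = 1 then X - F else {})"
        by (auto simp: disjoint_family_on_def)
      then show ?thesis using oms by (simp only: outer_measure_space_def countably_subadditive_def) blast
    qed
    also have "\<dots> = (\<Sum>i\<in>{0,1::nat}. H (if i = 0 then X \<inter> F else if i = 1 then X - F else {}))"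
      using oms by (intro suminf_finite) (auto simp: outer_measure_space_def positive_def)
    finally have "H X \<le> H (X \<inter> F) + H (X - F)" by simp
    moreover have "H (X \<inter> F) + H (X - F) \<le> H X"
      by (rule metric_outer_measure_closed[OF oms metric that])
    ultimately show "H (X \<inter> F) + H (X - F) = H X" by (rule antisym[rotated])
  qed auto
  have "sigma_sets UNIV (Collect closed) \<subseteq> ?L"
    by (rule sigma_algebra.sigma_sets_subset[OF sa]) (use cl in auto)
  then have sub: "sets (borel :: 'a measure) \<subseteq> ?L"
    by (simp add: borel_eq_closed sets_measure_of)
  show ?thesis
  proof (rule emeasure_measure_of)
    show "positive (sets (measure_of UNIV (sets borel) H)) H"
      using pos by (auto simp: positive_def)
    show "countably_additive (sets (measure_of UNIV (sets borel) H)) H"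
      using ca sub unfolding countably_additive_def
      by (simp add: sets.sigma_sets_eq[of borel, simplified]) blast
    show "A \<in> sets (measure_of UNIV (sets borel) H)"
      using A by (simp add: sets.sigma_sets_eq[of borel, simplified])
  qed auto
qed

section \<open>One-dimensional Hausdorff measure through covers at a fixed scale\<close>

definition H1_pre :: "real \<Rightarrow> 'a::metric_space set \<Rightarrow> ennreal" where
  "H1_pre \<delta> A = (INF U\<in>{U :: nat \<Rightarrow> 'a set. A \<subseteq> (\<Union>i. U i) \<and> (\<forall>i. bounded (U i) \<and> diameter (U i) \<le> \<delta>)}.
        (\<Sum>i. ennreal (diameter (U i))))"

lemma H1_outer_eq: "H1_outer A = (SUP \<delta>\<in>{0<..}. H1_pre \<delta> A)"
  by (simp add: H1_outer_def H1_pre_def)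

lemma H1_pre_le_outer: "\<delta> > 0 \<Longrightarrow> H1_pre \<delta> A \<le> H1_outer A"
  unfolding H1_outer_eq by (intro SUP_upper) auto

lemma H1_pre_le:
  "A \<subseteq> (\<Union>i. U i) \<Longrightarrow> (\<And>i. bounded (U i)) \<Longrightarrow> (\<And>i. diameter (U i) \<le> \<delta>) \<Longrightarrow>
    H1_pre \<delta> A \<le> (\<Sum>i. ennreal (diameter (U i)))" for U :: "nat \<Rightarrow> _"
  unfolding H1_pre_def by (intro INF_lower) auto

lemma H1_pre_lessD:
  assumes "H1_pre \<delta> A < c"
  obtains U :: "nat \<Rightarrow> _" where "A \<subseteq> (\<Union>i. U i)" "\<And>i. bounded (U i)" "\<And>i. diameter (U i) \<le> \<delta>"
    "(\<Sum>i. ennreal (diameter (U i))) < c"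
  using assms unfolding H1_pre_def INF_less_iff by blast

lemma H1_pre_mono: "A \<subseteq> B \<Longrightarrow> H1_pre \<delta> A \<le> H1_pre \<delta> B"
  unfolding H1_pre_def by (intro INF_superset_mono) auto

lemma H1_pre_antimono: "\<delta> \<le> \<delta>' \<Longrightarrow> H1_pre \<delta>' A \<le> H1_pre \<delta> A"
  unfolding H1_pre_def by (intro INF_superset_mono) (auto intro: order_trans)

lemma H1_outer_empty [simp]: "H1_outer {} = 0"
proof -
  have "H1_pre \<delta> ({} :: 'a set) = 0" if "\<delta> > 0" for \<delta>
    using H1_pre_le[of "{}" "\<lambda>_. {} :: 'a set" \<delta>] that by simp
  then have "(SUP \<delta>\<in>{0<..}. H1_pre \<delta> ({} :: 'a set)) \<le> 0" by (intro SUP_least) auto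
  then show ?thesis unfolding H1_outer_eq by simp
qed

lemma H1_outer_mono: "A \<subseteq> B \<Longrightarrow> H1_outer A \<le> H1_outer B"
  unfolding H1_outer_eq by (intro SUP_mono) (auto intro: H1_pre_mono)

lemma H1_pre_countable_subadditive: "H1_pre \<delta> (\<Union>i. A i) \<le> (\<Sum>i::nat. H1_pre \<delta> (A i))"
proof (rule ennreal_le_epsilon)
  fix e :: real assume "0 < e" and fin: "(\<Sum>i. H1_pre \<delta> (A i)) < top"
  then have *: "H1_pre \<delta> (A n) < H1_pre \<delta> (A n) + e * (1/2)^Suc n" for n
    by (auto simp add: less_top dest!: ennreal_suminf_lessD)
  have "\<exists>U :: nat \<Rightarrow> 'a set. A n \<subseteq> (\<Union>i. U i) \<and> (\<forall>i. bounded (U i) \<and> diameter (U i) \<le> \<delta>) \<and>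
    (\<Sum>i. ennreal (diameter (U i))) < H1_pre \<delta> (A n) + e * (1/2)^Suc n" for n
    using H1_pre_lessD[OF *] by metis
  then obtain B :: "nat \<Rightarrow> nat \<Rightarrow> 'a set" where B: "\<And>n. A n \<subseteq> (\<Union>i. B n i)"
    "\<And>n i. bounded (B n i)" "\<And>n i. diameter (B n i) \<le> \<delta>"
    "\<And>n. (\<Sum>i. ennreal (diameter (B n i))) < H1_pre \<delta> (A n) + e * (1/2)^Suc n"
    by metis
  define C where "C = case_prod B o prod_decode"
  have "(\<Union>i. A i) \<subseteq> (\<Union>i. C i)"
    using B(1) by (auto simp add: C_def subset_eq) (metis prod.case prod_encode_inverse)
  then have "H1_pre \<delta> (\<Union>i. A i) \<le> (\<Sum>i. ennreal (diameter (C i)))"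
    by (rule H1_pre_le) (auto simp: C_def split_def B)
  also have "\<dots> = (\<Sum>n. \<Sum>i. ennreal (diameter (B n i)))"
    unfolding C_def comp_def
    by (subst suminf_ennreal_2dimen[symmetric, where f="\<lambda>x. ennreal (diameter (case_prod B x))"]) auto
  also have "\<dots> \<le> (\<Sum>n. H1_pre \<delta> (A n) + e * (1/2) ^ Suc n)"
    using B(4) by (intro suminf_le) (auto intro: less_imp_le)
  also have "... = (\<Sum>n. H1_pre \<delta> (A n)) + (\<Sum>n. ennreal e * ennreal ((1/2) ^ Suc n))"
    using \<open>0 < e\<close> by (subst suminf_add[symmetric])
                     (auto simp del: ennreal_suminf_cmult simp add: ennreal_mult[symmetric])
  also have "\<dots> = (\<Sum>n. H1_pre \<delta> (A n)) + e"
    unfolding ennreal_suminf_cmult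
    by (subst suminf_ennreal_eq[OF zero_le_power power_half_series]) auto
  finally show "H1_pre \<delta> (\<Union>i. A i) \<le> (\<Sum>i. H1_pre \<delta> (A i)) + ennreal e" .
qed

lemma outer_measure_space_H1: "outer_measure_space UNIV (H1_outer :: 'a::metric_space set \<Rightarrow> ennreal)"
  unfolding outer_measure_space_def
proof (intro conjI)
  show "positive UNIV (H1_outer :: 'a set \<Rightarrow> ennreal)" by (simp add: positive_def)
  show "increasing UNIV (H1_outer :: 'a set \<Rightarrow> ennreal)" by (simp add: increasing_def H1_outer_mono)
  show "countably_subadditive UNIV (H1_outer :: 'a set \<Rightarrow> ennreal)"
    unfolding countably_subadditive_def
  proof safe
    fix A :: "nat \<Rightarrow> 'a set"
    have "H1_pre \<delta> (\<Union>i. A i) \<le> (\<Sum>i. H1_outer (A i))" if "\<delta> > 0" for \<delta>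
      by (rule order_trans[OF H1_pre_countable_subadditive]) (auto intro!: suminf_le H1_pre_le_outer that)
    then show "H1_outer (\<Union>i. A i) \<le> (\<Sum>i. H1_outer (A i))"
      unfolding H1_outer_eq[of "\<Union>i. A i"] by (intro SUP_least) auto
  qed
qed

text \<open>At a scale below \<open>e\<close> no set of a cover meets both \<open>A\<close> and
  \<open>B\<close>, so a cover of the union splits into two disjoint subfamilies covering
  \<open>A\<close> and \<open>B\<close>.\<close>

lemma H1_outer_metric:
  assumes e: "e > 0" and sep: "\<And>x y. x \<in> A \<Longrightarrow> y \<in> B \<Longrightarrow> e \<le> dist x y"
  shows "H1_outer A + H1_outer B \<le> H1_outer (A \<union> B)"
proof -
  have *: "H1_pre \<delta> A + H1_pre \<delta> B \<le> H1_pre \<delta> (A \<union> B)" if \<delta>: "0 < \<delta>" "\<delta> < e" for \<delta>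
    unfolding H1_pre_def[of \<delta> "A \<union> B"]
  proof (rule INF_greatest, clarify)
    fix U :: "nat \<Rightarrow> 'a set"
    assume U: "A \<union> B \<subseteq> (\<Union>i. U i)" "\<forall>i. bounded (U i) \<and> diameter (U i) \<le> \<delta>"
    define V where "V X i = (if U i \<inter> X = {} then {} else U i)" for X i
    have V: "H1_pre \<delta> X \<le> (\<Sum>i. ennreal (diameter (V X i)))" if "X \<subseteq> A \<union> B" for X
    proof (rule H1_pre_le)
      show "X \<subseteq> (\<Union>i. V X i)"
      proof
        fix x assume "x \<in> X"
        then have "x \<in> (\<Union>i. U i)" using that U(1) by blast
          then obtain i where "x \<in> U i" by blast
        then show "x \<in> (\<Union>i. V X i)" using \<open>x \<in> X\<close> by (auto simp: V_def intro!: exI[of _ i])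
      qed
    qed (use U \<delta> in \<open>auto simp: V_def\<close>)
    have "H1_pre \<delta> A + H1_pre \<delta> B \<le> (\<Sum>i. ennreal (diameter (V A i))) + (\<Sum>i. ennreal (diameter (V B i)))"
      by (intro add_mono V) auto
    also have "\<dots> = (\<Sum>i. ennreal (diameter (V A i)) + ennreal (diameter (V B i)))"
      by (rule suminf_add) auto
    also have "\<dots> \<le> (\<Sum>i. ennreal (diameter (U i)))"
    proof (rule suminf_le)
      fix i
      have "U i \<inter> A = {} \<or> U i \<inter> B = {}"
      proof (rule ccontr)
        assume "\<not> (U i \<inter> A = {} \<or> U i \<inter> B = {})"
        then obtain x y where "x \<in> U i" "x \<in> A" "y \<in> U i" "y \<in> B" by blast
        then have "e \<le> dist x y" "dist x y \<le> diameter (U i)"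
          using sep U(2) by (auto intro: diameter_bounded_bound)
        then show False using U(2) \<delta> by (meson less_le_trans not_le order_trans)
      qed
      then show "ennreal (diameter (V A i)) + ennreal (diameter (V B i)) \<le> ennreal (diameter (U i))"
        by (auto simp: V_def)
    qed auto
    finally show "H1_pre \<delta> A + H1_pre \<delta> B \<le> (\<Sum>i. ennreal (diameter (U i)))" .
  qed
  have **: "H1_pre \<delta> A + H1_pre \<delta>' B \<le> H1_outer (A \<union> B)" if "\<delta> > 0" "\<delta>' > 0" for \<delta> \<delta>'
  proof -
    let ?d = "min (min \<delta> \<delta>') (e/2)"
    have "H1_pre \<delta> A + H1_pre \<delta>' B \<le> H1_pre ?d A + H1_pre ?d B"
      by (intro add_mono H1_pre_antimono) auto
    also have "\<dots> \<le> H1_pre ?d (A \<union> B)" using that e by (intro *) auto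
    also have "\<dots> \<le> H1_outer (A \<union> B)" using that e by (intro H1_pre_le_outer) auto
    finally show ?thesis .
  qed
  have ne: "{0<..} \<noteq> ({} :: real set)" by (metis greaterThan_non_empty)
  have "H1_outer A + H1_pre \<delta>' B \<le> H1_outer (A \<union> B)" if "\<delta>' > 0" for \<delta>'
    unfolding H1_outer_eq[of A] ennreal_SUP_add_left[OF ne, symmetric]
    using ** that by (intro SUP_least) auto
  then have "H1_pre \<delta>' B + H1_outer A \<le> H1_outer (A \<union> B)" if "\<delta>' > 0" for \<delta>'
    using that by (simp add: add.commute)
  then have "H1_outer B + H1_outer A \<le> H1_outer (A \<union> B)"
    unfolding H1_outer_eq[of B] ennreal_SUP_add_left[OF ne, symmetric]
    by (intro SUP_least) auto
  then show ?thesis by (simp add: add.commute)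
qed

lemma emeasure_H1: "A \<in> sets borel \<Longrightarrow> emeasure H1 A = H1_outer A"
  unfolding H1_def by (rule metric_outer_measure_borel[OF outer_measure_space_H1 H1_outer_metric])

lemma sets_H1 [simp]: "sets H1 = sets borel" and space_H1 [simp]: "space H1 = UNIV"
  unfolding H1_def by (simp_all add: sets.sigma_sets_eq[of borel, simplified])

section \<open>A rectifiability criterion for graph measures\<close>

text \<open>A cover of the image pulls back to the base: each of its sets that meets the image is
  replaced by a ball around one base point with the diameter as radius, and the total measure is at
  most twice the sum of the diameters.\<close>

lemma LebT_null_if_small_image:
  fixes f :: "T1 \<Rightarrow> 'a::metric_space"
  assumes proj: "\<And>\<theta> \<theta>'. \<theta> \<in> A \<Longrightarrow> \<theta>' \<in> A \<Longrightarrow> dist \<theta> \<theta>' \<le> dist (f \<theta>) (f \<theta>')"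
    and A: "A \<in> sets LebT" and null: "H1_outer (f ` A) = 0"
  shows "emeasure LebT A = 0"
proof -
  have "emeasure LebT A \<le> 0 + ennreal e" if e: "e > 0" for e :: real
  proof -
    have "H1_pre 1 (f ` A) < ennreal (e/2)"
      using H1_pre_le_outer[of 1 "f ` A"] null e by (simp add: ennreal_less_zero_iff)
    then obtain U :: "nat \<Rightarrow> _" where U: "f ` A \<subseteq> (\<Union>i. U i)" "\<And>i. bounded (U i)" "\<And>i. diameter (U i) \<le> 1"
      "(\<Sum>i. ennreal (diameter (U i))) < ennreal (e/2)"
      by (rule H1_pre_lessD) blast
    define V where "V i = (if \<exists>\<theta>\<in>A. f \<theta> \<in> U i then cball (SOME \<theta>. \<theta> \<in> A \<and> f \<theta> \<in> U i) (diameter (U i)) else {})" for i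
    have dU: "diameter (U i) \<ge> 0" for i by (rule diameter_ge_0[OF U(2)])
    have V: "V i \<in> sets LebT" for i by (auto simp: V_def intro!: borel_imp_LebT)
    have "A \<subseteq> (\<Union>i. V i)"
    proof
      fix \<theta> assume \<theta>: "\<theta> \<in> A"
      then obtain i where i: "f \<theta> \<in> U i" using U(1) by blast
      define \<theta>' where "\<theta>' = (SOME \<theta>. \<theta> \<in> A \<and> f \<theta> \<in> U i)"
      have \<theta>': "\<theta>' \<in> A" "f \<theta>' \<in> U i" using someI[of "\<lambda>\<theta>. \<theta> \<in> A \<and> f \<theta> \<in> U i" \<theta>] \<theta> i by (auto simp: \<theta>'_def)
      have "dist \<theta>' \<theta> \<le> dist (f \<theta>') (f \<theta>)" by (rule proj[OF \<theta>'(1) \<theta>])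
      also have "\<dots> \<le> diameter (U i)" by (rule diameter_bounded_bound[OF U(2) \<theta>'(2) i])
      finally have "\<theta> \<in> V i" using \<theta> i by (auto simp: V_def \<theta>'_def)
      then show "\<theta> \<in> (\<Union>i. V i)" by blast
    qed
    then have "emeasure LebT A \<le> emeasure LebT (\<Union>i. V i)"
      using V by (intro emeasure_mono) auto
    also have "\<dots> \<le> (\<Sum>i. emeasure LebT (V i))"
      using V by (intro emeasure_subadditive_countably) auto
    also have "\<dots> \<le> (\<Sum>i. ennreal 2 * ennreal (diameter (U i)))"
    proof (intro suminf_le)
      fix i show "emeasure LebT (V i) \<le> ennreal 2 * ennreal (diameter (U i))"
        using emeasure_LebT_cball_le[OF dU[of i]] dU[of i] by (simp add: V_def ennreal_mult)
    qed auto
    also have "\<dots> = ennreal 2 * (\<Sum>i. ennreal (diameter (U i)))"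
      by (rule ennreal_suminf_cmult)
    also have "\<dots> \<le> ennreal 2 * ennreal (e/2)" using U(4) by (intro mult_left_mono) auto
    also have "\<dots> = ennreal (2 * (e/2))" using e by (intro ennreal_mult[symmetric]) auto
    finally show ?thesis by simp
  qed
  then have "emeasure LebT A \<le> 0" by (rule ennreal_le_epsilon)
  then show ?thesis by simp
qed

text \<open>The circle is cut into \<open>n\<close> arcs of length \<open>1/n\<close>, whose images
  have diameter at most \<open>L/n\<close>; the total is \<open>L\<close> for every
  \<open>n\<close>. The bound serves to make the restricted Hausdorff measure sigma-finite.\<close>

lemma H1_outer_lipschitz_image_T1:
  fixes g :: "T1 \<Rightarrow> 'a::metric_space"
  assumes g: "L-lipschitz_on K g"
  shows "H1_outer (g ` K) \<le> ennreal L"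
proof -
  have L: "L \<ge> 0" using lipschitz_on_nonneg[OF g] .
  have "H1_pre \<delta> (g ` K) \<le> ennreal L" if \<delta>: "\<delta> > 0" for \<delta>
  proof -
    obtain m :: nat where m: "L / \<delta> < real m" using reals_Archimedean2 by blast
    define n where "n = Suc m"
    have n: "n > 0" "L / n \<le> \<delta>"
    proof -
      have "L < real m * \<delta>" using m \<delta> by (simp add: divide_less_eq)
      also have "\<dots> \<le> real n * \<delta>" using \<delta> by (simp add: n_def)
      finally show "L / n \<le> \<delta>" by (simp add: n_def divide_le_eq mult.commute)
    qed (simp add: n_def)
    define U where "U i = (if i < n then g ` (K \<inter> abs_T1 ` {i/n..<(i+1)/n}) else {})" for i :: nat
    have dist_U: "dist x y \<le> L / n" if xy: "x \<in> U i" "y \<in> U i" for x y i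
    proof -
      obtain s t where st: "s \<in> {i/n..<(i+1)/n}" "t \<in> {i/n..<(i+1)/n}" "abs_T1 s \<in> K" "abs_T1 t \<in> K"
        "x = g (abs_T1 s)" "y = g (abs_T1 t)"
        using xy by (auto simp: U_def split: if_splits)
      have "dist x y \<le> L * dist (abs_T1 s) (abs_T1 t)"
        using lipschitz_onD[OF g st(3,4)] st by simp
      also have "\<dots> \<le> L * \<bar>s - t\<bar>" by (intro mult_left_mono dist_abs_T1_le L)
      also have "\<dots> \<le> L * (1 / n)"
      proof (intro mult_left_mono L)
        have "(i+1)/n = i/n + 1/n" by (simp add: add_divide_distrib)
        then show "\<bar>s - t\<bar> \<le> 1/n" using st(1,2) by (auto simp: abs_le_iff)
      qed
      finally show ?thesis by simp
    qed
    have bd: "bounded (U i)" for i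
      unfolding bounded_any_center[where a="SOME x. x \<in> U i"]
    proof (intro exI ballI)
      fix y assume y: "y \<in> U i"
      show "dist (SOME x. x \<in> U i) y \<le> L / n" by (rule dist_U[OF someI[of "\<lambda>x. x \<in> U i", OF y] y])
    qed
    have diam: "diameter (U i) \<le> L / n" for i
      using L dist_U by (auto simp: diameter_def intro!: cSUP_least)
    have "H1_pre \<delta> (g ` K) \<le> (\<Sum>i. ennreal (diameter (U i)))"
    proof (rule H1_pre_le[OF _ bd order_trans[OF diam n(2)]])
      show "g ` K \<subseteq> (\<Union>i. U i)"
      proof clarify
        fix \<theta> assume \<theta>: "\<theta> \<in> K"
        obtain u where u: "\<theta> = abs_T1 u" "u \<in> {0..<0+1}" by (rule T1_cases)
        define i where "i = nat \<lfloor>u * n\<rfloor>"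
        have i: "real i \<le> u * n" "u * n < real i + 1" using u by (auto simp: i_def)
        have "u * n < n" using u n by simp
        then have "i < n" using i by linarith
        moreover have "u \<in> {i/n..<(i+1)/n}" using i n by (auto simp: field_simps)
        ultimately have "g \<theta> \<in> U i" using u \<theta> by (auto simp: U_def)
        then show "g \<theta> \<in> (\<Union>i. U i)" by blast
      qed
    qed
    also have "\<dots> = (\<Sum>i<n. ennreal (diameter (U i)))"
      by (rule suminf_finite) (auto simp: U_def)
    also have "\<dots> \<le> (\<Sum>i<n. ennreal (L / n))"
      by (intro sum_mono ennreal_leI diam)
    also have "\<dots> = ennreal L"
      using n L by (simp add: ennreal_of_nat_eq_real_of_nat ennreal_mult[symmetric])
    finally show ?thesis .
  qed
  then show ?thesis unfolding H1_outer_eq by (intro SUP_least) auto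
qed

lemma graph_measurable:
  fixes \<phi> :: "T1 \<Rightarrow> T1"
  assumes "\<phi> \<in> measurable LebT borel"
  shows "(\<lambda>\<theta>. (\<theta>, \<phi> \<theta>)) \<in> measurable LebT borel"
proof -
  have "(\<lambda>\<theta>. \<theta>) \<in> measurable LebT borel"
    by (rule measurableI) (auto intro: borel_imp_LebT)
  then show ?thesis using assms by (intro borel_measurable_Pair)
qed

text \<open>An image of a Borel set need not be Borel, but this graph is the zero set of a Borel
  function on the torus: \<open>\<phi>\<close> is continuous on \<open>B\<close> and can be
  continued by a constant.\<close>

lemma graph_borel:
  fixes \<phi> :: "T1 \<Rightarrow> T1"
  assumes B: "B \<in> sets borel" and lip: "L-lipschitz_on B \<phi>"
  shows "(\<lambda>\<theta>. (\<theta>, \<phi> \<theta>)) ` B \<in> sets borel"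
proof -
  define \<psi> where "\<psi> \<theta> = (if \<theta> \<in> B then \<phi> \<theta> else abs_T1 0)" for \<theta>
  have [measurable]: "\<psi> \<in> borel_measurable borel"
    unfolding \<psi>_def
    using B by (intro borel_measurable_continuous_on_if lipschitz_on_continuous_on[OF lip] continuous_intros)
  have [measurable]: "fst \<in> borel_measurable (borel :: (T1 \<times> T1) measure)"
    "snd \<in> borel_measurable (borel :: (T1 \<times> T1) measure)"
    by (auto intro!: borel_measurable_continuous_onI continuous_intros)
  have [measurable]: "(\<lambda>p. dist (\<psi> (fst p)) (snd p)) \<in> borel_measurable (borel :: (T1 \<times> T1) measure)"
    by (intro borel_measurable_dist) measurable
  note B[measurable]
  have "(\<lambda>\<theta>. (\<theta>, \<phi> \<theta>)) ` B = {p \<in> space borel. fst p \<in> B \<and> dist (\<psi> (fst p)) (snd p) = 0}"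
    by (auto simp: \<psi>_def)
  also have "\<dots> \<in> sets borel" by measurable
  finally show ?thesis .
qed

lemma rectifiable_graph_measure:
  fixes \<phi> :: "T1 \<Rightarrow> T1"
  assumes \<phi>: "\<phi> \<in> measurable LebT borel"
    and lip: "\<And>P::nat. \<exists>L. L-lipschitz_on (K P) \<phi>"
    and meas: "\<And>P. K P \<in> sets LebT"
    and conull: "AE \<theta> in LebT. \<theta> \<in> (\<Union>P. K P)"
  shows "rectifiable_1_measure (graph_measure \<phi>)"
proof -
  define g where "g = (\<lambda>\<theta>. (\<theta>, \<phi> \<theta>))"
  have "\<exists>B. B \<in> sets borel \<and> B \<subseteq> K P \<and> K P - B \<in> null_sets LebT" for P
    using sets_LebT_sandwich[OF meas[of P]] by metis
  then obtain B where B: "\<And>P. B P \<in> sets borel" "\<And>P. B P \<subseteq> K P" "\<And>P. K P - B P \<in> null_sets LebT"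
    by metis
  have "\<exists>L. L \<ge> 0 \<and> L-lipschitz_on (B P) \<phi>" for P
    using lip[of P] B(2)[of P] lipschitz_on_nonneg lipschitz_on_subset by blast
  then obtain L where L: "\<And>P. L P \<ge> 0" "\<And>P. (L P)-lipschitz_on (B P) \<phi>" by metis
  have glip: "(1 + L P)-lipschitz_on (B P) g" for P
  proof (rule lipschitz_onI)
    fix x y assume xy: "x \<in> B P" "y \<in> B P"
    have "dist (g x) (g y) \<le> dist x y + dist (\<phi> x) (\<phi> y)"
      unfolding g_def dist_Pair_Pair by (rule sqrt_sum_squares_le_sum) auto
    also have "\<dots> \<le> dist x y + L P * dist x y" using lipschitz_onD[OF L(2) xy] by simp
    finally show "dist (g x) (g y) \<le> (1 + L P) * dist x y" by (simp add: algebra_simps)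
  qed (use L in auto)
  define A where "A = (\<Union>P. g ` B P)"
  have gB: "g ` B P \<in> sets borel" for P unfolding g_def by (rule graph_borel[OF B(1) L(2)])
  then have A: "A \<in> sets borel" by (auto simp: A_def)
  have gm: "g \<in> measurable LebT borel" unfolding g_def by (rule graph_measurable[OF \<phi>])
  have gm_eq: "graph_measure \<phi> = distr LebT borel g" by (simp add: graph_measure_def g_def)
  have A_rect: "countably_1_rectifiable A"
    unfolding countably_1_rectifiable_def
  proof (intro exI[of _ "\<lambda>P. {0..<1} \<inter> abs_T1 -` B P"] exI[of _ "\<lambda>P. g \<circ> abs_T1"] conjI allI)
    fix P :: nat
    show "\<exists>M. M-lipschitz_on ({0..<1} \<inter> abs_T1 -` B P) (g \<circ> abs_T1)"
    proof -
      have "abs_T1 ` ({0..<1} \<inter> abs_T1 -` B P) \<subseteq> B P" by auto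
      then show ?thesis
        using lipschitz_on_compose[OF lipschitz_abs_T1 lipschitz_on_subset[OF glip]] by blast
    qed
  next
    have "A \<subseteq> (\<Union>P. (g \<circ> abs_T1) ` ({0..<1} \<inter> abs_T1 -` B P))"
    proof
      fix p assume "p \<in> A"
      then obtain P \<theta> where \<theta>: "\<theta> \<in> B P" "p = g \<theta>" by (auto simp: A_def)
      obtain u where "\<theta> = abs_T1 u" "u \<in> {0..<0+1}" by (rule T1_cases)
      then show "p \<in> (\<Union>P. (g \<circ> abs_T1) ` ({0..<1} \<inter> abs_T1 -` B P))" using \<theta> by force
    qed
    then have "A - (\<Union>i. (g \<circ> abs_T1) ` ({0..<1} \<inter> abs_T1 -` B i)) = {}" by blast
    then show "H1_outer (A - (\<Union>i. (g \<circ> abs_T1) ` ({0..<1} \<inter> abs_T1 -` B i))) = 0"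
      by (simp only: H1_outer_empty)
  qed
  \<comment> \<open>The Radon-Nikodym theorem asks for a sigma-finite measure; \<open>H1\<close> is
    restricted to \<open>A\<close>, which is a countable union of graphs of finite length.\<close>
  define \<nu> where "\<nu> = density H1 (indicator A)"
  have sets_\<nu>: "sets \<nu> = sets borel" and space_\<nu>: "space \<nu> = UNIV" by (simp_all add: \<nu>_def)
  have ind: "(indicator A :: _ \<Rightarrow> ennreal) \<in> borel_measurable H1"
    using A by (intro borel_measurable_indicator) simp
  have em\<nu>: "emeasure \<nu> X = H1_outer (A \<inter> X)" if "X \<in> sets borel" for X
  proof -
    have "emeasure \<nu> X = (\<integral>\<^sup>+x. indicator (A \<inter> X) x \<partial>H1)"
      unfolding \<nu>_def using that by (subst emeasure_density[OF ind]) (auto simp: indicator_inter_arith mult.commute intro!: nn_integral_cong)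
    also have "\<dots> = emeasure H1 (A \<inter> X)" using that A by (intro nn_integral_indicator) auto
    finally show ?thesis using that A by (simp add: emeasure_H1)
  qed
  interpret \<nu>: sigma_finite_measure \<nu>
  proof
    have "emeasure \<nu> (g ` B P) \<noteq> \<infinity>" for P
    proof -
      have "emeasure \<nu> (g ` B P) \<le> H1_outer (g ` B P)" by (subst em\<nu>[OF gB]) (auto intro: H1_outer_mono)
      also have "\<dots> \<le> ennreal (1 + L P)" by (rule H1_outer_lipschitz_image_T1[OF glip])
      finally show ?thesis by (auto simp: top_unique)
    qed
    moreover have "emeasure \<nu> (- A) \<noteq> \<infinity>" using A by (subst em\<nu>) auto
    ultimately show "\<exists>F. countable F \<and> F \<subseteq> sets \<nu> \<and> \<Union> F = space \<nu> \<and> (\<forall>a\<in>F. emeasure \<nu> a \<noteq> \<infinity>)"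
      using gB A by (intro exI[of _ "insert (- A) (range (\<lambda>P. g ` B P))"]) (auto simp: sets_\<nu> space_\<nu> A_def)
  qed
  have sets_gm: "sets (graph_measure \<phi>) = sets \<nu>" by (simp add: sets_\<nu> gm_eq)
  have em: "emeasure (graph_measure \<phi>) X = emeasure LebT (g -` X)" if "X \<in> sets borel" for X
    unfolding gm_eq using that gm by (subst emeasure_distr) auto
  have ac: "absolutely_continuous \<nu> (graph_measure \<phi>)"
    unfolding absolutely_continuous_def
  proof
    fix X assume "X \<in> null_sets \<nu>"
    then have X: "X \<in> sets borel" "H1_outer (A \<inter> X) = 0" by (auto simp: null_sets_def sets_\<nu> em\<nu>)
    define Y where "Y = g -` X"
    have Y: "Y \<in> sets LebT" using measurable_sets[OF gm X(1)] by (simp add: Y_def)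
    have Z: "Y \<inter> (\<Union>P. B P) \<in> null_sets LebT"
    proof -
      have Zm: "Y \<inter> (\<Union>P. B P) \<in> sets LebT" using Y B(1) by (auto intro: borel_imp_LebT)
      have "H1_outer (g ` (Y \<inter> (\<Union>P. B P))) \<le> H1_outer (A \<inter> X)"
        by (rule H1_outer_mono) (auto simp: Y_def A_def)
      then have "H1_outer (g ` (Y \<inter> (\<Union>P. B P))) = 0" using X by simp
      then have "emeasure LebT (Y \<inter> (\<Union>P. B P)) = 0"
        by (intro LebT_null_if_small_image[OF _ Zm, of g]) (auto simp: g_def dist_Pair_Pair)
      then show ?thesis using Zm by (rule null_setsI)
    qed
    have "AE \<theta> in LebT. \<theta> \<notin> (\<Union>P. K P - B P)"
      using B(3) by (intro AE_not_in null_sets_UN) auto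
    moreover have "AE \<theta> in LebT. \<theta> \<notin> Y \<inter> (\<Union>P. B P)" using Z by (rule AE_not_in)
    ultimately have "AE \<theta> in LebT. \<theta> \<notin> Y" using conull by eventually_elim auto
    then have "emeasure LebT Y = 0" using Y by (subst (asm) AE_iff_null_sets[symmetric]) auto
    then show "X \<in> null_sets (graph_measure \<phi>)"
      using X em[OF X(1)] by (auto simp: null_sets_def Y_def sets_gm sets_\<nu>)
  qed
  define R where "R = RN_deriv \<nu> (graph_measure \<phi>)"
  have R: "density \<nu> R = graph_measure \<phi>" unfolding R_def by (rule \<nu>.density_RN_deriv[OF ac sets_gm])
  have Rm: "R \<in> borel_measurable \<nu>" unfolding R_def by (rule borel_measurable_RN_deriv)
  interpret gm: finite_measure "graph_measure \<phi>"
    by standard (simp add: em sets_eq_imp_space_eq[OF sets_gm] space_\<nu>)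
  have fin: "AE x in \<nu>. R x \<noteq> \<infinity>"
    unfolding R_def by (rule \<nu>.RN_deriv_finite[OF gm.sigma_finite_measure_axioms ac sets_gm])
  define \<Theta> where "\<Theta> x = enn2real (R x)" for x
  have Rb: "R \<in> borel_measurable borel" using Rm by (simp cong: measurable_cong_sets add: sets_\<nu>)
  have \<Theta>m: "\<Theta> \<in> borel_measurable borel" unfolding \<Theta>_def using Rb by measurable
  have "graph_measure \<phi> = density \<nu> (\<lambda>x. ennreal (\<Theta> x))"
    unfolding R[symmetric]
  proof (rule density_cong[OF Rm])
    show "(\<lambda>x. ennreal (\<Theta> x)) \<in> borel_measurable \<nu>" using \<Theta>m by (simp cong: measurable_cong_sets add: sets_\<nu>)
    show "AE x in \<nu>. R x = ennreal (\<Theta> x)" using fin by eventually_elim (simp add: \<Theta>_def less_top)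
  qed
  also have "\<dots> = density H1 (\<lambda>x. indicator A x * ennreal (\<Theta> x))"
    unfolding \<nu>_def by (rule density_density_eq) (use A \<Theta>m in \<open>auto cong: measurable_cong_sets\<close>)
  finally show ?thesis
    unfolding rectifiable_1_measure_def using A A_rect \<Theta>m by (intro exI[of _ A] exI[of _ \<Theta>]) (auto simp: \<Theta>_def)
qed

section \<open>Contraction along recurrent orbits\<close>

definition rotn :: "real \<Rightarrow> int \<Rightarrow> T1 \<Rightarrow> T1" where
  "rotn w k = rotT (of_int k * w)"

lemma rotn_rotn [simp]: "rotn w a (rotn w b x) = rotn w (a + b) x"
  by (simp add: rotn_def algebra_simps)

lemma rotn_0 [simp]: "rotn w 0 x = x"
  by (simp add: rotn_def)

lemma rotT_rotn: "rotT w (rotn w k x) = rotn w (k + 1) x"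
  by (simp add: rotn_def algebra_simps)

lemma dist_rotn [simp]: "dist (rotn w k x) (rotn w k y) = dist x y"
  by (simp add: rotn_def)

text \<open>Division by \<open>Suc D\<close> is injective on \<open>H\<close>. The left end
  \<open>a\<close> is kept because a late first element, \<open>a = Suc D\<close>, cancels the extra
  1 and leaves a count proportional to the length of the interval.\<close>

lemma card_gaps_le:
  assumes H: "H \<subseteq> {a..b}" and gaps: "\<And>m m'. m \<in> H \<Longrightarrow> m' \<in> H \<Longrightarrow> m < m' \<Longrightarrow> m + D < m'"
  shows "card H \<le> Suc (b div Suc D) - a div Suc D"
proof -
  have "inj_on (\<lambda>m. m div Suc D) H"
  proof (rule linorder_inj_onI')
    fix i j assume ij: "i \<in> H" "j \<in> H" "i < j"
    then have "i + Suc D \<le> j" using gaps by (simp add: Suc_leI)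
    then have "(i + Suc D) div Suc D \<le> j div Suc D" by (rule div_le_mono)
    moreover have "(i + Suc D) div Suc D = i div Suc D + 1" by (rule div_add_self2) simp
    ultimately show "i div Suc D \<noteq> j div Suc D" by linarith
  qed
  moreover have "(\<lambda>m. m div Suc D) ` H \<subseteq> {a div Suc D..b div Suc D}"
    using H by (auto intro!: div_le_mono dest!: subsetD)
  ultimately have "card H \<le> card {a div Suc D..b div Suc D}"
    by (intro card_inj_on_le) auto
  then show ?thesis by simp
qed

text \<open>\<open>X\<close> is the contracting strip, \<open>Y\<close> the part of the fibre from which it may be missed, and \<open>p n\<close>,
  \<open>q n\<close> are the lengths of the windows before and after a visit to \<open>J n\<close>. The attractor uses
  \<open>p n = M n - 1\<close>, \<open>q n = M n + 1\<close>, \<open>J n = I\<^sub>n\<close>; the inverse map uses \<open>p n = q n = M n\<close>, \<open>J n = I\<^sub>n + \<omega>\<close>.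
  Contraction is only required over two consecutive steps: a strip longer than half the circle
  contains points whose distance is attained outside it, but their images are close within it.\<close>

locale skew_contraction =
  fixes w :: real and F :: "T1 \<Rightarrow> T1 \<Rightarrow> T1" and X Y :: "T1 set" and J :: "nat \<Rightarrow> T1 set"
    and p q M K :: "nat \<Rightarrow> nat" and \<alpha> S \<delta>\<^sub>0 :: real
  assumes step: "x \<notin> Y \<Longrightarrow> \<theta> \<notin> J 0 \<Longrightarrow> F \<theta> x \<in> X"
    and XY: "X \<inter> Y = {}"
    and cross: "\<theta> \<in> J n \<Longrightarrow> \<theta> \<notin> J (Suc n) \<Longrightarrow>
      (\<And>t. u (Suc t) = F (rotn w (int t - int (p n)) \<theta>) (u t)) \<Longrightarrow> u 0 \<in> X \<Longrightarrow> u (p n + q n) \<notin> Y"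
    and no_return: "\<theta> \<in> J n \<Longrightarrow> 1 \<le> k \<Longrightarrow> k \<le> 2 * K n * M n \<Longrightarrow> rotn w (int k) \<theta> \<notin> J n"
    and clear_after: "\<theta> \<in> J n \<Longrightarrow> j < n \<Longrightarrow> l \<in> {- int (p n), int (q n)} \<Longrightarrow> 1 \<le> i \<Longrightarrow> i \<le> q j \<Longrightarrow>
      rotn w (l - int i) \<theta> \<notin> J j"
    and clear_before: "\<theta> \<in> J n \<Longrightarrow> j < n \<Longrightarrow> l \<in> {- int (p n), int (q n)} \<Longrightarrow> i \<le> p j \<Longrightarrow>
      rotn w (l + int i) \<theta> \<notin> J j"
    and pq: "p n + q n = 2 * M n" "1 \<le> q n" "q n \<le> M n + 1"
    and M: "strict_mono M" "2 \<le> M 0"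
    and K: "1 \<le> K n" "(\<Sum>j<n. 1 / real (K j)) \<le> 1 / 10"
    and \<alpha>: "\<alpha> > 1" and S: "S \<ge> 0"
    and lip_fibre: "dist (F \<theta> x) (F \<theta> x') \<le> \<alpha>\<^sup>2 * dist x x'"
    and lip_base: "dist (F \<theta> x) (F \<theta>' x) \<le> S * dist \<theta> \<theta>'"
    and \<delta>\<^sub>0: "\<delta>\<^sub>0 > 0"
    and contract: "dist \<theta> \<theta>' \<le> \<delta>\<^sub>0 \<Longrightarrow> x \<in> X \<Longrightarrow> x' \<in> X \<Longrightarrow>
      \<theta> \<notin> J 0 \<Longrightarrow> \<theta>' \<notin> J 0 \<Longrightarrow> rotT w \<theta> \<notin> J 0 \<Longrightarrow> rotT w \<theta>' \<notin> J 0 \<Longrightarrow>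
      dist (F (rotT w \<theta>) (F \<theta> x)) (F (rotT w \<theta>') (F \<theta>' x'))
        \<le> dist (F \<theta> x) (F \<theta>' x') / \<alpha> + S * dist \<theta> \<theta>'"
begin

section \<open>Windows around visits and orbits that stay in the strip\<close>

abbreviation R :: "int \<Rightarrow> T1 \<Rightarrow> T1" where "R \<equiv> rotn w"

text \<open>Points with a visit to some \<open>J j\<close> so close ahead that an orbit started in
  \<open>X\<close> lacks the run-up of \<open>p j\<close> steps. Outside this set orbits may be
  started.\<close>

definition before_hit :: "T1 \<Rightarrow> bool" where
  "before_hit \<theta> \<longleftrightarrow> (\<exists>j. \<exists>l<p j. R (int l) \<theta> \<in> J j)"

definition after_hit :: "T1 \<Rightarrow> bool" where
  "after_hit \<theta> \<longleftrightarrow> (\<exists>j. \<exists>l\<in>{1..q j}. R (- int l) \<theta> \<in> J j)"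

definition Good :: "nat \<Rightarrow> T1 \<Rightarrow> bool" where
  "Good P \<theta> \<longleftrightarrow> (\<forall>j\<ge>P. \<forall>l\<le>2 * K j * M j. R (- int l) \<theta> \<notin> J j)"

lemma M_ge: "n + 2 \<le> M n"
proof (induction n)
  case (Suc n)
  then show ?case using strict_monoD[OF M(1), of n "Suc n"] by simp
qed (use M in simp)

lemma K_ge: "10 \<le> K n"
proof -
  have "1 / real (K n) \<le> (\<Sum>j<Suc n. 1 / real (K j))"
    by (rule member_le_sum) auto
  also have "\<dots> \<le> 1 / 10" by (rule K)
  finally show ?thesis using K(1)[of n] by (simp add: field_simps)
qed

lemma le_KM: "k \<le> 2 * M n \<Longrightarrow> k \<le> 2 * K n * M n"
proof -
  have "2 * M n \<le> 2 * K n * M n" using K(1)[of n] by simp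
  then show "k \<le> 2 * M n \<Longrightarrow> k \<le> 2 * K n * M n" by (rule order_trans[rotated])
qed

text \<open>Induction on the level, and inside it on time. Before the first visit to
  \<open>J n\<close> only lower levels matter. The orbit is in \<open>X\<close> when the run-up of
  \<open>p n\<close> steps begins, and since the visit misses \<open>J (Suc n)\<close>,
  \<open>cross\<close> brings it past the window without ending in \<open>Y\<close>. One more step
  leads into \<open>X\<close>, and the argument restarts there.\<close>

lemma orbit_in_X:
  assumes "\<And>t. x (Suc t) = F (R (int t) \<theta>) (x t)" "x 0 \<in> X"
    and "\<And>j l. j < n \<Longrightarrow> l < p j \<Longrightarrow> R (int l) \<theta> \<notin> J j"
    and "\<And>s. s < t \<Longrightarrow> R (int s) \<theta> \<notin> J n"
  shows "x t \<in> X \<or> (\<exists>j<n. \<exists>s<t. t \<le> s + q j \<and> R (int s) \<theta> \<in> J j)"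
  using assms
proof (induction n arbitrary: \<theta> x t)
  case 0
  have "s \<le> t \<Longrightarrow> x s \<in> X" for s
  proof (induction s)
    case (Suc s)
    then have "x s \<notin> Y" using XY by auto
    then show ?case using Suc.prems 0 by (simp add: step)
  qed (use 0 in simp)
  then show ?case by simp
next
  case (Suc n)
  note outer = Suc.IH
  show ?case using Suc.prems
  proof (induction t arbitrary: \<theta> x rule: less_induct)
    case (less t)
    note orb = less.prems(1) and start = less.prems(2) and clear = less.prems(3) and nohit = less.prems(4)
    show ?case
    proof (cases "\<exists>s<t. R (int s) \<theta> \<in> J n")
      case False
      then have "x t \<in> X \<or> (\<exists>j<n. \<exists>s<t. t \<le> s + q j \<and> R (int s) \<theta> \<in> J j)"
        using clear by (intro outer orb start) auto
      then show ?thesis using less_SucI by blast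
    next
      case True
      define m where "m = (LEAST s. R (int s) \<theta> \<in> J n)"
      have m: "R (int m) \<theta> \<in> J n" unfolding m_def using True by (metis LeastI)
      have m_least: "s < m \<Longrightarrow> R (int s) \<theta> \<notin> J n" for s unfolding m_def by (rule not_less_Least)
      have mt: "m < t" using True unfolding m_def by (metis Least_le le_less_trans)
      show ?thesis
      proof (cases "t \<le> m + q n")
        case True
        then show ?thesis using mt m by blast
      next
        case False
        \<comment> \<open>The run-up to the first visit fits into the orbit because the start is
          clear for \<open>p n\<close> steps.\<close>
        have pm: "p n \<le> m"
        proof (rule ccontr)
          assume "\<not> p n \<le> m" then show False using clear[of n m] m by simp
        qed
        have "x (m - p n) \<in> X \<or> (\<exists>j<n. \<exists>s<m - p n. m - p n \<le> s + q j \<and> R (int s) \<theta> \<in> J j)"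
          using clear m_least by (intro outer orb start) auto
        \<comment> \<open>A lower window still open at time \<open>m - p n\<close> would be a visit
          to \<open>J j\<close> shortly before the run-up, which \<open>clear_after\<close> rules
          out.\<close>
        moreover have "\<not> (\<exists>j<n. \<exists>s<m - p n. m - p n \<le> s + q j \<and> R (int s) \<theta> \<in> J j)"
        proof safe
          fix j s assume j: "j < n" "s < m - p n" "m - p n \<le> s + q j" "R (int s) \<theta> \<in> J j"
          have "R (- int (p n) - int (m - p n - s)) (R (int m) \<theta>) \<notin> J j"
            using j by (intro clear_after[OF m j(1)]) auto
          then show False using j pm by (simp add: of_nat_diff)
        qed
        ultimately have xp: "x (m - p n) \<in> X" by blast
        define z where "z = m + q n"
        have "x (m - p n + (p n + q n)) \<notin> Y"
        proof (rule cross[where u="\<lambda>t. x (m - p n + t)" and \<theta>="R (int m) \<theta>", OF m])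
          show "R (int m) \<theta> \<notin> J (Suc n)" using nohit[OF mt] .
          show "x (m - p n + Suc t) = F (R (int t - int (p n)) (R (int m) \<theta>)) (x (m - p n + t))" for t
            using orb[of "m - p n + t"] pm by (simp add: of_nat_diff algebra_simps)
        qed (use xp in simp)
        then have xz: "x z \<notin> Y" using pm by (simp add: z_def)
        \<comment> \<open>At level 0 the visit at time \<open>m\<close> was to \<open>J 0\<close>
          itself and the return time excludes another; at higher levels this is
          \<open>clear_before\<close> with offset 0.\<close>
        have "R (int z) \<theta> \<notin> J 0"
        proof (cases n)
          case 0
          have "R (int (q 0)) (R (int m) \<theta>) \<notin> J 0"
            using pq[of 0] m M(2) 0 by (intro no_return le_KM) auto
          then show ?thesis by (simp add: z_def 0 add.commute)
        next
          case (Suc n')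
          have "R (int (q n) + int 0) (R (int m) \<theta>) \<notin> J 0"
            by (rule clear_before[OF m]) (use Suc in auto)
          then show ?thesis by (simp add: z_def add.commute)
        qed
        then have x1: "x (Suc z) \<in> X" using orb[of z] xz by (simp add: step)
        define t' where "t' = t - Suc z"
        have t': "t' < t" "t = Suc z + t'" using False by (auto simp: t'_def z_def)
        have sh: "R (int s) (R (int (Suc z)) \<theta>) = R (int (Suc z + s)) \<theta>" for s
          by (simp add: algebra_simps)
        have "x (Suc z + t') \<in> X \<or> (\<exists>j<Suc n. \<exists>s<t'. t' \<le> s + q j \<and> R (int s) (R (int (Suc z)) \<theta>) \<in> J j)"
        proof (rule less.IH[OF t'(1), where x="\<lambda>s. x (Suc z + s)"])
          show "x (Suc z + Suc s) = F (R (int s) (R (int (Suc z)) \<theta>)) (x (Suc z + s))" for s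
            unfolding sh using orb[of "Suc z + s"] by simp
          show "x (Suc z + 0) \<in> X" using x1 by simp
          show "R (int s) (R (int (Suc z)) \<theta>) \<notin> J (Suc n)" if "s < t'" for s
            unfolding sh using that t' by (intro nohit) auto
          \<comment> \<open>The new start needs clear run-ups for all levels up to \<open>n\<close>.
            At level \<open>n\<close> the times involved are at most
            \<open>p n + q n = 2 * M n\<close> after the visit, below the return time.\<close>
          show "R (int l) (R (int (Suc z)) \<theta>) \<notin> J j" if jl: "j < Suc n" "l < p j" for j l
          proof (cases "j = n")
            case False
            have "R (int (q n) + int (Suc l)) (R (int m) \<theta>) \<notin> J j"
              by (rule clear_before[OF m]) (use jl False in auto)
            then show ?thesis by (simp add: z_def algebra_simps)
          next
            case True
            have "R (int (Suc (q n) + l)) (R (int m) \<theta>) \<notin> J n"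
            proof (rule no_return[OF m])
              show "Suc (q n) + l \<le> 2 * K n * M n" using pq(1)[of n] jl True by (intro le_KM) simp
            qed simp
            then show ?thesis by (simp add: z_def algebra_simps True)
          qed
        qed
        then show ?thesis
        proof
          assume "\<exists>j<Suc n. \<exists>s<t'. t' \<le> s + q j \<and> R (int s) (R (int (Suc z)) \<theta>) \<in> J j"
          then obtain j s where "j < Suc n" "s < t'" "t' \<le> s + q j" "R (int (Suc z + s)) \<theta> \<in> J j"
            unfolding sh by blast
          then show ?thesis using t' by (intro disjI2 exI[of _ j] conjI exI[of _ "Suc z + s"]) auto
        qed (use t' in simp)
      qed
    qed
  qed
qed

lemma backward_orbit_in_X:
  assumes orb: "\<And>k::int. y (k + 1) = F (R k \<theta>) (y k)"
    and start: "y (- int k) \<in> X" "\<not> before_hit (R (- int k) \<theta>)" and good: "Good P \<theta>"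
  shows "y 0 \<in> X \<or> after_hit \<theta>"
proof -
  \<comment> \<open>A level with \<open>n >= P\<close> and \<open>k <= 2 * M n\<close>: goodness
    then excludes every visit to \<open>J n\<close> among the last \<open>k\<close> steps, and so
    the induction over levels may stop at \<open>n\<close>.\<close>
  define n where "n = max P k"
  have kn: "k \<le> 2 * K n * M n" using M_ge[of n] by (intro le_KM) (simp add: n_def)
  define x where "x t = y (int t - int k)" for t
  have sh: "R (int s) (R (- int k) \<theta>) = R (int s - int k) \<theta>" for s by simp
  have "x k \<in> X \<or> (\<exists>j<n. \<exists>s<k. k \<le> s + q j \<and> R (int s) (R (- int k) \<theta>) \<in> J j)"
  proof (rule orbit_in_X)
    show "x (Suc t) = F (R (int t) (R (- int k) \<theta>)) (x t)" for t
      unfolding sh x_def using orb[of "int t - int k"] by (simp add: algebra_simps)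
    show "x 0 \<in> X" using start by (simp add: x_def)
    show "R (int l) (R (- int k) \<theta>) \<notin> J j" if "j < n" "l < p j" for j l
      using start that unfolding before_hit_def by blast
    show "R (int s) (R (- int k) \<theta>) \<notin> J n" if "s < k" for s
    proof -
      have "R (- int (k - s)) \<theta> \<notin> J n"
        using good kn that unfolding Good_def n_def by (meson diff_le_self max.cobounded1 order_trans)
      then show ?thesis using that by (simp add: of_nat_diff)
    qed
  qed
  then show ?thesis
  proof
    assume "\<exists>j<n. \<exists>s<k. k \<le> s + q j \<and> R (int s) (R (- int k) \<theta>) \<in> J j"
    then obtain j s where js: "s < k" "k \<le> s + q j" "R (int s - int k) \<theta> \<in> J j" unfolding sh by blast
    then have "R (- int (k - s)) \<theta> \<in> J j" "k - s \<in> {1..q j}" by (auto simp: of_nat_diff)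
    then show ?thesis unfolding after_hit_def by blast
  qed (simp add: x_def)
qed

text \<open>One step more than the window after a visit, since contraction needs two consecutive steps.\<close>

definition bad :: "T1 \<Rightarrow> nat \<Rightarrow> nat \<Rightarrow> bool" where
  "bad \<theta> j i \<longleftrightarrow> (\<exists>m\<in>{i..i + q j + 1}. R (- int m) \<theta> \<in> J j)"

section \<open>Counting the non-contracting times\<close>

lemma card_bad_le_hits:
  defines "H \<equiv> \<lambda>\<theta> j k. {m \<in> {1..k + q j + 1}. R (- int m) \<theta> \<in> J j}"
  shows "card {i \<in> {1..k}. bad \<theta> j i} \<le> card (H \<theta> j k) * (q j + 2)"
proof -
  \<comment> \<open>A visit \<open>m\<close> steps back spoils the times from
    \<open>m - (q j + 1)\<close> to \<open>m\<close>, which are at most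
    \<open>q j + 2\<close>.\<close>
  have "{i \<in> {1..k}. bad \<theta> j i} \<subseteq> (\<Union>m\<in>H \<theta> j k. {m - (q j + 1)..m})"
  proof
    fix i assume "i \<in> {i \<in> {1..k}. bad \<theta> j i}"
    then obtain m where "i \<in> {1..k}" "m \<in> {i..i + q j + 1}" "R (- int m) \<theta> \<in> J j"
      by (auto simp: bad_def)
    then have "m \<in> H \<theta> j k" "i \<in> {m - (q j + 1)..m}" by (auto simp: H_def)
    then show "i \<in> (\<Union>m\<in>H \<theta> j k. {m - (q j + 1)..m})" by blast
  qed
  then have "card {i \<in> {1..k}. bad \<theta> j i} \<le> card (\<Union>m\<in>H \<theta> j k. {m - (q j + 1)..m})"
    by (intro card_mono) (auto simp: H_def)
  also have "\<dots> \<le> (\<Sum>m\<in>H \<theta> j k. card {m - (q j + 1)..m})"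
    by (intro card_UN_le) (auto simp: H_def)
  also have "\<dots> \<le> (\<Sum>m\<in>H \<theta> j k. q j + 2)" by (intro sum_mono) auto
  finally show ?thesis by simp
qed

lemma hit_gaps:
  assumes "R (- int m) \<theta> \<in> J j" "R (- int m') \<theta> \<in> J j" "m < m'"
  shows "m + 2 * K j * M j < m'"
proof (rule ccontr)
  assume "\<not> m + 2 * K j * M j < m'"
  then have "R (int (m' - m)) (R (- int m') \<theta>) \<notin> J j"
    using assms by (intro no_return) auto
  then show False using assms by (simp add: of_nat_diff)
qed

text \<open>The bound for levels below \<open>P\<close>, where the first visit may come at once. The
  additive term absorbs that visit and the end of the interval.\<close>

lemma card_bad_any:
  "real (card {i \<in> {1..k}. bad \<theta> j i}) \<le> (real (M j) + 3)\<^sup>2 + 7/5 * real k / real (K j)"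
proof -
  define H where "H = {m \<in> {1..k + q j + 1}. R (- int m) \<theta> \<in> J j}"
  define D where "D = 2 * K j * M j"
  have "card H \<le> Suc ((k + q j + 1) div Suc D) - 1 div Suc D"
    by (rule card_gaps_le) (auto simp: H_def D_def intro: hit_gaps)
  then have "card H \<le> (k + q j + 1) div Suc D + 1" by simp
  then have "real (card H) \<le> real ((k + q j + 1) div Suc D) + 1" by linarith
  also have "\<dots> \<le> real (k + q j + 1) / real (Suc D) + 1" by (simp add: of_nat_div_le_of_nat del: of_nat_Suc of_nat_add)
  also have "\<dots> \<le> real (k + (M j + 2)) / real D + 1"
    using pq(3)[of j] K_ge[of j] M_ge[of j] by (intro add_right_mono frac_le) (auto simp: D_def)
  also have "\<dots> = real k / real D + real (M j + 2) / real D + 1" by (simp add: add_divide_distrib)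
  also have "\<dots> \<le> real k / real D + (real (M j) + 3)"
  proof -
    have "real (M j + 2) / real D \<le> real (M j + 2) / 1"
      using K_ge[of j] M_ge[of j] by (intro divide_left_mono) (auto simp: D_def Suc_le_eq simp flip: of_nat_mult)
    then show ?thesis by simp
  qed
  finally have cH: "real (card H) \<le> real k / real D + (real (M j) + 3)" .
  have "card {i \<in> {1..k}. bad \<theta> j i} \<le> card H * (q j + 2)"
    unfolding H_def by (rule card_bad_le_hits)
  then have "real (card {i \<in> {1..k}. bad \<theta> j i}) \<le> real (card H * (q j + 2))" by (simp only: of_nat_le_iff)
  also have "\<dots> \<le> (real k / real D + (real (M j) + 3)) * (real (M j) + 3)"
    unfolding of_nat_mult using cH pq(3)[of j] by (intro mult_mono) auto
  also have "\<dots> = (real (M j) + 3)\<^sup>2 + (real (M j) + 3) * (real k / real D)"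
    by (simp add: power2_eq_square algebra_simps)
  \<comment> \<open>\<open>M j >= 2\<close> gives \<open>M j + 3 <= 14/5 * M j\<close>, and half of
    14/5 is the rate 7/5 that \<open>card_bad_good\<close> has too.\<close>
  also have "(real (M j) + 3) * (real k / real D) \<le> (14/5 * real (M j)) * (real k / real D)"
    using M_ge[of j] by (intro mult_right_mono) auto
  also have "\<dots> = 7/5 * real k / real (K j)"
    using M_ge[of j] K_ge[of j] by (simp add: D_def field_simps)
  finally show ?thesis by simp
qed

text \<open>For a good point the first visit lies more than \<open>2 * K j * M j\<close> steps back,
  so any visit that counts makes \<open>k\<close> large compared with \<open>M j\<close>. This turns
  the additive constant into a small relative error and leaves no bad times at all when
  \<open>k < j\<close>.\<close>

lemma card_bad_good:
  assumes good: "Good P \<theta>" and j: "j \<ge> P"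
  shows "real (card {i \<in> {1..k}. bad \<theta> j i}) \<le> 7/5 * real k / real (K j)"
    and "k < j \<Longrightarrow> {i \<in> {1..k}. bad \<theta> j i} = {}"
proof -
  define H where "H = {m \<in> {1..k + q j + 1}. R (- int m) \<theta> \<in> J j}"
  define D where "D = 2 * K j * M j"
  have H_ge: "m \<ge> Suc D" if "m \<in> H" for m
  proof (rule ccontr)
    assume "\<not> m \<ge> Suc D"
    then have "m \<le> 2 * K j * M j" by (simp add: D_def)
    then show False using good j that by (auto simp: Good_def H_def)
  qed
  have cb: "card {i \<in> {1..k}. bad \<theta> j i} \<le> card H * (q j + 2)"
    unfolding H_def by (rule card_bad_le_hits)
  have M2: "real (M j) \<ge> 2" and K10: "real (K j) \<ge> 10" using M_ge[of j] K_ge[of j] by auto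
  have KM: "real (K j) * real (M j) \<ge> 10 * real (M j)" using K10 M2 by (intro mult_right_mono) auto
  \<comment> \<open>From \<open>K j >= 10\<close> and \<open>M j >= 2\<close>: 20 M - M - 1 is at
    least 37/2 M.\<close>
  have k_ge: "real k \<ge> 37/2 * real (M j)" if H_ne: "H \<noteq> {}"
  proof -
    obtain m where "m \<in> H" using H_ne by blast
    then have "Suc D \<le> k + q j + 1" using H_ge[of m] by (auto simp: H_def)
    then have "2 * K j * M j \<le> k + M j + 1" using pq(3)[of j] by (simp add: D_def)
    then have "real (2 * K j * M j) \<le> real (k + M j + 1)" by (simp only: of_nat_le_iff)
    then have "2 * (real (K j) * real (M j)) \<le> real k + real (M j) + 1" by simp
    then show ?thesis using KM M2 by linarith
  qed
  show "{i \<in> {1..k}. bad \<theta> j i} = {}" if "k < j"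
  proof -
    have "H = {}" using k_ge M_ge[of j] that by fastforce
    then show ?thesis using cb by simp
  qed
  show "real (card {i \<in> {1..k}. bad \<theta> j i}) \<le> 7/5 * real k / real (K j)"
  proof (cases "H = {}")
    case True
    then have "card {i \<in> {1..k}. bad \<theta> j i} = 0" using cb by simp
    then show ?thesis by (simp only:) simp
  next
    case False
    note kM = k_ge[OF False]
    have "card H \<le> Suc ((k + q j + 1) div Suc D) - Suc D div Suc D"
      using H_ge by (intro card_gaps_le) (auto simp: H_def D_def intro: hit_gaps)
    then have "card H \<le> (k + q j + 1) div Suc D" by simp
    then have "real (card H) \<le> real ((k + q j + 1) div Suc D)" by linarith
    also have "\<dots> \<le> real (k + q j + 1) / real (Suc D)" by (rule of_nat_div_le_of_nat)
    \<comment> \<open>\<open>q j + 1 <= M j + 2 <= 2 * M j\<close>, and \<open>2 * M j\<close> is at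
      most 4/37 of \<open>k\<close>. With the factor 5/2 for \<open>q j + 2\<close> the result is
      205/148 < 7/5.\<close>
    also have "\<dots> \<le> (41/37 * real k) / real D"
      using pq(3)[of j] K10 M2 kM by (intro frac_le) (auto simp: D_def)
    finally have cH: "real (card H) \<le> (41/37 * real k) / real D" .
    have "real (card {i \<in> {1..k}. bad \<theta> j i}) \<le> real (card H * (q j + 2))" using cb by (simp only: of_nat_le_iff)
    also have "\<dots> \<le> ((41/37 * real k) / real D) * (5/2 * real (M j))"
      unfolding of_nat_mult using cH pq(3)[of j] M2 by (intro mult_mono) auto
    also have "\<dots> = (205/148) * (real k / real (K j))"
      using M2 K10 by (simp add: D_def field_simps)
    also have "\<dots> \<le> 7/5 * (real k / real (K j))"
      by (intro mult_right_mono) auto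
    finally show ?thesis by simp
  qed
qed

lemma card_bad_total:
  assumes good: "Good P \<theta>"
  shows "real (card {i \<in> {1..k}. \<exists>j. bad \<theta> j i}) \<le> (\<Sum>j<P. (real (M j) + 3)\<^sup>2) + 7/50 * real k"
proof -
  \<comment> \<open>Levels from \<open>n\<close> on have no bad times up to \<open>k\<close>, so the
    union over all levels is finite.\<close>
  define n where "n = max P (Suc k)"
  have "{i \<in> {1..k}. \<exists>j. bad \<theta> j i} \<subseteq> (\<Union>j<n. {i \<in> {1..k}. bad \<theta> j i})"
  proof
    fix i assume "i \<in> {i \<in> {1..k}. \<exists>j. bad \<theta> j i}"
    then obtain j where ij: "i \<in> {1..k}" "bad \<theta> j i" by blast
    have "j < n"
    proof (rule ccontr)
      assume "\<not> j < n"
      then have "{i \<in> {1..k}. bad \<theta> j i} = {}" by (intro card_bad_good(2)[OF good]) (auto simp: n_def)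
      then show False using ij by blast
    qed
    then show "i \<in> (\<Union>j<n. {i \<in> {1..k}. bad \<theta> j i})" using ij by blast
  qed
  then have "card {i \<in> {1..k}. \<exists>j. bad \<theta> j i} \<le> card (\<Union>j<n. {i \<in> {1..k}. bad \<theta> j i})"
    by (intro card_mono) auto
  also have "\<dots> \<le> (\<Sum>j<n. card {i \<in> {1..k}. bad \<theta> j i})" by (intro card_UN_le) auto
  finally have "real (card {i \<in> {1..k}. \<exists>j. bad \<theta> j i}) \<le> (\<Sum>j<n. real (card {i \<in> {1..k}. bad \<theta> j i}))"
    by (simp only: of_nat_sum[symmetric] of_nat_le_iff)
  also have "\<dots> \<le> (\<Sum>j<n. (if j < P then (real (M j) + 3)\<^sup>2 else 0) + 7/5 * real k * (1 / real (K j)))"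
    using card_bad_any card_bad_good(1)[OF good] by (intro sum_mono) auto
  also have "\<dots> = (\<Sum>j<n. if j < P then (real (M j) + 3)\<^sup>2 else 0) + 7/5 * real k * (\<Sum>j<n. 1 / real (K j))"
    by (simp add: sum.distrib sum_distrib_left)
  also have "\<dots> \<le> (\<Sum>j<n. if j < P then (real (M j) + 3)\<^sup>2 else 0) + 7/5 * real k * (1/10)"
    by (intro add_left_mono mult_left_mono K) auto
  also have "(\<Sum>j<n. if j < P then (real (M j) + 3)\<^sup>2 else 0) = (\<Sum>j<P. (real (M j) + 3)\<^sup>2)"
    by (rule sum.mono_neutral_cong_right) (auto simp: n_def)
  finally show ?thesis by simp
qed

section \<open>Comparison of two orbits over good base points\<close>

lemma good_step:
  assumes orb: "\<And>k::int. y (k + 1) = F (R k \<theta>) (y k)" "\<And>k::int. y' (k + 1) = F (R k \<theta>') (y' k)"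
    and inX: "\<And>k. y k \<in> X \<or> after_hit (R k \<theta>)" "\<And>k. y' k \<in> X \<or> after_hit (R k \<theta>')"
    and d: "dist \<theta> \<theta>' \<le> \<delta>\<^sub>0"
    and nb: "\<And>j. \<not> bad \<theta> j i" "\<And>j. \<not> bad \<theta>' j i"
  shows "dist (y (1 - int i)) (y' (1 - int i)) \<le> dist (y (- int i)) (y' (- int i)) / \<alpha> + S * dist \<theta> \<theta>'"
proof -
  \<comment> \<open>The two steps begin at time \<open>- (i + 1)\<close>. The window of
    \<open>bad\<close> covers \<open>J 0\<close> at the times \<open>- i\<close> and
    \<open>- (i + 1)\<close>, and from \<open>i + 2\<close> on it covers the after-window of the
    starting time, so both orbits start in \<open>X\<close>.\<close>
  have *: "R (- int i) \<theta> \<notin> J 0 \<and> R (- int (Suc i)) \<theta> \<notin> J 0 \<and> \<not> after_hit (R (- int (Suc i)) \<theta>)"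
    if nb: "\<And>j. \<not> bad \<theta> j i" for \<theta>
  proof (intro conjI)
    have "R (- int m) \<theta> \<notin> J 0" if "m \<in> {i..i + q 0 + 1}" for m using nb[of 0] that by (auto simp: bad_def)
    from this[of i] this[of "Suc i"] show "R (- int i) \<theta> \<notin> J 0" "R (- int (Suc i)) \<theta> \<notin> J 0" by auto
    show "\<not> after_hit (R (- int (Suc i)) \<theta>)"
      unfolding after_hit_def
    proof safe
      fix j l assume l: "l \<in> {1..q j}" "R (- int l) (R (- int (Suc i)) \<theta>) \<in> J j"
      have "- int l + - int (Suc i) = - int (Suc i + l)" by simp
      then have "R (- int (Suc i + l)) \<theta> \<in> J j" using l(2) by (metis rotn_rotn)
      moreover have "Suc i + l \<in> {i..i + q j + 1}" using l by auto
      ultimately have "bad \<theta> j i" unfolding bad_def by blast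
      then show False using nb by blast
    qed
  qed
  note h = *[of \<theta>, OF nb(1)] and h' = *[of \<theta>', OF nb(2)]
  have e1: "- int (Suc i) + 1 = - int i" and e2: "- int i + 1 = 1 - int i"
    and e3: "1 - int (Suc i) = - int i" by auto
  have "dist (F (rotT w (R (- int (Suc i)) \<theta>)) (F (R (- int (Suc i)) \<theta>) (y (- int (Suc i)))))
     (F (rotT w (R (- int (Suc i)) \<theta>')) (F (R (- int (Suc i)) \<theta>') (y' (- int (Suc i)))))
     \<le> dist (F (R (- int (Suc i)) \<theta>) (y (- int (Suc i)))) (F (R (- int (Suc i)) \<theta>') (y' (- int (Suc i)))) / \<alpha>
       + S * dist (R (- int (Suc i)) \<theta>) (R (- int (Suc i)) \<theta>')"
    using h h' inX d by (intro contract) (auto simp: rotT_rotn e1 e3 simp del: of_nat_Suc)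
  then show ?thesis
    unfolding rotT_rotn e1 orb[of "- int (Suc i)", unfolded e1, symmetric] orb[of "- int i", unfolded e2, symmetric]
    by simp
qed

lemma any_step:
  assumes orb: "\<And>k::int. y (k + 1) = F (R k \<theta>) (y k)" "\<And>k::int. y' (k + 1) = F (R k \<theta>') (y' k)"
  shows "dist (y (1 - int i)) (y' (1 - int i)) \<le> \<alpha>\<^sup>2 * dist (y (- int i)) (y' (- int i)) + S * dist \<theta> \<theta>'"
proof -
  have e2: "- int i + 1 = 1 - int i" by auto
  let ?a = "R (- int i) \<theta>" and ?b = "R (- int i) \<theta>'"
  have "dist (y (1 - int i)) (y' (1 - int i)) = dist (F ?a (y (- int i))) (F ?b (y' (- int i)))"
    using orb(1)[of "- int i"] orb(2)[of "- int i"] by (simp add: e2)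
  also have "\<dots> \<le> dist (F ?a (y (- int i))) (F ?a (y' (- int i))) + dist (F ?a (y' (- int i))) (F ?b (y' (- int i)))"
    by (rule dist_triangle)
  also have "\<dots> \<le> \<alpha>\<^sup>2 * dist (y (- int i)) (y' (- int i)) + S * dist ?a ?b"
    by (intro add_mono lip_fibre lip_base)
  finally show ?thesis by simp
qed

text \<open>Unrolling the one-step estimates into the past bounds the distance by the product of
  \<open>k\<close> rates times the distance at time \<open>- k\<close>, plus
  \<open>S * dist \<theta> \<theta>'\<close> times the sum of the partial products. These products
  decay geometrically with a prefactor depending only on \<open>P\<close>.\<close>

lemma two_orbits_close:
  assumes orb: "\<And>k::int. y (k + 1) = F (R k \<theta>) (y k)" "\<And>k::int. y' (k + 1) = F (R k \<theta>') (y' k)"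
    and inX: "\<And>k. y k \<in> X \<or> after_hit (R k \<theta>)" "\<And>k. y' k \<in> X \<or> after_hit (R k \<theta>')"
    and good: "Good P \<theta>" "Good P \<theta>'" and d: "dist \<theta> \<theta>' \<le> \<delta>\<^sub>0"
  defines "B \<equiv> (\<Sum>j<P. (real (M j) + 3)\<^sup>2)" and "\<rho> \<equiv> \<alpha> powr (-4/25)"
  shows "dist (y 0) (y' 0) \<le> \<alpha> powr (6 * B) * S / (1 - \<rho>) * dist \<theta> \<theta>'"
proof -
  define e where "e i = dist (y (- int i)) (y' (- int i))" for i :: nat
  define bd where "bd i \<longleftrightarrow> (\<exists>j. bad \<theta> j i) \<or> (\<exists>j. bad \<theta>' j i)" for i
  define r where "r i = (if bd i then \<alpha>\<^sup>2 else 1 / \<alpha>)" for i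
  define Pr where "Pr k = (\<Prod>i\<in>{1..k}. r i)" for k
  have r0: "r i \<ge> 0" for i using \<alpha> by (simp add: r_def)
  have Pr0: "Pr k \<ge> 0" for k unfolding Pr_def by (intro prod_nonneg) (simp add: r0)
  have stp: "e i \<le> r (Suc i) * e (Suc i) + S * dist \<theta> \<theta>'" for i
  proof (cases "bd (Suc i)")
    case True
    then show ?thesis using any_step[of y \<theta> y' \<theta>', OF orb, of "Suc i"] by (simp add: e_def r_def)
  next
    case False
    then show ?thesis using good_step[of y \<theta> y' \<theta>', OF orb inX d, of "Suc i"] by (simp add: e_def r_def bd_def)
  qed
  have expand: "e 0 \<le> Pr k * e k + S * dist \<theta> \<theta>' * (\<Sum>i<k. Pr i)" for k
  proof (induction k)
    case (Suc k)
    have "Pr k * e k \<le> Pr k * (r (Suc k) * e (Suc k) + S * dist \<theta> \<theta>')"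
      by (intro mult_left_mono stp Pr0)
    moreover have "Pr (Suc k) = Pr k * r (Suc k)" by (simp add: Pr_def)
    ultimately show ?case using Suc by (simp add: algebra_simps)
  qed (simp add: Pr_def)
  have \<rho>: "0 < \<rho>" "\<rho> < 1" using \<alpha> by (auto simp: \<rho>_def powr_less_one)
  have Pr_le: "Pr k \<le> \<alpha> powr (6 * B) * \<rho> ^ k" for k
  proof -
    let ?b = "card {i \<in> {1..k}. bd i}"
    have "Pr k = (\<Prod>i\<in>{1..k}. \<alpha> powr (if bd i then 2 else -1))"
      unfolding Pr_def r_def using \<alpha> by (intro prod.cong) (auto simp: powr_minus inverse_eq_divide powr_realpow)
    also have "\<dots> = \<alpha> powr (\<Sum>i\<in>{1..k}. if bd i then 2 else -1)"
      using \<alpha> by (simp add: powr_sum)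
    also have "(\<Sum>i\<in>{1..k}. if bd i then 2 else -1) = (\<Sum>i\<in>{1..k}. (if bd i then 3 else 0) - (1::real))"
      by (intro sum.cong) auto
    also have "\<dots> = 3 * real ?b - real k"
      by (simp add: sum_subtractf sum.If_cases Int_def conj_commute)
    \<comment> \<open>Each orbit has at most \<open>B + 7/50 * k\<close> bad times, so the exponent
      is at most 3 (2 B + 7/25 k) - k = 6 B - 4/25 k.\<close>
    also have "\<alpha> powr (3 * real ?b - real k) \<le> \<alpha> powr (6 * B + (-4/25) * real k)"
    proof (rule powr_mono)
      have "{i \<in> {1..k}. bd i} = {i \<in> {1..k}. \<exists>j. bad \<theta> j i} \<union> {i \<in> {1..k}. \<exists>j. bad \<theta>' j i}"
        by (auto simp: bd_def)
      then have "?b \<le> card {i \<in> {1..k}. \<exists>j. bad \<theta> j i} + card {i \<in> {1..k}. \<exists>j. bad \<theta>' j i}"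
        by (metis card_Un_le)
      then have "real ?b \<le> real (card {i \<in> {1..k}. \<exists>j. bad \<theta> j i}) + real (card {i \<in> {1..k}. \<exists>j. bad \<theta>' j i})"
        by linarith
      also have "\<dots> \<le> 2 * B + 7/25 * real k"
        using card_bad_total[OF good(1), of k] card_bad_total[OF good(2), of k] by (simp add: B_def)
      finally show "3 * real ?b - real k \<le> 6 * B + (-4/25) * real k" by simp
    qed (use \<alpha> in simp)
    also have "\<dots> = \<alpha> powr (6 * B) * \<rho> ^ k"
    proof -
      have "\<alpha> powr ((-4/25) * real k) = \<rho> powr (real k)" unfolding \<rho>_def powr_powr ..
      then show ?thesis using \<rho> by (simp only: powr_add powr_realpow)
    qed
    finally show ?thesis .
  qed
  have bound: "e 0 \<le> \<alpha> powr (6 * B) * \<rho> ^ k + S * dist \<theta> \<theta>' * (\<alpha> powr (6 * B) / (1 - \<rho>))" for k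
  proof -
    have "(\<Sum>i<k. Pr i) \<le> (\<Sum>i<k. \<alpha> powr (6 * B) * \<rho> ^ i)" by (intro sum_mono Pr_le)
    also have "\<dots> = \<alpha> powr (6 * B) * (\<Sum>i<k. \<rho> ^ i)" by (simp add: sum_distrib_left)
    also have "(\<Sum>i<k. \<rho> ^ i) \<le> (\<Sum>i. \<rho> ^ i)" using \<rho> by (intro sum_le_suminf summable_geometric) auto
    also have "\<dots> = 1 / (1 - \<rho>)" using \<rho> by (intro suminf_geometric) auto
    finally have 1: "(\<Sum>i<k. Pr i) \<le> \<alpha> powr (6 * B) / (1 - \<rho>)" by (simp add: mult_left_mono)
    have "e k \<le> 1" using dist_T1_le_half[of "y (- int k)" "y' (- int k)"] by (simp add: e_def)
    then have 2: "Pr k * e k \<le> (\<alpha> powr (6 * B) * \<rho> ^ k) * 1"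
      using \<rho> by (intro mult_mono Pr_le) (auto simp: e_def)
    have "S * dist \<theta> \<theta>' * (\<Sum>i<k. Pr i) \<le> S * dist \<theta> \<theta>' * (\<alpha> powr (6 * B) / (1 - \<rho>))"
      using 1 S by (intro mult_left_mono) auto
    then show ?thesis using 2 expand[of k] by simp
  qed
  \<comment> \<open>Letting \<open>k\<close> grow removes the contribution of the unknown distance
    in the far past; only the term linear in \<open>dist \<theta> \<theta>'\<close> remains.\<close>
  have "(\<lambda>k. \<alpha> powr (6 * B) * \<rho> ^ k + S * dist \<theta> \<theta>' * (\<alpha> powr (6 * B) / (1 - \<rho>)))
      \<longlonglongrightarrow> \<alpha> powr (6 * B) * 0 + S * dist \<theta> \<theta>' * (\<alpha> powr (6 * B) / (1 - \<rho>))"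
    using \<rho> by (intro tendsto_intros LIMSEQ_realpow_zero) auto
  then have "e 0 \<le> \<alpha> powr (6 * B) * 0 + S * dist \<theta> \<theta>' * (\<alpha> powr (6 * B) / (1 - \<rho>))"
    by (rule LIMSEQ_le_const) (use bound in blast)
  then show ?thesis by (simp add: e_def algebra_simps)
qed

end

section \<open>Lipschitz pieces of the invariant graph\<close>

lemma measurable_rotn_preimage: "A \<in> sets borel \<Longrightarrow> rotn w k -` A \<in> sets borel"
  unfolding rotn_def by (rule measurable_sets_borel[OF measurable_rotT])

text \<open>The assumption \<open>visits\<close> is what the sign of the Lyapunov exponent will
  supply: the graph meets the strip, over points where an orbit may be started, on a set that is not
  null. \<open>erg\<close> spreads this to almost every orbit.\<close>

locale skew_contraction_graph = skew_contraction +
  fixes \<phi> :: "T1 \<Rightarrow> T1"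
  assumes J_borel: "J n \<in> sets borel"
    and J_small: "(\<Sum>n. ennreal (real (2 * K n * M n + 1)) * emeasure LebT (J n)) < \<infinity>"
    and X_closed: "closed X"
    and \<phi>_meas: "\<phi> \<in> measurable LebT borel"
    and \<phi>_inv: "AE \<theta> in LebT. F \<theta> (\<phi> \<theta>) = \<phi> (rotT w \<theta>)"
    and erg: "B \<in> sets borel \<Longrightarrow> rotT w -` B = B \<Longrightarrow> emeasure LebT B = 0 \<or> emeasure LebT B = 1"
    and visits: "\<not> (AE \<theta> in LebT. \<not> before_hit \<theta> \<longrightarrow> \<phi> \<theta> \<notin> X)"
begin

lemma J_rotn_borel: "{\<theta>. R k \<theta> \<in> J j} \<in> sets borel"
  using measurable_rotn_preimage[OF J_borel, of w k j] by (simp add: vimage_def)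

lemma Good_borel: "{\<theta>. Good P \<theta>} \<in> sets borel"
proof -
  have "{\<theta>. Good P \<theta>} = - (\<Union>j\<in>{P..}. \<Union>l\<in>{..2 * K j * M j}. {\<theta>. R (- int l) \<theta> \<in> J j})"
    by (auto simp: Good_def)
  also have "\<dots> \<in> sets borel"
    by (intro borel_comp sets.countable_UN'' J_rotn_borel) auto
  finally show ?thesis .
qed

lemma before_hit_borel: "{\<theta>. \<not> before_hit \<theta>} \<in> sets borel"
proof -
  have "{\<theta>. \<not> before_hit \<theta>} = - (\<Union>j. \<Union>l\<in>{..<p j}. {\<theta>. R (int l) \<theta> \<in> J j})"
    by (auto simp: before_hit_def)
  also have "\<dots> \<in> sets borel"
    by (intro borel_comp sets.countable_UN'' J_rotn_borel) auto
  finally show ?thesis .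
qed

lemma AE_Good: "AE \<theta> in LebT. \<exists>P. Good P \<theta>"
proof -
  define A where "A j = (\<Union>l\<in>{..2 * K j * M j}. {\<theta>. R (- int l) \<theta> \<in> J j})" for j
  have A: "A j \<in> sets borel" for j unfolding A_def by (intro sets.countable_UN'' J_rotn_borel) auto
  have mA: "emeasure LebT (A j) \<le> ennreal (real (2 * K j * M j + 1)) * emeasure LebT (J j)" for j
  proof -
    have "emeasure LebT (A j) \<le> (\<Sum>l\<le>2 * K j * M j. emeasure LebT {\<theta>. R (- int l) \<theta> \<in> J j})"
      unfolding A_def by (intro emeasure_subadditive_finite) (auto intro: borel_imp_LebT J_rotn_borel)
    also have "\<dots> = (\<Sum>l\<le>2 * K j * M j. emeasure LebT (J j))"
      using emeasure_LebT_rotT(2)[OF borel_imp_LebT[OF J_borel]] by (simp add: rotn_def vimage_def)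
    finally show ?thesis by (simp add: ennreal_of_nat_eq_real_of_nat add.commute)
  qed
  have "(\<Sum>j. emeasure LebT (A j)) \<le> (\<Sum>n. ennreal (real (2 * K n * M n + 1)) * emeasure LebT (J n))"
    by (intro suminf_le mA) auto
  then have fin: "(\<Sum>j. emeasure LebT (A j)) \<noteq> \<infinity>" using J_small by (auto simp: top_unique)
  have "(\<Sum>j. ennreal (measure LebT (A j))) \<noteq> top"
    using fin by (simp add: LebT.emeasure_eq_measure)
  then have "summable (\<lambda>j. measure LebT (A j))"
    by (intro summable_suminf_not_top) auto
  moreover have "emeasure LebT (A j) < \<infinity>" for j
    by (simp add: LebT.emeasure_eq_measure)
  ultimately have "AE \<theta> in LebT. eventually (\<lambda>n. \<theta> \<in> space LebT - A n) sequentially"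
    using borel_imp_LebT[OF A] by (intro borel_cantelli_AE1)
  then show ?thesis
  proof eventually_elim
    case (elim \<theta>)
    then show ?case unfolding eventually_sequentially Good_def A_def by auto
  qed
qed

lemma AE_all_rotn:
  assumes "AE \<theta> in LebT. Pr \<theta>" shows "AE \<theta> in LebT. \<forall>k. Pr (R k \<theta>)"
  unfolding AE_all_countable rotn_def using AE_LebT_rotT[OF assms] by blast

text \<open>Ergodicity gives a visit at some time of either sign. The sets \<open>V n\<close> of
  points with a visit at a time at most \<open>n\<close> increase to the invariant set
  \<open>W\<close> and are rotated copies of each other; having equal measure, they all have full
  measure, in particular \<open>V 0\<close>.\<close>

lemma AE_visit: "AE \<theta> in LebT. \<exists>k::nat. \<phi> (R (- int k) \<theta>) \<in> X \<and> \<not> before_hit (R (- int k) \<theta>)"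
proof -
  define Q where "Q = {\<theta>. \<phi> \<theta> \<in> X \<and> \<not> before_hit \<theta>}"
  have Q: "Q \<in> sets LebT"
  proof -
    have "\<phi> -` X \<inter> space LebT \<in> sets LebT" using X_closed by (intro measurable_sets[OF \<phi>_meas]) auto
    moreover have "Q = (\<phi> -` X \<inter> space LebT) \<inter> {\<theta>. \<not> before_hit \<theta>}" by (auto simp: Q_def)
    ultimately show ?thesis using before_hit_borel by (auto intro: borel_imp_LebT)
  qed
  obtain Q' where Q': "Q' \<in> sets borel" "Q' \<subseteq> Q" "Q - Q' \<in> null_sets LebT"
    by (rule sets_LebT_sandwich[OF Q])
  have Q'0: "emeasure LebT Q' \<noteq> 0"
  proof
    assume "emeasure LebT Q' = 0"
    then have "Q' \<in> null_sets LebT" using Q' by (auto intro: borel_imp_LebT)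
    then have "Q' \<union> (Q - Q') \<in> null_sets LebT" using Q'(3) by (rule null_sets.Un)
    moreover have "Q' \<union> (Q - Q') = Q" using Q'(2) by auto
    ultimately have "AE \<theta> in LebT. \<theta> \<notin> Q" using AE_not_in by metis
    then have "AE \<theta> in LebT. \<not> before_hit \<theta> \<longrightarrow> \<phi> \<theta> \<notin> X" by eventually_elim (auto simp: Q_def)
    then show False using visits by blast
  qed
  define V where "V n = {\<theta>. \<exists>k\<le>n. R k \<theta> \<in> Q'}" for n :: int
  define W where "W = {\<theta>. \<exists>k. R k \<theta> \<in> Q'}"
  have V: "V n \<in> sets borel" for n
  proof -
    have "V n = (\<Union>k\<in>{..n}. R k -` Q')" by (auto simp: V_def)
    also have "\<dots> \<in> sets borel" by (intro sets.countable_UN'' measurable_rotn_preimage Q') auto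
    finally show ?thesis .
  qed
  have W_eq: "W = (\<Union>n::nat. V (int n))"
  proof
    show "W \<subseteq> (\<Union>n::nat. V (int n))"
    proof
      fix \<theta> assume "\<theta> \<in> W"
      then obtain k where "R k \<theta> \<in> Q'" by (auto simp: W_def)
      then have "\<theta> \<in> V (int (nat k))" by (auto simp: V_def intro!: exI[of _ k])
      then show "\<theta> \<in> (\<Union>n::nat. V (int n))" by blast
    qed
  qed (auto simp: V_def W_def)
  then have W: "W \<in> sets borel" using V by auto
  have W_inv: "rotT w -` W = W"
  proof (rule set_eqI)
    fix \<theta>
    have "R k (rotT w \<theta>) = R (k + 1) \<theta>" for k by (simp add: rotn_def algebra_simps)
    then have "rotT w \<theta> \<in> W \<longleftrightarrow> (\<exists>k. R (k + 1) \<theta> \<in> Q')" by (simp add: W_def)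
    also have "\<dots> \<longleftrightarrow> \<theta> \<in> W" unfolding W_def by (simp, metis diff_add_cancel)
    finally show "\<theta> \<in> rotT w -` W \<longleftrightarrow> \<theta> \<in> W" by simp
  qed
  have "R 0 \<theta> = \<theta>" for \<theta> by simp
  then have "Q' \<subseteq> W" unfolding W_def by (auto intro!: exI[of _ 0])
  then have "emeasure LebT Q' \<le> emeasure LebT W" using W by (intro emeasure_mono borel_imp_LebT)
  then have W1: "emeasure LebT W = 1" using erg[OF W W_inv] Q'0 by auto
  have Vn: "emeasure LebT (V n) = emeasure LebT (V 0)" for n
  proof -
    have "V n = R n -` V 0"
    proof (rule set_eqI)
      fix \<theta>
      have "\<theta> \<in> V n \<longleftrightarrow> (\<exists>k\<le>0. R (k + n) \<theta> \<in> Q')"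
        unfolding V_def
      proof safe
        fix k assume "k \<le> n" "R k \<theta> \<in> Q'"
        then show "\<exists>k\<le>0. R (k + n) \<theta> \<in> Q'" by (intro exI[of _ "k - n"]) auto
      next
        fix k assume "k \<le> 0" "R (k + n) \<theta> \<in> Q'"
        then show "\<exists>k\<le>n. R k \<theta> \<in> Q'" by (intro exI[of _ "k + n"]) auto
      qed
      then show "\<theta> \<in> V n \<longleftrightarrow> \<theta> \<in> R n -` V 0" by (simp add: V_def)
    qed
    then show ?thesis using emeasure_LebT_rotT(2)[OF borel_imp_LebT[OF V]] by (simp add: rotn_def)
  qed
  have "(SUP n::nat. emeasure LebT (V (int n))) = emeasure LebT (\<Union>n::nat. V (int n))"
  proof (rule SUP_emeasure_incseq)
    show "range (\<lambda>n. V (int n)) \<subseteq> sets LebT" using borel_imp_LebT[OF V] by auto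
    show "incseq (\<lambda>n. V (int n))"
    proof (intro incseq_SucI subsetI)
      fix n \<theta> assume "\<theta> \<in> V (int n)"
      then obtain k where "k \<le> int n" "R k \<theta> \<in> Q'" by (auto simp: V_def)
      then show "\<theta> \<in> V (int (Suc n))" unfolding V_def by (auto intro!: exI[of _ k])
    qed
  qed
  moreover have "(\<lambda>n::nat. emeasure LebT (V (int n))) = (\<lambda>_. emeasure LebT (V 0))"
    by (rule ext) (rule Vn)
  ultimately have V1: "emeasure LebT (V 0) = 1"
    using W1 unfolding W_eq by (simp only: SUP_constant) simp
  have "emeasure LebT (space LebT - V 0) = 0"
    using V1 V[of 0] by (subst emeasure_compl) (auto intro: borel_imp_LebT)
  then have "space LebT - V 0 \<in> null_sets LebT"
    using V[of 0] by (intro null_setsI) (auto intro: borel_imp_LebT sets.compl_sets)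
  then have "AE \<theta> in LebT. \<theta> \<notin> space LebT - V 0" by (rule AE_not_in)
  then show ?thesis
  proof eventually_elim
    case (elim \<theta>)
    then obtain k where k: "k \<le> 0" "R k \<theta> \<in> Q'" by (auto simp: V_def)
    then have "R (- int (nat (- k))) \<theta> \<in> Q" using Q'(2) by auto
    then show ?case unfolding Q_def by blast
  qed
qed

lemma AE_orbit_in_X:
  "AE \<theta> in LebT. \<forall>k. F (R k \<theta>) (\<phi> (R k \<theta>)) = \<phi> (R (k + 1) \<theta>) \<and> (\<phi> (R k \<theta>) \<in> X \<or> after_hit (R k \<theta>))"
proof -
  have inv: "AE \<theta> in LebT. \<forall>k. F (R k \<theta>) (\<phi> (R k \<theta>)) = \<phi> (R (k + 1) \<theta>)"
    using AE_all_rotn[OF \<phi>_inv] by (simp add: rotT_rotn)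
  have "AE \<theta> in LebT. \<phi> \<theta> \<in> X \<or> after_hit \<theta>"
    using inv AE_visit AE_Good
  proof eventually_elim
    case (elim \<theta>)
    then obtain P k where Pk: "Good P \<theta>" "\<phi> (R (- int k) \<theta>) \<in> X" "\<not> before_hit (R (- int k) \<theta>)" by blast
    have "\<phi> (R 0 \<theta>) \<in> X \<or> after_hit \<theta>"
      by (rule backward_orbit_in_X[where y="\<lambda>k. \<phi> (R k \<theta>)" and k=k]) (use elim Pk in auto)
    then show ?case by simp
  qed
  from inv AE_all_rotn[OF this] show ?thesis by eventually_elim blast
qed

lemma rectifiable: "rectifiable_1_measure (graph_measure \<phi>)"
proof -
  obtain N where N: "N \<in> null_sets LebT" and ok: "\<And>\<theta>. \<theta> \<notin> N \<Longrightarrow>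
    \<forall>k. F (R k \<theta>) (\<phi> (R k \<theta>)) = \<phi> (R (k + 1) \<theta>) \<and> (\<phi> (R k \<theta>) \<in> X \<or> after_hit (R k \<theta>))"
    using AE_orbit_in_X by (auto simp: eventually_ae_filter)
  define G where "G P = {\<theta>. Good P \<theta>} - N" for P
  show ?thesis
  proof (rule rectifiable_graph_measure[OF \<phi>_meas])
    show "G P \<in> sets LebT" for P
      unfolding G_def using borel_imp_LebT[OF Good_borel] N by (intro sets.Diff) auto
    show "AE \<theta> in LebT. \<theta> \<in> (\<Union>P. G P)"
      using AE_Good AE_not_in[OF N] by eventually_elim (auto simp: G_def)
    show "\<exists>L. L-lipschitz_on (G P) \<phi>" for P
    proof -
      define L where "L = \<alpha> powr (6 * (\<Sum>j<P. (real (M j) + 3)\<^sup>2)) * S / (1 - \<alpha> powr (-4/25))"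
      \<comment> \<open>\<open>two_orbits_close\<close> covers base distances up to
        \<open>\<delta>\<^sub>0\<close>; beyond, \<open>1 / \<delta>\<^sub>0\<close> suffices
        because circle distances are at most 1/2.\<close>
      have "(max L (1 / \<delta>\<^sub>0))-lipschitz_on (G P) \<phi>"
      proof (rule lipschitz_onI)
        fix \<theta> \<theta>' assume h: "\<theta> \<in> G P" "\<theta>' \<in> G P"
        note ok' = ok[of \<theta>] ok[of \<theta>']
        show "dist (\<phi> \<theta>) (\<phi> \<theta>') \<le> max L (1 / \<delta>\<^sub>0) * dist \<theta> \<theta>'"
        proof (cases "dist \<theta> \<theta>' \<le> \<delta>\<^sub>0")
          case True
          have "dist (\<phi> (R 0 \<theta>)) (\<phi> (R 0 \<theta>')) \<le> L * dist \<theta> \<theta>'"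
            unfolding L_def
            by (rule two_orbits_close[where y="\<lambda>k. \<phi> (R k \<theta>)" and y'="\<lambda>k. \<phi> (R k \<theta>')"])
               (use h ok' True in \<open>auto simp: G_def\<close>)
          also have "\<dots> \<le> max L (1 / \<delta>\<^sub>0) * dist \<theta> \<theta>'" by (intro mult_right_mono) auto
          finally show ?thesis by simp
        next
          case False
          have "dist (\<phi> \<theta>) (\<phi> \<theta>') \<le> 1" using dist_T1_le_half[of "\<phi> \<theta>" "\<phi> \<theta>'"] by simp
          also have "\<dots> \<le> (1 / \<delta>\<^sub>0) * dist \<theta> \<theta>'" using False \<delta>\<^sub>0 by (simp add: field_simps)
          also have "\<dots> \<le> max L (1 / \<delta>\<^sub>0) * dist \<theta> \<theta>'" by (intro mult_right_mono) auto
          finally show ?thesis .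
        qed
      next
        show "0 \<le> max L (1 / \<delta>\<^sub>0)" using \<delta>\<^sub>0 by (intro max.coboundedI2) simp
      qed
      then show ?thesis by blast
    qed
  qed
qed

end

section \<open>Fibre maps and their lifts\<close>

text \<open>A point off the arc has a lift in each gap between consecutive translates of [u, v]. A
  continuous lift moving from one translate to another would hit such a lift by the intermediate
  value theorem.\<close>

lemma same_copy:
  fixes g :: "real \<Rightarrow> real"
  assumes cont: "continuous_on {a..b} g" and ab: "a \<le> b"
    and avoid: "\<And>z. z \<in> {a..b} \<Longrightarrow> abs_T1 (g z) \<noteq> c" and c: "c \<notin> cl_arc u v"
    and ga: "g a \<in> {u + of_int k..v + of_int k}" and gb: "g b \<in> {u + of_int k'..v + of_int k'}"
  shows "k = k'"
proof (rule ccontr)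
  have lift: "\<exists>s. c = abs_T1 s \<and> v + of_int i < s \<and> s < u + of_int i + 1" for i :: int
  proof -
    obtain s where s: "c = abs_T1 s" "s \<in> {u + of_int i..<u + of_int i + 1}" by (rule T1_cases)
    have "v + of_int i < s"
    proof (rule ccontr)
      assume "\<not> v + of_int i < s"
      then have "s - of_int i \<in> {u..v}" using s by auto
      moreover have "c = abs_T1 (s - of_int i)"
        using s(1) abs_T1_add_int[of "s - of_int i" i] by simp
      ultimately show False using c by (auto simp: cl_arc_def)
    qed
    then show ?thesis using s by auto
  qed
  assume "k \<noteq> k'"
  then consider "k < k'" | "k' < k" by linarith
  then show False
  proof cases
    case 1
    obtain s where s: "c = abs_T1 s" "v + of_int k < s" "s < u + of_int k + 1" using lift by blast
    have "real_of_int k + 1 \<le> of_int k'" using 1 by linarith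
    then have "g a \<le> s" "s \<le> g b" using ga gb s by auto
    then obtain z where "z \<in> {a..b}" "g z = s" using IVT'[OF _ _ ab cont] by auto
    then show False using avoid s by auto
  next
    case 2
    obtain s where s: "c = abs_T1 s" "v + of_int k' < s" "s < u + of_int k' + 1" using lift by blast
    have "real_of_int k' + 1 \<le> of_int k" using 2 by linarith
    then have "g b \<le> s" "s \<le> g a" using ga gb s by auto
    then obtain z where "z \<in> {a..b}" "g z = s" using IVT2'[OF _ _ ab cont] by auto
    then show False using avoid s by auto
  qed
qed

text \<open>Going around outside the arc costs at least \<open>1 - (v - u)\<close>, so for closer
  points the distance is realised inside the arc.\<close>

lemma arc_dist:
  assumes "r \<in> {u..v}" "r' \<in> {u..v}" "dist (abs_T1 r) (abs_T1 r') < 1 - (v - u)"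
  shows "\<bar>r - r'\<bar> \<le> dist (abs_T1 r) (abs_T1 r')"
proof (cases "round (r - r') = 0")
  case True
  then show ?thesis by (simp add: dist_abs_T1)
next
  case False
  then have "\<bar>real_of_int (round (r - r'))\<bar> \<ge> 1" by linarith
  then have "dist (abs_T1 r) (abs_T1 r') \<ge> 1 - \<bar>r - r'\<bar>" unfolding dist_abs_T1 by linarith
  moreover have "\<bar>r - r'\<bar> \<le> v - u" using assms by (auto simp: abs_le_iff)
  ultimately show ?thesis using assms(3) by linarith
qed

text \<open>After one step the fibre contraction leaves lifts within 1/4, and the change of base
  point moves one of them by at most 1/4 inside the strip. Lifts within 1/2 realise the circle
  distance, so the second contraction can be stated with it.\<close>

lemma two_step_contraction:
  fixes F :: "T1 \<Rightarrow> T1 \<Rightarrow> T1"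
  assumes uv: "v < u + 1" and \<alpha>: "\<alpha> > 4"
    and strip: "\<And>\<theta> s s'. \<theta> \<notin> J \<Longrightarrow> s \<in> {u..v} \<Longrightarrow> s' \<in> {u..v} \<Longrightarrow>
      \<exists>r\<in>{u..v}. \<exists>r'\<in>{u..v}. F \<theta> (abs_T1 s) = abs_T1 r \<and> F \<theta> (abs_T1 s') = abs_T1 r' \<and> \<bar>r - r'\<bar> \<le> \<bar>s - s'\<bar> / \<alpha>"
    and base: "\<And>\<theta> \<theta>' x. dist (F \<theta> x) (F \<theta>' x) \<le> S * dist \<theta> \<theta>'" and S: "S \<ge> 0"
    and d: "dist \<theta> \<theta>' \<le> min (1/4) (1 - (v - u)) / (2 * (S + 1))"
    and x: "x \<in> cl_arc u v" "x' \<in> cl_arc u v"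
    and J: "\<theta> \<notin> J" "\<theta>' \<notin> J" "rotT w \<theta> \<notin> J" "rotT w \<theta>' \<notin> J"
  shows "dist (F (rotT w \<theta>) (F \<theta> x)) (F (rotT w \<theta>') (F \<theta>' x'))
        \<le> dist (F \<theta> x) (F \<theta>' x') / \<alpha> + S * dist \<theta> \<theta>'"
proof -
  define \<eta> where "\<eta> = min (1/4) (1 - (v - u))"
  have \<eta>: "\<eta> > 0" "\<eta> \<le> 1/4" "\<eta> \<le> 1 - (v - u)"
    using uv min.cobounded1[of "1/4" "1 - (v - u)"] min.cobounded2[of "1/4" "1 - (v - u)"]
    unfolding \<eta>_def by linarith+
  \<comment> \<open>The radius contains a factor 1/2 for a strict inequality and
    \<open>S + 1\<close> to avoid division by zero.\<close>
  have "S * dist \<theta> \<theta>' \<le> (S + 1) * (\<eta> / (2 * (S + 1)))"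
    using d S by (intro mult_mono) (auto simp: \<eta>_def)
  also have "\<dots> = \<eta> / 2" using S by (simp add: field_simps)
  finally have Sd: "S * dist \<theta> \<theta>' < \<eta>" using \<eta> by simp
  obtain s s' where s: "x = abs_T1 s" "x' = abs_T1 s'" "s \<in> {u..v}" "s' \<in> {u..v}"
    using x by (auto simp: cl_arc_def)
  obtain r r' where r: "r \<in> {u..v}" "r' \<in> {u..v}" "F \<theta> x = abs_T1 r" "F \<theta> x' = abs_T1 r'" "\<bar>r - r'\<bar> \<le> \<bar>s - s'\<bar> / \<alpha>"
    using strip[OF J(1) s(3,4)] s by auto
  obtain r'' where r'': "r'' \<in> {u..v}" "F \<theta>' x' = abs_T1 r''"
    using strip[OF J(2) s(4) s(4)] s by auto
  have d1: "dist (abs_T1 r') (abs_T1 r'') \<le> S * dist \<theta> \<theta>'" using base[of \<theta> x' \<theta>'] r r'' by simp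
  then have "\<bar>r' - r''\<bar> \<le> dist (abs_T1 r') (abs_T1 r'')"
    using Sd \<eta> by (intro arc_dist[OF r(2) r''(1)]) simp
  then have r1: "\<bar>r' - r''\<bar> \<le> 1/4" using d1 Sd \<eta> by linarith
  have "\<bar>s - s'\<bar> \<le> 1" using s uv by (auto simp: abs_le_iff)
  then have "\<bar>s - s'\<bar> / \<alpha> \<le> 1 / 4" using \<alpha> by (intro frac_le) auto
  then have "\<bar>r - r''\<bar> \<le> 1/2" using r(5) r1 by linarith
  then have rr: "dist (F \<theta> x) (F \<theta>' x') = \<bar>r - r''\<bar>" using r r'' by (simp add: dist_abs_T1_eq)
  obtain z z' where z: "F (rotT w \<theta>) (F \<theta> x) = abs_T1 z" "F (rotT w \<theta>) (F \<theta>' x') = abs_T1 z'" "\<bar>z - z'\<bar> \<le> \<bar>r - r''\<bar> / \<alpha>"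
    using strip[OF J(3) r(1) r''(1)] r r'' by auto
  have "dist (F (rotT w \<theta>) (F \<theta> x)) (F (rotT w \<theta>') (F \<theta>' x'))
     \<le> dist (abs_T1 z) (abs_T1 z') + dist (F (rotT w \<theta>) (F \<theta>' x')) (F (rotT w \<theta>') (F \<theta>' x'))"
    unfolding z(1) z(2)[symmetric] by (rule dist_triangle)
  also have "\<dots> \<le> \<bar>z - z'\<bar> + S * dist (rotT w \<theta>) (rotT w \<theta>')"
    by (intro add_mono dist_abs_T1_le base)
  also have "\<dots> \<le> dist (F \<theta> x) (F \<theta>' x') / \<alpha> + S * dist \<theta> \<theta>'"
    using z(3) by (simp add: rr)
  finally show ?thesis .
qed

text \<open>\<open>f\<close> dominates the function that is \<open>c\<close> off \<open>Z\<close>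
  and \<open>- 2 * c\<close> on \<open>Z\<close>, whose integral exceeds c (1 - 3/16).\<close>

lemma integral_pos_if_mostly_large:
  fixes f :: "T1 \<Rightarrow> real"
  assumes c: "c > 0" and nz: "(\<integral>\<theta>. f \<theta> \<partial>LebT) \<noteq> 0"
    and lower: "\<And>\<theta>. f \<theta> \<ge> - 2 * c" and big: "AE \<theta> in LebT. \<theta> \<notin> Z \<longrightarrow> f \<theta> \<ge> c"
    and Z: "Z \<in> sets LebT" "emeasure LebT Z < ennreal (1/16)"
  shows "(\<integral>\<theta>. f \<theta> \<partial>LebT) > 0"
proof -
  \<comment> \<open>The integral of a non-integrable function is 0 by convention, so a nonzero value
    implies integrability.\<close>
  have int: "integrable LebT f" using nz not_integrable_integral_eq by blast
  have mZ: "measure LebT Z < 1/16" using Z(2) by (simp add: LebT.emeasure_eq_measure ennreal_less_iff)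
  have iZ: "integrable LebT (\<lambda>\<theta>. indicator Z \<theta> :: real)"
    using Z by (intro integrable_real_indicator) (auto simp: LebT.emeasure_eq_measure)
  have "0 < c - 3 * c * (1/16)" using c by simp
  also have "\<dots> < c - 3 * c * measure LebT Z" using mZ c by simp
  also have "\<dots> = (\<integral>\<theta>. c - 3 * c * indicator Z \<theta> \<partial>LebT)"
    using iZ by (simp add: measure_def)
  also have "\<dots> \<le> (\<integral>\<theta>. f \<theta> \<partial>LebT)"
  proof (rule integral_mono_AE)
    show "integrable LebT (\<lambda>\<theta>. c - 3 * c * indicator Z \<theta>)" using iZ by auto
    show "AE \<theta> in LebT. c - 3 * c * indicator Z \<theta> \<le> f \<theta>"
      using big
    proof eventually_elim
      case (elim \<theta>) then show ?case using lower[of \<theta>] by (auto simp: indicator_def)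
    qed
  qed (rule int)
  finally show ?thesis .
qed

locale lifted_fibres =
  fixes \<omega> :: real and G :: "real \<Rightarrow> real \<Rightarrow> real"
  assumes F_omega: "F_omega \<omega> G"
begin

lemma G_add_int: "G (t + of_int k) (y + of_int l) = G t y + of_int l"
proof -
  have t1: "G (t + 1) y = G t y" and y1: "G t (y + 1) = G t y + 1" for t y
    using F_omega by (auto simp: F_omega_def)
  have tn: "G (t + of_nat n) y = G t y" for t y n
    by (induction n) (use t1[of "t + of_nat _"] in \<open>simp_all add: algebra_simps\<close>)
  have yn: "G t (y + of_nat n) = G t y + of_nat n" for t y n
    by (induction n) (use y1[of t "y + of_nat _"] in \<open>simp_all add: algebra_simps\<close>)
  have tk: "G (t + of_int k) y = G t y" for t y
  proof (cases k)
    case (nonneg n) then show ?thesis using tn[of t n y] by simp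
  next
    case (neg n) then show ?thesis using tn[of "t + of_int k" "Suc n" y] by simp
  qed
  have "G t (y + of_int l) = G t y + of_int l"
  proof (cases l)
    case (nonneg n) then show ?thesis using yn[of t y n] by simp
  next
    case (neg n) then show ?thesis using yn[of t "y + of_int l" "Suc n"] by simp
  qed
  then show ?thesis using tk by simp
qed

lemma fib_abs: "fib G (abs_T1 t) (abs_T1 y) = abs_T1 (G t y)"
proof -
  obtain k where k: "rep (abs_T1 t) = t + of_int k" by (rule abs_T1_eqE[of "rep (abs_T1 t)" t]) simp
  obtain l where l: "rep (abs_T1 y) = y + of_int l" by (rule abs_T1_eqE[of "rep (abs_T1 y)" y]) simp
  show ?thesis by (simp add: fib_def k l G_add_int)
qed

lemma G_has_deriv: "(G t has_field_derivative deriv (G t) y) (at y)"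
proof -
  obtain D :: "real \<times> real \<Rightarrow> ((real \<times> real) \<Rightarrow>\<^sub>L real)"
    where D: "\<And>p. ((\<lambda>p. G (fst p) (snd p)) has_derivative blinfun_apply (D p)) (at p)"
    using F_omega unfolding F_omega_def C1_map_def by blast
  have "((\<lambda>y. (t, y)) has_derivative (\<lambda>h. (0, h))) (at y)"
    by (auto intro!: derivative_eq_intros)
  from has_derivative_compose[OF this D, of ]
  have "(G t has_derivative (\<lambda>h. D (t, y) (0, h))) (at y)" by simp
  then have "G t differentiable (at y)" by (auto simp: differentiable_def)
  then show ?thesis
    by (simp add: DERIV_deriv_iff_real_differentiable)
qed

lemma G_continuous: "continuous_on A (G t)"
  using G_has_deriv[of t] by (intro continuous_at_imp_continuous_on) (blast intro: DERIV_isCont)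

lemma deriv_G_add_int: "deriv (G (t + of_int k)) (y + of_int l) = deriv (G t) y"
proof -
  have "((\<lambda>z. G (t + of_int k) (z + of_int l)) has_field_derivative deriv (G (t + of_int k)) (y + of_int l)) (at y)"
    using G_has_deriv[of "t + of_int k" "y + of_int l"] by (simp add: DERIV_shift)
  moreover have "((\<lambda>z. G (t + of_int k) (z + of_int l)) has_field_derivative deriv (G t) y) (at y)"
    unfolding G_add_int by (auto intro!: derivative_eq_intros G_has_deriv)
  ultimately show ?thesis by (rule DERIV_unique)
qed

lemma dfib_abs: "dfib G (abs_T1 t) (abs_T1 y) = deriv (G t) y"
proof -
  obtain k where k: "rep (abs_T1 t) = t + of_int k" by (rule abs_T1_eqE[of "rep (abs_T1 t)" t]) simp
  obtain l where l: "rep (abs_T1 y) = y + of_int l" by (rule abs_T1_eqE[of "rep (abs_T1 y)" y]) simp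
  show ?thesis by (simp add: dfib_def k l deriv_G_add_int)
qed

lemma surj_fib: "\<exists>x. fib G \<theta> x = y"
proof -
  obtain t where t: "\<theta> = abs_T1 t" by (rule T1_cases)
  obtain s where s: "y = abs_T1 s" by (rule T1_cases)
  obtain H where "\<And>t y. G t (H t y) = y" using F_omega unfolding F_omega_def by blast
  then have "fib G \<theta> (abs_T1 (H t s)) = y" by (simp add: t s fib_abs)
  then show ?thesis ..
qed

lemma G_diff_mvt:
  assumes "s \<le> s'"
  obtains z where "z \<in> {s..s'}" "G t s' - G t s = (s' - s) * deriv (G t) z"
proof (cases "s = s'")
  case False
  then have "s < s'" using assms by simp
  from MVT2[OF this, of "G t" "deriv (G t)"] G_has_deriv obtain z where "s < z" "z < s'" "G t s' - G t s = (s' - s) * deriv (G t) z"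
    by blast
  then show ?thesis by (intro that) auto
qed (auto intro: that)

text \<open>For small increments the circle distance is the ordinary one, so the bi-Lipschitz bounds
  pass to difference quotients and to the limit. They limit the loss on the exceptional set of the
  Lyapunov integral.\<close>

lemma dfib_bounds:
  assumes \<alpha>: "\<alpha> > 0"
    and lip: "\<And>\<theta> x x'. dist x x' / \<alpha>\<^sup>2 \<le> dist (fib G \<theta> x) (fib G \<theta> x') \<and> dist (fib G \<theta> x) (fib G \<theta> x') \<le> \<alpha>\<^sup>2 * dist x x'"
  shows "1 / \<alpha>\<^sup>2 \<le> \<bar>dfib G \<theta> x\<bar>" "\<bar>dfib G \<theta> x\<bar> \<le> \<alpha>\<^sup>2"
proof -
  obtain t where t: "\<theta> = abs_T1 t" by (rule T1_cases)
  obtain y where y: "x = abs_T1 y" by (rule T1_cases)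
  have "(\<lambda>h. (G t (y + h) - G t y) / h) \<midarrow>0\<rightarrow> deriv (G t) y"
    using G_has_deriv[of t y] by (simp add: DERIV_def)
  then have lim: "(\<lambda>h. \<bar>(G t (y + h) - G t y) / h\<bar>) \<midarrow>0\<rightarrow> \<bar>dfib G \<theta> x\<bar>"
    unfolding t y dfib_abs by (rule tendsto_rabs)
  have "continuous_on UNIV (\<lambda>h. G t (y + h) - G t y)"
    by (intro continuous_intros continuous_on_compose2[OF G_continuous[of UNIV t]]) auto
  then have "isCont (\<lambda>h. G t (y + h) - G t y) 0" by (simp add: continuous_on_eq_continuous_at)
  then have "(\<lambda>h. G t (y + h) - G t y) \<midarrow>0\<rightarrow> 0" by (auto simp: isCont_def)
  then have ev: "\<forall>\<^sub>F h in at 0. \<bar>G t (y + h) - G t y\<bar> < 1/2"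
    using tendstoD[of "\<lambda>h. G t (y + h) - G t y" 0 "at 0" "1/2"] by (simp add: dist_real_def)
  have ev': "\<forall>\<^sub>F h in at (0::real). \<bar>h\<bar> < 1/2"
    by (auto simp: eventually_at dist_real_def intro!: exI[of _ "1/2"])
  have ne: "\<forall>\<^sub>F h in at (0::real). h \<noteq> 0" by (auto simp: eventually_at_filter)
  have bds: "\<forall>\<^sub>F h in at 0. 1 / \<alpha>\<^sup>2 \<le> \<bar>(G t (y + h) - G t y) / h\<bar> \<and> \<bar>(G t (y + h) - G t y) / h\<bar> \<le> \<alpha>\<^sup>2"
    using ev ev' ne
  proof eventually_elim
    case (elim h)
    have 1: "dist (abs_T1 (y + h)) (abs_T1 y) = \<bar>h\<bar>" using elim by (subst dist_abs_T1_eq) auto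
    have 2: "dist (abs_T1 (G t (y + h))) (abs_T1 (G t y)) = \<bar>G t (y + h) - G t y\<bar>" using elim by (subst dist_abs_T1_eq) auto
    have "\<bar>h\<bar> / \<alpha>\<^sup>2 \<le> \<bar>G t (y + h) - G t y\<bar>" "\<bar>G t (y + h) - G t y\<bar> \<le> \<alpha>\<^sup>2 * \<bar>h\<bar>"
      using lip[of "abs_T1 (y + h)" "abs_T1 y" "abs_T1 t"] by (auto simp: fib_abs 1 2)
    then show ?case using elim \<alpha> by (simp add: abs_divide field_simps)
  qed
  show "1 / \<alpha>\<^sup>2 \<le> \<bar>dfib G \<theta> x\<bar>"
    by (rule tendsto_lowerbound[OF lim]) (use bds in \<open>auto elim: eventually_mono\<close>)
  show "\<bar>dfib G \<theta> x\<bar> \<le> \<alpha>\<^sup>2"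
    by (rule tendsto_upperbound[OF lim]) (use bds in \<open>auto elim: eventually_mono\<close>)
qed

end

section \<open>Attractor and repeller\<close>

lemma shiftT_iff: "z \<in> shiftT \<omega> l A \<longleftrightarrow> rotn \<omega> (- l) z \<in> A"
  by (simp add: shiftT_def rotn_def rotT_image_iff)

lemma rotn_minus: "rotn (- w) k = rotn w (- k)"
  by (rule ext) (simp add: rotn_def)

text \<open>The product of the \<open>1 - c j\<close> times one plus the sum of the
  \<open>c j\<close> is at most 1, by induction from (1 - c)(1 + s + c) <= 1 + s; the product
  decreases to \<open>l\<close>.\<close>

lemma partial_sums_le_of_prod:
  fixes c :: "nat \<Rightarrow> real"
  assumes c: "\<And>j. 0 \<le> c j" "\<And>j. c j \<le> 1" and lim: "(\<lambda>n. \<Prod>j<n. 1 - c j) \<longlonglongrightarrow> l" and l: "l > 0"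
  shows "1 + (\<Sum>j<n. c j) \<le> 1 / l"
proof -
  have nn: "(\<Prod>j<n. 1 - c j) \<ge> 0" for n using c by (intro prod_nonneg) simp
  have "decseq (\<lambda>n. \<Prod>j<n. 1 - c j)"
  proof (rule decseq_SucI)
    fix n show "(\<Prod>j<Suc n. 1 - c j) \<le> (\<Prod>j<n. 1 - c j)"
      using mult_left_mono[OF _ nn, of "1 - c n" 1 n] c by simp
  qed
  then have ge: "l \<le> (\<Prod>j<n. 1 - c j)" using lim by (rule decseq_ge)
  have s0: "(\<Sum>j<n. c j) \<ge> 0" for n using c by (intro sum_nonneg) simp
  have "(\<Prod>j<n. 1 - c j) * (1 + (\<Sum>j<n. c j)) \<le> 1" for n
  proof (induction n)
    case (Suc n)
    let ?s = "\<Sum>j<n. c j"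
    have "(1 - c n) * (1 + ?s + c n) = 1 + ?s - c n * ?s - c n * c n" by (simp add: algebra_simps)
    also have "\<dots> \<le> 1 + ?s" using mult_nonneg_nonneg[OF c(1)[of n] s0[of n]] mult_nonneg_nonneg[OF c(1)[of n] c(1)[of n]] by linarith
    finally have "(\<Prod>j<n. 1 - c j) * ((1 - c n) * (1 + ?s + c n)) \<le> (\<Prod>j<n. 1 - c j) * (1 + ?s)"
      by (rule mult_left_mono[OF _ nn])
    then show ?case using Suc by (simp add: algebra_simps)
  qed simp
  then have "l * (1 + (\<Sum>j<n. c j)) \<le> 1"
    using mult_right_mono[OF ge, of "1 + (\<Sum>j<n. c j)"] s0[of n] by (meson add_nonneg_nonneg order_trans zero_le_one)
  then show ?thesis using l by (simp add: field_simps)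
qed

locale V_data = lifted_fibres +
  fixes cm cp em ep :: real and N :: nat and a b :: "nat \<Rightarrow> real" and \<alpha> S :: real
    and \<kappa> K0 :: nat and M :: "nat \<Rightarrow> nat" and \<epsilon> :: "nat \<Rightarrow> real" and s0 :: real
  assumes cond_i: "Vcond_i G cm cp em ep N a b \<alpha> S"
    and cond_ii: "Vcond_ii N a b \<alpha> \<kappa> K0 M \<epsilon> s0"
    and cond_iii: "Vcond_iii \<omega> N (crit \<omega> G (cl_arc cm cp) (cl_arc em ep) (\<Union>i<N. op_arc (a i) (b i)) M)
        (Kseq K0 \<kappa>) M \<epsilon>"
begin

abbreviation "C \<equiv> cl_arc cm cp"
abbreviation "E \<equiv> cl_arc em ep"
abbreviation "Eo \<equiv> op_arc em ep"
definition J :: "nat \<Rightarrow> T1 set" where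
  "J = crit \<omega> G (cl_arc cm cp) (cl_arc em ep) (\<Union>i<N. op_arc (a i) (b i)) M"
abbreviation "K \<equiv> Kseq K0 \<kappa>"
abbreviation "f \<equiv> fmap \<omega> G"

lemma arcs: "cm < cp" "cp < cm + 1" "em < ep" "ep < em + 1" "C \<inter> E = {}" "Eo \<subseteq> E"
  using cond_i by (auto simp: Vcond_i_def cl_arc_def op_arc_def)

lemma C_not_E: "x \<in> C \<Longrightarrow> x \<notin> E"
  using arcs(5) by blast

lemma C_not_Eo: "x \<in> C \<Longrightarrow> x \<notin> Eo"
  using arcs(5,6) by blast

lemma in_interior_C: "x \<in> interior C \<Longrightarrow> x \<in> C"
  using interior_subset by blast

lemma E_not_interior_C: "x \<in> E \<Longrightarrow> x \<notin> interior C"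
  using in_interior_C C_not_E by blast

lemmas cond_iii_J = cond_iii[folded J_def]

lemma \<alpha>_gt: "\<alpha> > 4" and S_pos: "S > 0"
  using cond_i by (auto simp: Vcond_i_def)

lemma fib_in_C: "x \<notin> Eo \<Longrightarrow> \<theta> \<notin> J 0 \<Longrightarrow> fib G \<theta> x \<in> interior C"
  using cond_i by (simp add: Vcond_i_def J_def)

lemma fib_lip: "dist x x' / \<alpha>\<^sup>2 \<le> dist (fib G \<theta> x) (fib G \<theta> x')"
  "dist (fib G \<theta> x) (fib G \<theta> x') \<le> \<alpha>\<^sup>2 * dist x x'"
  using cond_i unfolding Vcond_i_def by blast+

lemma fib_lip_base: "dist (fib G \<theta> x) (fib G \<theta>' x) \<le> S * dist \<theta> \<theta>'"
  using cond_i unfolding Vcond_i_def by blast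

lemma dfib_C: "x \<in> C \<Longrightarrow> \<bar>dfib G \<theta> x\<bar> \<le> 1 / \<alpha>" and dfib_E: "x \<in> E \<Longrightarrow> \<alpha> \<le> \<bar>dfib G \<theta> x\<bar>"
  using cond_i unfolding Vcond_i_def by blast+

lemma fib_inj: "fib G \<theta> x = fib G \<theta> x' \<Longrightarrow> x = x'"
  using fib_lip(1)[of x x' \<theta>] \<alpha>_gt by (simp add: divide_le_0_iff)

text \<open>Indexed by the base point of the argument, so that \<open>(\<theta>, y)\<close> goes to
  \<open>(\<theta> - \<omega>, finv \<theta> y)\<close> under the inverse of \<open>f\<close>: it is
  a skew product over the rotation by \<open>- \<omega>\<close>.\<close>

definition finv :: "T1 \<Rightarrow> T1 \<Rightarrow> T1" where
  "finv \<theta> y = (THE x. fib G (rotT (- \<omega>) \<theta>) x = y)"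

lemma fib_finv: "fib G (rotT (- \<omega>) \<theta>) (finv \<theta> y) = y"
proof -
  obtain x where "fib G (rotT (- \<omega>) \<theta>) x = y" using surj_fib by blast
  then show ?thesis unfolding finv_def by (rule theI) (metis \<open>fib G (rotT (- \<omega>) \<theta>) x = y\<close> fib_inj)
qed

lemma finv_eq: "fib G (rotT (- \<omega>) \<theta>) x = y \<Longrightarrow> finv \<theta> y = x"
  by (rule fib_inj[of "rotT (- \<omega>) \<theta>"]) (simp add: fib_finv)

lemma finv_lip: "dist (finv \<theta> y) (finv \<theta> y') \<le> \<alpha>\<^sup>2 * dist y y'"
proof -
  have "dist (finv \<theta> y) (finv \<theta> y') / \<alpha>\<^sup>2 \<le> dist y y'"
    using fib_lip(1)[of "finv \<theta> y" "finv \<theta> y'" "rotT (- \<omega>) \<theta>"] by (simp only: fib_finv)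
  moreover have "0 < \<alpha>\<^sup>2" using \<alpha>_gt by simp
  ultimately show ?thesis by (simp only: pos_divide_le_eq mult.commute)
qed

lemma finv_lip_base: "dist (finv \<theta> y) (finv \<theta>' y) \<le> \<alpha>\<^sup>2 * S * dist \<theta> \<theta>'"
proof -
  define z where "z = finv \<theta>' y"
  have "dist (finv \<theta> y) z = dist (finv \<theta> y) (finv \<theta> (fib G (rotT (- \<omega>) \<theta>) z))"
    by (simp only: finv_eq[OF refl])
  also have "\<dots> \<le> \<alpha>\<^sup>2 * dist y (fib G (rotT (- \<omega>) \<theta>) z)" by (rule finv_lip)
  also have "\<dots> = \<alpha>\<^sup>2 * dist (fib G (rotT (- \<omega>) \<theta>') z) (fib G (rotT (- \<omega>) \<theta>) z)"
    by (simp add: z_def fib_finv)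
  also have "\<dots> \<le> \<alpha>\<^sup>2 * (S * dist (rotT (- \<omega>) \<theta>') (rotT (- \<omega>) \<theta>))"
    by (intro mult_left_mono fib_lip_base) auto
  finally show ?thesis by (simp add: z_def dist_commute mult.assoc)
qed

lemma K_ge1: "K n \<ge> 1"
  using cond_ii by (simp add: Vcond_ii_def Kseq_def)

lemma sum_K: "(\<Sum>j<n. 1 / real (K j)) \<le> 1 / 10"
proof -
  obtain l where l: "(\<lambda>n. \<Prod>j<n. 1 - 1 / real (K j)) \<longlonglongrightarrow> l" "l > sqrt (5/6)"
    using cond_ii unfolding Vcond_ii_def by blast
  \<comment> \<open>100/121 < 5/6. The reciprocal 11/10 leaves exactly 1/10 for the sum.\<close>
  have "sqrt (5/6) > 10/11" by (rule real_less_rsqrt) (simp add: power2_eq_square)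
  then have l': "l > 10/11" using l by simp
  have "1 + (\<Sum>j<n. 1 / real (K j)) \<le> 1 / l"
    using K_ge1 l l' by (intro partial_sums_le_of_prod) (auto simp: field_simps Suc_le_eq)
  also have "\<dots> \<le> 11/10" using l' by (simp add: field_simps)
  finally show ?thesis by simp
qed

lemma M_props: "strict_mono M" "2 \<le> M 0"
  using cond_ii by (auto simp: Vcond_ii_def superexp_def)

lemma M_ge2: "2 \<le> M n"
  using M_props strict_mono_leD[of M 0 n] by simp

lemma no_return: "\<theta> \<in> J n \<Longrightarrow> 1 \<le> k \<Longrightarrow> k \<le> 2 * K n * M n \<Longrightarrow> rotn \<omega> (int k) \<theta> \<notin> J n"
proof
  assume h: "\<theta> \<in> J n" "1 \<le> k" "k \<le> 2 * K n * M n" "rotn \<omega> (int k) \<theta> \<in> J n"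
  have "\<forall>n. J n \<inter> (\<Union>k\<in>{1..2 * K n * M n}. shiftT \<omega> (int k) (J n)) = {}"
    using cond_iii_J unfolding Vcond_iii_def by (elim conjE)
  then have "J n \<inter> (\<Union>k\<in>{1..2 * K n * M n}. shiftT \<omega> (int k) (J n)) = {}" by (rule spec)
  moreover have "rotn \<omega> (int k) \<theta> \<in> shiftT \<omega> (int k) (J n)" using h by (simp add: shiftT_iff)
  then have "rotn \<omega> (int k) \<theta> \<in> (\<Union>k\<in>{1..2 * K n * M n}. shiftT \<omega> (int k) (J n))"
    using h(2,3) by (intro UN_I[of k]) simp_all
  ultimately show False using h(4) by (simp only: disjoint_iff)
qed

text \<open>A visit to \<open>J j\<close> at that time would place
  \<open>rotn \<omega> c \<theta>\<close> in \<open>J j\<close> shifted by \<open>l\<close>, a part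
  of \<open>Wp\<close> for \<open>l >= 1\<close> and of \<open>Wm\<close> for \<open>l <= 0\<close>.
  One range of \<open>l\<close> thus serves both sides of a visit and both directions of
  time.\<close>

lemma clear_window:
  assumes "\<theta> \<in> J n" "j < n" "c \<in> {- (int (M n) - 1), int (M n) + 1}" "- (int (M j) - 1) \<le> l" "l \<le> int (M j) + 1"
  shows "rotn \<omega> (c - l) \<theta> \<notin> J j"
proof
  assume h: "rotn \<omega> (c - l) \<theta> \<in> J j"
  define z where "z = rotn \<omega> c \<theta>"
  have "(shiftT \<omega> (- (int (M n) - 1)) (J n) \<union> shiftT \<omega> (int (M n) + 1) (J n))
              \<inter> (Wp \<omega> J M (n - 1) \<union> Wm \<omega> J M (n - 1)) = {}"
    using cond_iii_J assms(2) unfolding Vcond_iii_def by simp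
  moreover have "z \<in> shiftT \<omega> (- (int (M n) - 1)) (J n) \<union> shiftT \<omega> (int (M n) + 1) (J n)"
    using assms by (auto simp: shiftT_iff z_def)
  moreover have "z \<in> Wp \<omega> J M (n - 1) \<union> Wm \<omega> J M (n - 1)"
  proof -
    have z: "z \<in> shiftT \<omega> l (J j)" using h by (simp add: shiftT_iff z_def algebra_simps)
    have j: "j \<le> n - 1" using assms by simp
    show ?thesis
    proof (cases "1 \<le> l")
      case True
      then have "z \<in> (\<Union>l\<in>{1..int (M j) + 1}. shiftT \<omega> l (J j))"
        using z assms(5) by (intro UN_I[of l]) simp_all
      then have "z \<in> Wp \<omega> J M (n - 1)" unfolding Wp_def using j by (intro UN_I[of j]) simp_all
      then show ?thesis by (rule UnI1)
    next
      case False
      then have "z \<in> (\<Union>l\<in>{- (int (M j) - 1)..0}. shiftT \<omega> l (J j))"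
        using z assms(4) by (intro UN_I[of l]) simp_all
      then have "z \<in> Wm \<omega> J M (n - 1)" unfolding Wm_def using j by (intro UN_I[of j]) simp_all
      then show ?thesis by (rule UnI2)
    qed
  qed
  ultimately show False by blast
qed

lemma J_open: "open (J n)"
  by (cases n) (auto intro: open_op_arc simp: J_def Let_def)

lemma J_emeasure: "emeasure LebT (J n) \<le> ennreal (real N * \<epsilon> n)"
proof -
  have "\<forall>n. finite (components (J n)) \<and> card (components (J n)) = N \<and>
         (\<forall>c\<in>components (J n). measure LebT c < \<epsilon> n)"
    using cond_iii_J unfolding Vcond_iii_def by (elim conjE)
  then have c: "finite (components (J n))" "card (components (J n)) = N"
    "\<And>c. c \<in> components (J n) \<Longrightarrow> measure LebT c < \<epsilon> n"
    by blast+
  have cs: "c \<in> sets LebT" if "c \<in> components (J n)" for c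
  proof -
    have "closedin (top_of_set (J n)) c" using that by (rule closedin_component)
    then obtain T where "closed T" "c = J n \<inter> T" by (auto simp: closedin_closed)
    then show ?thesis using J_open by (auto intro: borel_imp_LebT)
  qed
  have "emeasure LebT (J n) = emeasure LebT (\<Union>c\<in>components (J n). c)" by (simp add: Union_components)
  also have "\<dots> \<le> (\<Sum>c\<in>components (J n). emeasure LebT c)"
    using cs by (intro emeasure_subadditive_finite c(1)) auto
  also have "\<dots> \<le> (\<Sum>c\<in>components (J n). ennreal (\<epsilon> n))"
    unfolding LebT.emeasure_eq_measure by (intro sum_mono ennreal_leI less_imp_le c(3))
  also have "\<dots> = ennreal (real N * \<epsilon> n)"
    using c(2) cond_ii by (simp add: Vcond_ii_def ennreal_mult ennreal_of_nat_eq_real_of_nat less_imp_le)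
  finally show ?thesis .
qed

lemma J_sum: "(\<Sum>n. ennreal (real (2 * K n * M n + 1)) * emeasure LebT (J n)) < ennreal (1/16)"
proof -
  have \<epsilon>: "\<epsilon> n \<ge> 0" for n using cond_ii by (simp add: Vcond_ii_def less_imp_le)
  have "(\<Sum>n. ennreal (real (2 * K n * M n + 1)) * emeasure LebT (J n))
    \<le> (\<Sum>n. ennreal ((2 * real (K n) * real (M n) + 1) * real N * \<epsilon> n))"
  proof (intro suminf_le)
    fix n
    have "ennreal (real (2 * K n * M n + 1)) * emeasure LebT (J n) \<le> ennreal (real (2 * K n * M n + 1)) * ennreal (real N * \<epsilon> n)"
      by (intro mult_left_mono J_emeasure) auto
    also have "\<dots> = ennreal (real (2 * K n * M n + 1) * (real N * \<epsilon> n))"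
      using \<epsilon> by (intro ennreal_mult[symmetric]) auto
    also have "\<dots> = ennreal ((2 * real (K n) * real (M n) + 1) * real N * \<epsilon> n)"
      by (simp add: mult.assoc add.commute)
    finally show "ennreal (real (2 * K n * M n + 1)) * emeasure LebT (J n)
      \<le> ennreal ((2 * real (K n) * real (M n) + 1) * real N * \<epsilon> n)" .
  qed auto
  also have "\<dots> \<le> (\<Sum>n. ennreal (sqrt (\<epsilon> n)))" using cond_ii by (simp add: Vcond_ii_def)
  also have "\<dots> < ennreal (1/16)" using cond_ii by (simp add: Vcond_ii_def)
  finally show ?thesis .
qed

text \<open>A window of \<open>M j + 1\<close> consecutive times is shorter than the
  \<open>2 * K j * M j + 1\<close> times already summed. Its position \<open>u\<close> is free
  because attractor and repeller need different windows.\<close>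

lemma window_small:
  fixes u :: "nat \<Rightarrow> int"
  defines "Z \<equiv> \<Union>j. \<Union>l\<in>{u j..u j + int (M j)}. {\<theta>. rotn \<omega> l \<theta> \<in> J j}"
  shows "Z \<in> sets borel" "emeasure LebT Z < ennreal (1/16)"
proof -
  have b: "{\<theta>. rotn \<omega> l \<theta> \<in> J j} \<in> sets borel" for l j
    using measurable_rotn_preimage[of "J j" \<omega> l] J_open by (simp add: vimage_def)
  then have b': "(\<Union>l\<in>{u j..u j + int (M j)}. {\<theta>. rotn \<omega> l \<theta> \<in> J j}) \<in> sets borel" for j
    by (intro sets.countable_UN'') auto
  then show "Z \<in> sets borel" unfolding Z_def by (rule sets.countable_UN''[rotated]) auto
  have "emeasure LebT Z \<le> (\<Sum>j. emeasure LebT (\<Union>l\<in>{u j..u j + int (M j)}. {\<theta>. rotn \<omega> l \<theta> \<in> J j}))"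
    unfolding Z_def using borel_imp_LebT[OF b'] by (intro emeasure_subadditive_countably) auto
  also have "\<dots> \<le> (\<Sum>n. ennreal (real (2 * K n * M n + 1)) * emeasure LebT (J n))"
  proof (intro suminf_le)
    fix j
    have "emeasure LebT (\<Union>l\<in>{u j..u j + int (M j)}. {\<theta>. rotn \<omega> l \<theta> \<in> J j})
      \<le> (\<Sum>l\<in>{u j..u j + int (M j)}. emeasure LebT {\<theta>. rotn \<omega> l \<theta> \<in> J j})"
      using borel_imp_LebT[OF b] by (intro emeasure_subadditive_finite) auto
    also have "\<dots> = (\<Sum>l\<in>{u j..u j + int (M j)}. emeasure LebT (J j))"
      using emeasure_LebT_rotT(2)[OF borel_imp_LebT, of "J j"] J_open by (simp add: rotn_def vimage_def)
    also have "\<dots> = ennreal (real (M j + 1)) * emeasure LebT (J j)"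
      by (simp add: ennreal_of_nat_eq_real_of_nat nat_add_distrib add.commute)
    also have "\<dots> \<le> ennreal (real (2 * K j * M j + 1)) * emeasure LebT (J j)"
    proof (intro mult_right_mono ennreal_leI)
      have "M j \<le> 2 * K j * M j" using K_ge1[of j] by simp
      then show "real (M j + 1) \<le> real (2 * K j * M j + 1)" by linarith
    qed auto
    finally show "emeasure LebT (\<Union>l\<in>{u j..u j + int (M j)}. {\<theta>. rotn \<omega> l \<theta> \<in> J j})
      \<le> ennreal (real (2 * K j * M j + 1)) * emeasure LebT (J j)" .
  qed auto
  also have "\<dots> < ennreal (1/16)" by (rule J_sum)
  finally show "emeasure LebT Z < ennreal (1/16)" .
qed

section \<open>The inverse skew product and crossing a critical region\<close>

lemma fst_f_pow: "fst ((f ^^ n) p) = rotn \<omega> (int n) (fst p)"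
proof (induction n)
  case (Suc n)
  then show ?case by (simp add: fmap_def rotT_rotn add.commute)
qed simp

definition g :: "T1 \<times> T1 \<Rightarrow> T1 \<times> T1" where
  "g p = (rotT (- \<omega>) (fst p), finv (fst p) (snd p))"

lemma f_g: "f (g p) = p"
  by (simp add: fmap_def g_def fib_finv)

lemma fst_g_pow: "fst ((g ^^ n) p) = rotn \<omega> (- int n) (fst p)"
proof (induction n)
  case (Suc n)
  have "rotT (- \<omega>) (rotn \<omega> (- int n) (fst p)) = rotn \<omega> (- int (Suc n)) (fst p)"
    by (simp add: rotn_def algebra_simps)
  then show ?case using Suc by (simp add: g_def)
qed simp

lemma f_pow_g_pow: "(f ^^ n) ((g ^^ n) p) = p"
proof (induction n arbitrary: p)
  case (Suc n)
  have "(f ^^ Suc n) ((g ^^ Suc n) p) = (f ^^ n) (f (g ((g ^^ n) p)))"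
    by (simp only: funpow_Suc_right[of n f] funpow.simps(2)[of n g] comp_apply)
  then show ?case using Suc by (simp add: f_g)
qed simp

lemma continuous_skew:
  fixes h :: "T1 \<Rightarrow> T1 \<Rightarrow> T1"
  assumes h: "\<And>\<theta> x x'. dist (h \<theta> x) (h \<theta> x') \<le> A * dist x x'" "\<And>\<theta> \<theta>' x. dist (h \<theta> x) (h \<theta>' x) \<le> B * dist \<theta> \<theta>'"
    and AB: "A \<ge> 0" "B \<ge> 0"
  shows "continuous_on UNIV (\<lambda>p. (rotT c (fst p), h (fst p) (snd p)))"
proof (rule lipschitz_on_continuous_on[of "1 + (A + B)"], rule lipschitz_onI)
  fix p p' :: "T1 \<times> T1"
  have "dist (rotT c (fst p), h (fst p) (snd p)) (rotT c (fst p'), h (fst p') (snd p'))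
    \<le> dist (fst p) (fst p') + dist (h (fst p) (snd p)) (h (fst p') (snd p'))"
    unfolding dist_Pair_Pair dist_rotT by (rule sqrt_sum_squares_le_sum) auto
  also have "dist (h (fst p) (snd p)) (h (fst p') (snd p'))
    \<le> dist (h (fst p) (snd p)) (h (fst p) (snd p')) + dist (h (fst p) (snd p')) (h (fst p') (snd p'))"
    by (rule dist_triangle)
  also have "\<dots> \<le> A * dist (snd p) (snd p') + B * dist (fst p) (fst p')" by (intro add_mono h)
  also have "\<dots> \<le> A * dist p p' + B * dist p p'"
    using AB by (intro add_mono mult_left_mono dist_fst_le dist_snd_le)
  also have "dist (fst p) (fst p') \<le> dist p p'" by (rule dist_fst_le)
  finally show "dist (rotT c (fst p), h (fst p) (snd p)) (rotT c (fst p'), h (fst p') (snd p'))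
    \<le> (1 + (A + B)) * dist p p'" by (simp add: algebra_simps)
qed (use AB in auto)

lemma continuous_f: "continuous_on UNIV f"
  unfolding fmap_def using \<alpha>_gt S_pos
  by (intro continuous_skew[where A="\<alpha>\<^sup>2" and B=S] fib_lip fib_lip_base) auto

lemma continuous_g: "continuous_on UNIV g"
  unfolding g_def using \<alpha>_gt S_pos
  by (intro continuous_skew[where A="\<alpha>\<^sup>2" and B="\<alpha>\<^sup>2 * S"] finv_lip finv_lip_base) auto

lemma continuous_funpow:
  fixes h :: "'a::topological_space \<Rightarrow> 'a"
  assumes "continuous_on UNIV h" shows "continuous_on UNIV (h ^^ n)"
proof (induction n)
  case (Suc n)
  then show ?case using continuous_on_compose2[OF assms Suc] by (simp add: o_def)
qed (simp add: id_def)

lemma open_section: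
  fixes h :: "T1 \<times> T1 \<Rightarrow> T1 \<times> T1"
  assumes h: "continuous_on UNIV h" and V: "open V"
  shows "open {\<theta>. snd ((h ^^ n) (rotn \<omega> k \<theta>, x)) \<in> V}"
proof -
  have "continuous_on UNIV (\<lambda>\<theta>. snd ((h ^^ n) (rotn \<omega> k \<theta>, x)))"
    unfolding rotn_def
    by (intro continuous_intros continuous_on_compose2[OF continuous_funpow[OF h]]) auto
  then show ?thesis using V by (simp add: continuous_on_open_vimage vimage_def)
qed

text \<open>The recursion defining the critical sets keeps only interior points; the two separating
  properties below survive because the orbit condition is open once one of the two arcs is.\<close>

lemma subset_crit_Suc:
  assumes U: "open U" "U \<subseteq> J n"
    and orb: "\<And>\<theta>. \<theta> \<in> U \<Longrightarrow> \<exists>x\<in>C. snd ((f ^^ (2 * M n)) (rotn \<omega> (- (int (M n) - 1)) \<theta>, x)) \<in> E"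
  shows "U \<subseteq> J (Suc n)"
proof -
  have "U \<subseteq> fst ` (((f ^^ (M n - 1)) ` (shiftT \<omega> (- (int (M n) - 1)) (J n) \<times> C)) \<inter>
    ((f ^^ (M n + 1)) -` (shiftT \<omega> (int (M n) + 1) (J n) \<times> E)))" (is "U \<subseteq> fst ` ?T")
  proof
    fix \<theta> assume \<theta>: "\<theta> \<in> U"
    then obtain x where x: "x \<in> C" "snd ((f ^^ (2 * M n)) (rotn \<omega> (- (int (M n) - 1)) \<theta>, x)) \<in> E"
      using orb by blast
    define p where "p = (rotn \<omega> (- (int (M n) - 1)) \<theta>, x)"
    define r where "r = (f ^^ (M n - 1)) p"
    have M1: "int (M n - 1) = int (M n) - 1" using M_ge2[of n] by (simp add: of_nat_diff)
    have fr: "fst r = \<theta>" unfolding r_def fst_f_pow M1 p_def by simp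
    have "p \<in> shiftT \<omega> (- (int (M n) - 1)) (J n) \<times> C"
      using \<theta> U x by (auto simp: p_def shiftT_iff)
    moreover have "(f ^^ (M n + 1)) r = (f ^^ (2 * M n)) p"
    proof -
      have "(f ^^ (M n + 1)) r = (f ^^ (M n + 1 + (M n - 1))) p" by (simp only: r_def funpow_add comp_apply)
      moreover have "M n + 1 + (M n - 1) = 2 * M n" using M_ge2[of n] by simp
      ultimately show ?thesis by (simp only:)
    qed
    moreover have "fst ((f ^^ (M n + 1)) r) \<in> shiftT \<omega> (int (M n) + 1) (J n)"
      unfolding fst_f_pow fr using \<theta> U by (auto simp: shiftT_iff)
    ultimately have "r \<in> ?T" using x(2) by (auto simp: r_def p_def mem_Times_iff)
    then show "\<theta> \<in> fst ` ?T" using fr by force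
  qed
  then have "U \<subseteq> interior (fst ` ?T)" using U(1) by (rule interior_maximal)
  then show ?thesis by (simp add: J_def Let_def)
qed

lemma cross_C:
  assumes \<theta>: "\<theta> \<in> J n" "\<theta> \<notin> J (Suc n)"
    and u: "\<And>t. u (Suc t) = fib G (rotn \<omega> (int t - int (M n - 1)) \<theta>) (u t)" "u 0 \<in> C"
  shows "u (M n - 1 + (M n + 1)) \<notin> Eo"
proof
  assume uE: "u (M n - 1 + (M n + 1)) \<in> Eo"
  define c where "c = - (int (M n) - 1)"
  have c: "int t - int (M n - 1) = int t + c" for t using M_ge2[of n] by (simp add: of_nat_diff c_def)
  have M2: "M n - 1 + (M n + 1) = 2 * M n" using M_ge2[of n] by simp
  have orb: "(f ^^ t) (rotn \<omega> c \<theta>, u 0) = (rotn \<omega> (int t + c) \<theta>, u t)" for t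
    by (induction t) (simp_all add: fmap_def u(1)[unfolded c] rotT_rotn algebra_simps)
  \<comment> \<open>The fibre point \<open>u 0\<close> is kept and only the base point
    varies.\<close>
  define U where "U = J n \<inter> {\<theta>. snd ((f ^^ (2 * M n)) (rotn \<omega> c \<theta>, u 0)) \<in> Eo}"
  have "U \<subseteq> J (Suc n)"
  proof (rule subset_crit_Suc)
    show "open U" unfolding U_def by (intro open_Int J_open open_section continuous_f open_op_arc)
  qed (use u(2) arcs(6) in \<open>auto simp: U_def c_def\<close>)
  moreover have "\<theta> \<in> U" using \<theta>(1) uE unfolding U_def M2 by (simp add: orb)
  ultimately show False using \<theta>(2) by blast
qed

text \<open>The backward version: the closed arc \<open>E\<close> is now the start and the interior
  of \<open>C\<close> the open target. Running \<open>f\<close> forward again from the end point,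
  which lies in \<open>C\<close>, returns to the starting point in \<open>E\<close>.\<close>

lemma cross_E:
  assumes \<theta>: "\<theta> \<in> J n" "\<theta> \<notin> J (Suc n)"
    and u: "\<And>t. u (Suc t) = finv (rotn \<omega> (int (M n) + 1 - int t) \<theta>) (u t)" "u 0 \<in> E"
  shows "u (2 * M n) \<notin> interior C"
proof
  assume uC: "u (2 * M n) \<in> interior C"
  define c where "c = int (M n) + 1"
  have orb: "(g ^^ t) (rotn \<omega> c \<theta>, u 0) = (rotn \<omega> (c - int t) \<theta>, u t)" for t
    by (induction t) (simp_all add: g_def u(1)[folded c_def] rotn_def algebra_simps)
  define U where "U = J n \<inter> {\<theta>. snd ((g ^^ (2 * M n)) (rotn \<omega> c \<theta>, u 0)) \<in> interior C}"
  have "U \<subseteq> J (Suc n)"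
  proof (rule subset_crit_Suc)
    show "open U" unfolding U_def by (intro open_Int J_open open_section continuous_g open_interior)
    fix \<theta> assume \<theta>: "\<theta> \<in> U"
    define r where "r = (g ^^ (2 * M n)) (rotn \<omega> c \<theta>, u 0)"
    have "fst r = rotn \<omega> (- (int (M n) - 1)) \<theta>" unfolding r_def fst_g_pow by (simp add: c_def)
    then have "r = (rotn \<omega> (- (int (M n) - 1)) \<theta>, snd r)" by (simp add: prod_eq_iff)
    moreover have "snd r \<in> C" using \<theta> interior_subset by (auto simp: U_def r_def)
    moreover have "snd ((f ^^ (2 * M n)) r) \<in> E" using u(2) by (simp add: r_def f_pow_g_pow)
    ultimately show "\<exists>x\<in>C. snd ((f ^^ (2 * M n)) (rotn \<omega> (- (int (M n) - 1)) \<theta>, x)) \<in> E" by metis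
  qed (auto simp: U_def)
  moreover have "\<theta> \<in> U" using \<theta>(1) uC unfolding U_def by (simp add: orb)
  ultimately show False using \<theta>(2) by blast
qed

section \<open>Contraction of lifts inside the two strips\<close>

lemma cl_arc_lift:
  assumes "abs_T1 y \<in> cl_arc u v" obtains k :: int where "y \<in> {u + of_int k..v + of_int k}"
proof -
  obtain z where z: "z \<in> {u..v}" "abs_T1 y = abs_T1 z" using assms by (auto simp: cl_arc_def)
  from z(2) obtain k where "y = z + of_int k" by (rule abs_T1_eqE)
  then show thesis using z by (intro that[of k]) auto
qed

text \<open>Over a non-critical fibre \<open>C\<close> is mapped into itself and so avoids a point
  of \<open>E\<close>; the lifted image of [s, s'] therefore stays in one translate of [cm, cp], and
  the mean value theorem gives the contraction of lifts.\<close>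

lemma strip_C_ordered:
  assumes \<theta>: "\<theta> \<notin> J 0" and s: "s \<in> {cm..cp}" "s' \<in> {cm..cp}" "s \<le> s'"
  shows "\<exists>r\<in>{cm..cp}. \<exists>r'\<in>{cm..cp}. fib G \<theta> (abs_T1 s) = abs_T1 r \<and> fib G \<theta> (abs_T1 s') = abs_T1 r' \<and> \<bar>r - r'\<bar> \<le> \<bar>s - s'\<bar> / \<alpha>"
proof -
  obtain t where t: "\<theta> = abs_T1 t" by (rule T1_cases)
  have inC: "abs_T1 (G t z) \<in> C" if "z \<in> {cm..cp}" for z
  proof -
    have "abs_T1 z \<in> C" using that by (auto simp: cl_arc_def)
    from in_interior_C[OF fib_in_C[OF C_not_Eo[OF this] \<theta>]] have "fib G \<theta> (abs_T1 z) \<in> C" .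
    then show ?thesis by (simp add: t fib_abs)
  qed
  have "abs_T1 em \<in> E" using arcs(3) by (auto simp: cl_arc_def)
  then have em: "abs_T1 em \<notin> C" using arcs(5) by blast
  obtain k where k: "G t s \<in> {cm + of_int k..cp + of_int k}" using inC[OF s(1)] by (rule cl_arc_lift)
  obtain k' where k': "G t s' \<in> {cm + of_int k'..cp + of_int k'}" using inC[OF s(2)] by (rule cl_arc_lift)
  have "k = k'"
  proof (rule same_copy[OF G_continuous s(3) _ em k k'])
    fix z assume "z \<in> {s..s'}"
    then have "z \<in> {cm..cp}" using s by auto
    then show "abs_T1 (G t z) \<noteq> abs_T1 em" using inC em by metis
  qed
  obtain z where z: "z \<in> {s..s'}" "G t s' - G t s = (s' - s) * deriv (G t) z"
    using G_diff_mvt[OF s(3)] by blast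
  have "\<bar>deriv (G t) z\<bar> \<le> 1 / \<alpha>"
    using dfib_C[of "abs_T1 z" \<theta>] z s by (auto simp: t dfib_abs cl_arc_def)
  then have "\<bar>s' - s\<bar> * \<bar>deriv (G t) z\<bar> \<le> \<bar>s' - s\<bar> * (1 / \<alpha>)" by (rule mult_left_mono) simp
  then have "\<bar>G t s' - G t s\<bar> \<le> \<bar>s' - s\<bar> / \<alpha>" by (simp add: z(2) abs_mult)
  then have le: "\<bar>(G t s - of_int k) - (G t s' - of_int k)\<bar> \<le> \<bar>s - s'\<bar> / \<alpha>"
    using abs_minus_commute[of s s'] abs_minus_commute[of "G t s" "G t s'"] by simp
  have "fib G \<theta> (abs_T1 s) = abs_T1 (G t s - of_int k)" "fib G \<theta> (abs_T1 s') = abs_T1 (G t s' - of_int k)"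
    using abs_T1_add_int[of "_ - of_int k" k] by (simp_all add: t fib_abs)
  then show ?thesis using k k' \<open>k = k'\<close> le
    by (intro bexI[of _ "G t s - of_int k"] bexI[of _ "G t s' - of_int k"] conjI) simp_all
qed

lemma strip_C:
  assumes "\<theta> \<notin> J 0" "s \<in> {cm..cp}" "s' \<in> {cm..cp}"
  shows "\<exists>r\<in>{cm..cp}. \<exists>r'\<in>{cm..cp}. fib G \<theta> (abs_T1 s) = abs_T1 r \<and> fib G \<theta> (abs_T1 s') = abs_T1 r' \<and> \<bar>r - r'\<bar> \<le> \<bar>s - s'\<bar> / \<alpha>"
proof (cases "s \<le> s'")
  case True then show ?thesis by (rule strip_C_ordered[OF assms])
next
  case False
  then have "s' \<le> s" by simp
  from strip_C_ordered[OF assms(1,3,2) this] show ?thesis by (metis abs_minus_commute)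
qed

text \<open>On the repelling side the image of \<open>E\<close> covers almost the whole circle, so a point of \<open>C\<close>
  with preimage in \<open>C\<close> is needed to see that two returns to \<open>E\<close> lie in the same copy of \<open>E\<close>.\<close>

lemma strip_E_ordered:
  assumes t: "abs_T1 t \<notin> J 0" and r: "r \<in> {em..ep}" "r' \<in> {em..ep}" "r \<le> r'"
    and s: "s \<in> {em..ep}" "s' \<in> {em..ep}" "abs_T1 (G t r) = abs_T1 s" "abs_T1 (G t r') = abs_T1 s'"
  shows "\<bar>r - r'\<bar> \<le> \<bar>s - s'\<bar> / \<alpha>"
proof -
  define c where "c = fib G (abs_T1 t) (abs_T1 cm)"
  have "abs_T1 cm \<in> C" using arcs(1) by (auto simp: cl_arc_def)
  then have cm: "abs_T1 cm \<in> C" "abs_T1 cm \<notin> E" by (simp_all add: C_not_E)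
  have "c \<in> C" unfolding c_def by (rule in_interior_C[OF fib_in_C[OF C_not_Eo[OF cm(1)] t]])
  then have cE: "c \<notin> E" by (rule C_not_E)
  obtain k where k: "G t r = s + of_int k" using s(3) by (rule abs_T1_eqE)
  obtain k' where k': "G t r' = s' + of_int k'" using s(4) by (rule abs_T1_eqE)
  have "k = k'"
  proof (rule same_copy[OF G_continuous r(3) _ cE])
    show "G t r \<in> {em + of_int k..ep + of_int k}" "G t r' \<in> {em + of_int k'..ep + of_int k'}"
      using s(1,2) by (simp_all add: k k')
    fix z assume z: "z \<in> {r..r'}"
    show "abs_T1 (G t z) \<noteq> c"
    proof
      assume "abs_T1 (G t z) = c"
      then have "fib G (abs_T1 t) (abs_T1 z) = fib G (abs_T1 t) (abs_T1 cm)" by (simp only: fib_abs c_def)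
      then have "abs_T1 z = abs_T1 cm" by (rule fib_inj)
      moreover have "abs_T1 z \<in> E"
        unfolding cl_arc_def using z r(1,2) by (intro imageI) simp
      ultimately show False using cm(2) by (simp only:)
    qed
  qed
  obtain z where z: "z \<in> {r..r'}" "G t r' - G t r = (r' - r) * deriv (G t) z"
    using G_diff_mvt[OF r(3)] by blast
  have "abs_T1 z \<in> E"
    unfolding cl_arc_def using z(1) r(1,2) by (intro imageI) simp
  from dfib_E[OF this, of "abs_T1 t"] have "\<alpha> \<le> \<bar>deriv (G t) z\<bar>" by (simp only: dfib_abs)
  then have "\<bar>r' - r\<bar> * \<alpha> \<le> \<bar>r' - r\<bar> * \<bar>deriv (G t) z\<bar>" by (rule mult_left_mono) simp
  also have "\<dots> = \<bar>G t r' - G t r\<bar>" by (simp only: z(2) abs_mult)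
  also have "\<dots> = \<bar>s' - s\<bar>" by (simp add: k k' \<open>k = k'\<close>)
  finally have "\<bar>r' - r\<bar> \<le> \<bar>s' - s\<bar> / \<alpha>" using \<alpha>_gt by (simp only: pos_le_divide_eq)
  then show ?thesis by (simp only: abs_minus_commute)
qed

text \<open>The contrapositive of \<open>fib_in_C\<close> at the preimage.\<close>

lemma finv_in_Eo: "y \<notin> interior C \<Longrightarrow> rotT (- \<omega>) \<theta> \<notin> J 0 \<Longrightarrow> finv \<theta> y \<in> Eo"
  using fib_in_C[of "finv \<theta> y" "rotT (- \<omega>) \<theta>"] fib_finv[of \<theta> y] by fastforce

lemma strip_E:
  assumes \<theta>: "rotT (- \<omega>) \<theta> \<notin> J 0" and s: "s \<in> {em..ep}" "s' \<in> {em..ep}"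
  shows "\<exists>r\<in>{em..ep}. \<exists>r'\<in>{em..ep}. finv \<theta> (abs_T1 s) = abs_T1 r \<and> finv \<theta> (abs_T1 s') = abs_T1 r' \<and> \<bar>r - r'\<bar> \<le> \<bar>s - s'\<bar> / \<alpha>"
proof -
  obtain t where t: "rotT (- \<omega>) \<theta> = abs_T1 t" by (rule T1_cases)
  have ex: "\<exists>r\<in>{em..ep}. finv \<theta> (abs_T1 s) = abs_T1 r \<and> abs_T1 (G t r) = abs_T1 s" if "s \<in> {em..ep}" for s
  proof -
    have "abs_T1 s \<in> E" using that by (auto simp: cl_arc_def)
    then have "finv \<theta> (abs_T1 s) \<in> Eo" using \<theta> by (intro finv_in_Eo E_not_interior_C)
    then have "finv \<theta> (abs_T1 s) \<in> E" using arcs(6) by blast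
    then obtain r where r: "r \<in> {em..ep}" "finv \<theta> (abs_T1 s) = abs_T1 r" by (auto simp: cl_arc_def)
    then have "abs_T1 (G t r) = abs_T1 s" using fib_finv[of \<theta> "abs_T1 s"] by (simp add: t fib_abs)
    then show ?thesis using r by blast
  qed
  obtain r where r: "r \<in> {em..ep}" "finv \<theta> (abs_T1 s) = abs_T1 r" "abs_T1 (G t r) = abs_T1 s" using ex[OF s(1)] by blast
  obtain r' where r': "r' \<in> {em..ep}" "finv \<theta> (abs_T1 s') = abs_T1 r'" "abs_T1 (G t r') = abs_T1 s'" using ex[OF s(2)] by blast
  have "\<bar>r - r'\<bar> \<le> \<bar>s - s'\<bar> / \<alpha>"
  proof (cases "r \<le> r'")
    case True
    then show ?thesis using \<theta> r r' s by (intro strip_E_ordered[of t]) (simp_all add: t)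
  next
    case False
    then have "\<bar>r' - r\<bar> \<le> \<bar>s' - s\<bar> / \<alpha>"
      using \<theta> r r' s by (intro strip_E_ordered[of t]) (simp_all add: t)
    then show ?thesis by (simp add: abs_minus_commute)
  qed
  then show ?thesis using r r' by blast
qed

section \<open>The two instances of the abstract contraction\<close>

definition "\<delta>C = min (1/4) (1 - (cp - cm)) / (2 * (S + 1))"
definition "\<delta>E = min (1/4) (1 - (ep - em)) / (2 * (\<alpha>\<^sup>2 * S + 1))"

lemma \<delta>_pos: "\<delta>C > 0" "\<delta>E > 0"
proof -
  have "min (1/4) (1 - (cp - cm)) > 0" "min (1/4) (1 - (ep - em)) > 0" using arcs by auto
  moreover have "2 * (S + 1) > 0" "2 * (\<alpha>\<^sup>2 * S + 1) > 0"
    using S_pos by (auto intro!: add_nonneg_pos)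
  ultimately show "\<delta>C > 0" "\<delta>E > 0" unfolding \<delta>C_def \<delta>E_def by (auto intro: divide_pos_pos)
qed

lemma skew_contraction_C:
  "skew_contraction \<omega> (fib G) C Eo J (\<lambda>n. M n - 1) (\<lambda>n. M n + 1) M K \<alpha> S \<delta>C"
proof
  show "x \<notin> Eo \<Longrightarrow> \<theta> \<notin> J 0 \<Longrightarrow> fib G \<theta> x \<in> C" for x \<theta> by (rule in_interior_C, rule fib_in_C)
  show "C \<inter> Eo = {}" using C_not_Eo by blast
  show "\<And>\<theta> n u. \<theta> \<in> J n \<Longrightarrow> \<theta> \<notin> J (Suc n) \<Longrightarrow>
      (\<And>t. u (Suc t) = fib G (rotn \<omega> (int t - int (M n - 1)) \<theta>) (u t)) \<Longrightarrow> u 0 \<in> C \<Longrightarrow> u (M n - 1 + (M n + 1)) \<notin> Eo"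
    by (rule cross_C)
  show "rotn \<omega> (int k) \<theta> \<notin> J n" if "\<theta> \<in> J n" "1 \<le> k" "k \<le> 2 * K n * M n" for \<theta> n k
    using that by (rule no_return)
  fix \<theta> n j l and i :: nat
  assume h: "\<theta> \<in> J n" "j < n" "l \<in> {- int (M n - 1), int (M n + 1)}"
  have l: "l \<in> {- (int (M n) - 1), int (M n) + 1}" using h(3) M_ge2[of n] by (auto simp: of_nat_diff)
  show "rotn \<omega> (l - int i) \<theta> \<notin> J j" if "1 \<le> i" "i \<le> M j + 1"
    using that by (intro clear_window[OF h(1,2) l]) auto
  show "rotn \<omega> (l + int i) \<theta> \<notin> J j" if "i \<le> M j - 1"
    using clear_window[OF h(1,2) l, of "- int i"] that M_ge2[of j] by simp
next
  show "M n - 1 + (M n + 1) = 2 * M n" for n using M_ge2[of n] by simp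
  show "dist (fib G (rotT \<omega> \<theta>) (fib G \<theta> x)) (fib G (rotT \<omega> \<theta>') (fib G \<theta>' x'))
        \<le> dist (fib G \<theta> x) (fib G \<theta>' x') / \<alpha> + S * dist \<theta> \<theta>'"
    if "dist \<theta> \<theta>' \<le> \<delta>C" "x \<in> C" "x' \<in> C" "\<theta> \<notin> J 0" "\<theta>' \<notin> J 0" "rotT \<omega> \<theta> \<notin> J 0" "rotT \<omega> \<theta>' \<notin> J 0"
    for \<theta> \<theta>' x x'
  proof (rule two_step_contraction[OF arcs(2) \<alpha>_gt strip_C fib_lip_base])
    show "dist \<theta> \<theta>' \<le> min (1/4) (1 - (cp - cm)) / (2 * (S + 1))" using that(1) by (simp only: \<delta>C_def)
  qed (use that S_pos in auto)
  show "1 < \<alpha>" "0 \<le> S" using \<alpha>_gt S_pos by simp_all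
qed (rule M_props K_ge1 sum_K \<delta>_pos fib_lip fib_lip_base | simp)+

text \<open>Under \<open>f\<close> a visit runs from \<open>M n - 1\<close> steps before to
  \<open>M n + 1\<close> steps after \<open>J n\<close>. Seen backwards and centred one step later,
  at \<open>J n\<close> shifted by \<open>\<omega>\<close>, this window is symmetric, with
  \<open>M n\<close> steps on either side.\<close>

lemma skew_contraction_E:
  "skew_contraction (- \<omega>) finv E (interior C) (\<lambda>n. rotT \<omega> ` J n) M M M K \<alpha> (\<alpha>\<^sup>2 * S) \<delta>E"
proof
  have iff: "z \<in> rotT \<omega> ` J n \<longleftrightarrow> rotn \<omega> (- 1) z \<in> J n" for z n
    by (simp add: rotT_image_iff rotn_def)
  have rot1: "rotT (- \<omega>) z = rotn \<omega> (- 1) z" for z by (simp add: rotn_def)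
  show "finv \<theta> x \<in> E" if "x \<notin> interior C" "\<theta> \<notin> rotT \<omega> ` J 0" for x \<theta>
    using finv_in_Eo[of x \<theta>] that arcs(6) unfolding iff rot1 by blast
  show "E \<inter> interior C = {}" using E_not_interior_C by blast
  show "u (M n + M n) \<notin> interior C"
    if "\<theta> \<in> rotT \<omega> ` J n" "\<theta> \<notin> rotT \<omega> ` J (Suc n)"
      "\<And>t. u (Suc t) = finv (rotn (- \<omega>) (int t - int (M n)) \<theta>) (u t)" "u 0 \<in> E" for \<theta> n u
  proof -
    have "u (2 * M n) \<notin> interior C"
    proof (rule cross_E)
      show "rotn \<omega> (- 1) \<theta> \<in> J n" "rotn \<omega> (- 1) \<theta> \<notin> J (Suc n)" using that(1,2) by (simp_all only: iff not_False_eq_True)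
      show "u (Suc t) = finv (rotn \<omega> (int (M n) + 1 - int t) (rotn \<omega> (- 1) \<theta>)) (u t)" for t
        using that(3)[of t] by (simp add: rotn_minus algebra_simps)
    qed (rule that)
    then show ?thesis unfolding mult_2 .
  qed
  show "rotn (- \<omega>) (int k) \<theta> \<notin> rotT \<omega> ` J n" if "\<theta> \<in> rotT \<omega> ` J n" "1 \<le> k" "k \<le> 2 * K n * M n" for \<theta> n k
  proof
    assume "rotn (- \<omega>) (int k) \<theta> \<in> rotT \<omega> ` J n"
    then have "rotn \<omega> (- 1) (rotn \<omega> (- int k) \<theta>) \<in> J n" unfolding iff rotn_minus .
    from no_return[OF this that(2,3)] that(1) show False unfolding iff by simp
  qed
  fix \<theta> n j l and i :: nat
  assume h: "\<theta> \<in> rotT \<omega> ` J n" "j < n" "l \<in> {- int (M n), int (M n)}"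
  have h1: "rotn \<omega> (- 1) \<theta> \<in> J n" using h(1) by (simp only: iff)
  \<comment> \<open>Reversed time \<open>l\<close> from \<open>\<theta>\<close> is forward time
    \<open>1 - l\<close> from the corresponding point of \<open>J n\<close>, so the two ends of the
    window are exchanged.\<close>
  have l: "1 - l \<in> {- (int (M n) - 1), int (M n) + 1}" using h(3) by auto
  show "rotn (- \<omega>) (l - int i) \<theta> \<notin> rotT \<omega> ` J j" if "1 \<le> i" "i \<le> M j"
    using clear_window[OF h1 h(2) l, of "1 - int i"] that unfolding iff rotn_minus by (simp add: algebra_simps)
  show "rotn (- \<omega>) (l + int i) \<theta> \<notin> rotT \<omega> ` J j" if "i \<le> M j"
    using clear_window[OF h1 h(2) l, of "1 + int i"] that unfolding iff rotn_minus by (simp add: algebra_simps)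
next
  have iff: "z \<in> rotT \<omega> ` J n \<longleftrightarrow> rotT (- \<omega>) z \<in> J n" for z n by (rule rotT_image_iff)
  show "M n + M n = 2 * M n" "1 \<le> M n" for n using M_ge2[of n] by auto
  show "dist (finv (rotT (- \<omega>) \<theta>) (finv \<theta> x)) (finv (rotT (- \<omega>) \<theta>') (finv \<theta>' x'))
        \<le> dist (finv \<theta> x) (finv \<theta>' x') / \<alpha> + \<alpha>\<^sup>2 * S * dist \<theta> \<theta>'"
    if "dist \<theta> \<theta>' \<le> \<delta>E" "x \<in> E" "x' \<in> E" "\<theta> \<notin> rotT \<omega> ` J 0" "\<theta>' \<notin> rotT \<omega> ` J 0"
      "rotT (- \<omega>) \<theta> \<notin> rotT \<omega> ` J 0" "rotT (- \<omega>) \<theta>' \<notin> rotT \<omega> ` J 0"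
    for \<theta> \<theta>' x x'
  proof (rule two_step_contraction[OF arcs(4) \<alpha>_gt, where J="rotT \<omega> ` J 0"])
    show "\<exists>r\<in>{em..ep}. \<exists>r'\<in>{em..ep}. finv \<theta> (abs_T1 s) = abs_T1 r \<and> finv \<theta> (abs_T1 s') = abs_T1 r' \<and> \<bar>r - r'\<bar> \<le> \<bar>s - s'\<bar> / \<alpha>"
      if "\<theta> \<notin> rotT \<omega> ` J 0" "s \<in> {em..ep}" "s' \<in> {em..ep}" for \<theta> s s'
      using that unfolding iff by (intro strip_E)
    show "dist \<theta> \<theta>' \<le> min (1/4) (1 - (ep - em)) / (2 * (\<alpha>\<^sup>2 * S + 1))" using that(1) by (simp only: \<delta>E_def)
  qed (use that S_pos in \<open>auto intro: finv_lip_base\<close>)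
  show "1 < \<alpha>" "0 \<le> \<alpha>\<^sup>2 * S" using \<alpha>_gt S_pos by simp_all
qed (rule M_props K_ge1 sum_K \<delta>_pos finv_lip finv_lip_base | simp)+

section \<open>The sign of the Lyapunov exponent forces visits to the strip\<close>

lemma dfib_pos: "0 < \<bar>dfib G \<theta> x\<bar>"
  and ln_dfib_bounds: "- 2 * ln \<alpha> \<le> ln \<bar>dfib G \<theta> x\<bar>" "ln \<bar>dfib G \<theta> x\<bar> \<le> 2 * ln \<alpha>"
proof -
  have \<alpha>0: "0 < \<alpha>" using \<alpha>_gt by simp
  note b = dfib_bounds[of \<alpha> \<theta> x, OF \<alpha>0 conjI[OF fib_lip]]
  have "0 < 1 / \<alpha>\<^sup>2" using \<alpha>0 by simp
  then show pos: "0 < \<bar>dfib G \<theta> x\<bar>" using b(1) by (rule less_le_trans)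
  have "ln (1 / \<alpha>\<^sup>2) \<le> ln \<bar>dfib G \<theta> x\<bar>" using b(1) \<open>0 < 1 / \<alpha>\<^sup>2\<close> by (intro ln_mono)
  then show "- 2 * ln \<alpha> \<le> ln \<bar>dfib G \<theta> x\<bar>" using \<alpha>0 by (simp add: ln_div ln_realpow)
  have "ln \<bar>dfib G \<theta> x\<bar> \<le> ln (\<alpha>\<^sup>2)" using b(2) pos by (intro ln_mono)
  then show "ln \<bar>dfib G \<theta> x\<bar> \<le> 2 * ln \<alpha>" using \<alpha>0 by (simp add: ln_realpow)
qed

text \<open>If the graph avoided \<open>C\<close> over all admissible points, then off a set of
  measure below 1/16 its image would miss \<open>C\<close>, so the graph would lie in
  \<open>E\<close> one step earlier. There the logarithm of the derivative is at least
  \<open>ln \<alpha>\<close>, which makes the exponent positive.\<close>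

lemma visits_C:
  assumes inv: "AE \<theta> in LebT. fib G \<theta> (\<phi> \<theta>) = \<phi> (rotT \<omega> \<theta>)" and ly: "lyap G \<phi> < 0"
  shows "\<not> (AE \<theta> in LebT. \<not> skew_contraction.before_hit \<omega> J (\<lambda>n. M n - 1) \<theta> \<longrightarrow> \<phi> \<theta> \<notin> C)"
proof
  assume out: "AE \<theta> in LebT. \<not> skew_contraction.before_hit \<omega> J (\<lambda>n. M n - 1) \<theta> \<longrightarrow> \<phi> \<theta> \<notin> C"
  \<comment> \<open>The times from 0 on exclude \<open>before_hit\<close> at the image point; the
    time -1 keeps the previous base point out of \<open>J 0\<close>.\<close>
  define Z where "Z = (\<Union>j. \<Union>l\<in>{-1..-1 + int (M j)}. {\<theta>. rotn \<omega> l \<theta> \<in> J j})"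
  note Z = window_small[of "\<lambda>_. -1", folded Z_def]
  have 1: "AE \<theta> in LebT. rotT \<omega> \<theta> \<notin> Z \<longrightarrow> \<phi> \<theta> \<in> E"
    using AE_LebT_rotT[OF out, of \<omega>] inv
  proof eventually_elim
    case (elim \<theta>)
    show ?case
    proof
      assume z: "rotT \<omega> \<theta> \<notin> Z"
      then have nz: "rotn \<omega> l (rotT \<omega> \<theta>) \<notin> J j" if "l \<in> {-1..-1 + int (M j)}" for l j
        using that unfolding Z_def by blast
      have "\<not> skew_contraction.before_hit \<omega> J (\<lambda>n. M n - 1) (rotT \<omega> \<theta>)"
        unfolding skew_contraction.before_hit_def[OF skew_contraction_C] using nz by auto
      then have "\<phi> (rotT \<omega> \<theta>) \<notin> C" using elim(1) by blast
      then have "fib G \<theta> (\<phi> \<theta>) \<notin> interior C" unfolding elim(2) using in_interior_C by blast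
      moreover have "\<theta> \<notin> J 0" using nz[of "-1" 0] by (simp add: rotn_def)
      ultimately show "\<phi> \<theta> \<in> E" using fib_in_C arcs(6) by blast
    qed
  qed
  have rZ: "rotT \<omega> -` Z \<in> sets LebT" "emeasure LebT (rotT \<omega> -` Z) < ennreal (1/16)"
    using emeasure_LebT_rotT[OF borel_imp_LebT[OF Z(1)], of \<omega>] Z(2) by simp_all
  have "(\<integral>\<theta>. ln \<bar>dfib G \<theta> (\<phi> \<theta>)\<bar> \<partial>LebT) > 0"
  proof (rule integral_pos_if_mostly_large[where c="ln \<alpha>", OF _ _ _ _ rZ])
    show "0 < ln \<alpha>" using \<alpha>_gt by simp
    show "(\<integral>\<theta>. ln \<bar>dfib G \<theta> (\<phi> \<theta>)\<bar> \<partial>LebT) \<noteq> 0" using ly by (simp add: lyap_def)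
    show "- 2 * ln \<alpha> \<le> ln \<bar>dfib G \<theta> (\<phi> \<theta>)\<bar>" for \<theta> by (rule ln_dfib_bounds)
    show "AE \<theta> in LebT. \<theta> \<notin> rotT \<omega> -` Z \<longrightarrow> ln \<alpha> \<le> ln \<bar>dfib G \<theta> (\<phi> \<theta>)\<bar>"
      using 1
    proof eventually_elim
      case (elim \<theta>)
      show ?case
      proof
        assume "\<theta> \<notin> rotT \<omega> -` Z"
        then have "\<alpha> \<le> \<bar>dfib G \<theta> (\<phi> \<theta>)\<bar>" using elim by (intro dfib_E) simp
        then show "ln \<alpha> \<le> ln \<bar>dfib G \<theta> (\<phi> \<theta>)\<bar>" using \<alpha>_gt by (intro ln_mono) auto
      qed
    qed
  qed
  then show False using ly by (simp add: lyap_def)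
qed

lemma visits_E:
  assumes inv: "AE \<theta> in LebT. fib G \<theta> (\<phi> \<theta>) = \<phi> (rotT \<omega> \<theta>)" and ly: "lyap G \<phi> > 0"
  shows "\<not> (AE \<theta> in LebT. \<not> skew_contraction.before_hit (- \<omega>) (\<lambda>n. rotT \<omega> ` J n) M \<theta> \<longrightarrow> \<phi> \<theta> \<notin> E)"
proof
  assume out: "AE \<theta> in LebT. \<not> skew_contraction.before_hit (- \<omega>) (\<lambda>n. rotT \<omega> ` J n) M \<theta> \<longrightarrow> \<phi> \<theta> \<notin> E"
  \<comment> \<open>For the inverse map the times \<open>- M j\<close> to -1 decide
    \<open>before_hit\<close>, because its critical sets are shifted by \<open>\<omega>\<close>; the
    time 0 keeps the base point out of \<open>J 0\<close>. The graph then enters \<open>C\<close>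
    one step later.\<close>
  define Z where "Z = (\<Union>j. \<Union>l\<in>{- int (M j)..- int (M j) + int (M j)}. {\<theta>. rotn \<omega> l \<theta> \<in> J j})"
  note Z = window_small[of "\<lambda>j. - int (M j)", folded Z_def]
  have "AE \<theta> in LebT. \<theta> \<notin> Z \<longrightarrow> \<phi> (rotT \<omega> \<theta>) \<in> C"
    using out inv
  proof eventually_elim
    case (elim \<theta>)
    show ?case
    proof
      assume z: "\<theta> \<notin> Z"
      then have nz: "rotn \<omega> l \<theta> \<notin> J j" if "- int (M j) \<le> l" "l \<le> 0" for l j
        using that unfolding Z_def by auto
      have "\<not> skew_contraction.before_hit (- \<omega>) (\<lambda>n. rotT \<omega> ` J n) M \<theta>"
        unfolding skew_contraction.before_hit_def[OF skew_contraction_E]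
      proof (intro notI, elim exE conjE)
        fix j l assume l: "l < M j" "rotn (- \<omega>) (int l) \<theta> \<in> rotT \<omega> ` J j"
        have "rotT (- \<omega>) (rotn (- \<omega>) (int l) \<theta>) = rotn \<omega> (- int l - 1) \<theta>"
          unfolding rotn_def rotT_rotT by (rule arg_cong[where f="\<lambda>c. rotT c \<theta>"]) (simp add: algebra_simps)
        then have "rotn \<omega> (- int l - 1) \<theta> \<in> J j" using l(2) by (simp only: rotT_image_iff)
        then show False using nz[of j "- int l - 1"] l(1) by simp
      qed
      then have "\<phi> \<theta> \<notin> Eo" using elim(1) arcs(6) by blast
      moreover have "\<theta> \<notin> J 0" using nz[of 0 0] by simp
      ultimately have "fib G \<theta> (\<phi> \<theta>) \<in> interior C" by (rule fib_in_C)
      then show "\<phi> (rotT \<omega> \<theta>) \<in> C" unfolding elim(2) by (rule in_interior_C)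
    qed
  qed
  from AE_LebT_rotT[OF this, of "- \<omega>"]
  have 1: "AE \<theta> in LebT. rotT (- \<omega>) \<theta> \<notin> Z \<longrightarrow> \<phi> \<theta> \<in> C" by simp
  have rZ: "rotT (- \<omega>) -` Z \<in> sets LebT" "emeasure LebT (rotT (- \<omega>) -` Z) < ennreal (1/16)"
    using emeasure_LebT_rotT[OF borel_imp_LebT[OF Z(1)], of "- \<omega>"] Z(2) by simp_all
  have "(\<integral>\<theta>. - ln \<bar>dfib G \<theta> (\<phi> \<theta>)\<bar> \<partial>LebT) > 0"
  proof (rule integral_pos_if_mostly_large[where c="ln \<alpha>", OF _ _ _ _ rZ])
    show "0 < ln \<alpha>" using \<alpha>_gt by simp
    show "(\<integral>\<theta>. - ln \<bar>dfib G \<theta> (\<phi> \<theta>)\<bar> \<partial>LebT) \<noteq> 0" using ly by (simp add: lyap_def)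
    show "- 2 * ln \<alpha> \<le> - ln \<bar>dfib G \<theta> (\<phi> \<theta>)\<bar>" for \<theta> using ln_dfib_bounds(2)[of \<theta> "\<phi> \<theta>"] by simp
    show "AE \<theta> in LebT. \<theta> \<notin> rotT (- \<omega>) -` Z \<longrightarrow> ln \<alpha> \<le> - ln \<bar>dfib G \<theta> (\<phi> \<theta>)\<bar>"
      using 1
    proof eventually_elim
      case (elim \<theta>)
      show ?case
      proof
        assume "\<theta> \<notin> rotT (- \<omega>) -` Z"
        then have "\<bar>dfib G \<theta> (\<phi> \<theta>)\<bar> \<le> 1 / \<alpha>" using elim by (intro dfib_C) simp
        then have "ln \<bar>dfib G \<theta> (\<phi> \<theta>)\<bar> \<le> ln (1 / \<alpha>)"
          using dfib_pos[of \<theta> "\<phi> \<theta>"] by (intro ln_mono)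
        then show "ln \<alpha> \<le> - ln \<bar>dfib G \<theta> (\<phi> \<theta>)\<bar>" using \<alpha>_gt by (simp add: ln_div)
      qed
    qed
  qed
  then show False using ly by (simp add: lyap_def)
qed

lemma J_sum_finite: "(\<Sum>n. ennreal (real (2 * K n * M n + 1)) * emeasure LebT (J n)) < \<infinity>"
  using J_sum by (rule less_trans) simp

lemma rectifiable_attractor:
  assumes inv: "inv_graph \<omega> G \<phi>" and ly: "lyap G \<phi> < 0"
    and erg: "\<And>B. B \<in> sets borel \<Longrightarrow> rotT \<omega> -` B = B \<Longrightarrow> emeasure LebT B = 0 \<or> emeasure LebT B = 1"
  shows "rectifiable_1_measure (graph_measure \<phi>)"
proof -
  interpret skew_contraction \<omega> "fib G" C Eo J "\<lambda>n. M n - 1" "\<lambda>n. M n + 1" M K \<alpha> S \<delta>C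
    by (rule skew_contraction_C)
  interpret skew_contraction_graph \<omega> "fib G" C Eo J "\<lambda>n. M n - 1" "\<lambda>n. M n + 1" M K \<alpha> S \<delta>C \<phi>
  proof
    show "J n \<in> sets borel" for n using J_open by simp
    show "closed C" using compact_cl_arc by (rule compact_imp_closed)
    show "\<phi> \<in> LebT \<rightarrow>\<^sub>M borel" "AE \<theta> in LebT. fib G \<theta> (\<phi> \<theta>) = \<phi> (rotT \<omega> \<theta>)"
      using inv by (auto simp: inv_graph_def)
    then show "\<not> (AE \<theta> in LebT. \<not> before_hit \<theta> \<longrightarrow> \<phi> \<theta> \<notin> C)"
      using ly by (intro visits_C)
  qed (rule J_sum_finite erg | assumption)+
  show ?thesis by (rule rectifiable)
qed

lemma rectifiable_repeller:
  assumes inv: "inv_graph \<omega> G \<phi>" and ly: "lyap G \<phi> > 0"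
    and erg: "\<And>B. B \<in> sets borel \<Longrightarrow> rotT \<omega> -` B = B \<Longrightarrow> emeasure LebT B = 0 \<or> emeasure LebT B = 1"
  shows "rectifiable_1_measure (graph_measure \<phi>)"
proof -
  have J': "rotT \<omega> ` J n = rotT (- \<omega>) -` J n" for n by (auto simp: rotT_image_iff)
  have inv': "AE \<theta> in LebT. fib G \<theta> (\<phi> \<theta>) = \<phi> (rotT \<omega> \<theta>)" using inv by (simp add: inv_graph_def)
  interpret skew_contraction "- \<omega>" finv E "interior C" "\<lambda>n. rotT \<omega> ` J n" M M M K \<alpha> "\<alpha>\<^sup>2 * S" \<delta>E
    by (rule skew_contraction_E)
  interpret skew_contraction_graph "- \<omega>" finv E "interior C" "\<lambda>n. rotT \<omega> ` J n" M M M K \<alpha> "\<alpha>\<^sup>2 * S" \<delta>E \<phi>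
  proof
    show "rotT \<omega> ` J n \<in> sets borel" for n
      unfolding J' using J_open by (intro measurable_sets_borel[OF measurable_rotT]) simp
    show "closed E" using compact_cl_arc by (rule compact_imp_closed)
    show "\<phi> \<in> LebT \<rightarrow>\<^sub>M borel" using inv by (simp add: inv_graph_def)
    show "AE \<theta> in LebT. finv \<theta> (\<phi> \<theta>) = \<phi> (rotT (- \<omega>) \<theta>)"
      using AE_LebT_rotT[OF inv', of "- \<omega>"] by eventually_elim (simp add: finv_eq)
    show "\<not> (AE \<theta> in LebT. \<not> before_hit \<theta> \<longrightarrow> \<phi> \<theta> \<notin> E)"
      using inv' ly by (rule visits_E)
    have "emeasure LebT (rotT \<omega> ` J n) = emeasure LebT (J n)" for n
      unfolding J' using J_open by (intro emeasure_LebT_rotT(2) borel_imp_LebT) simp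
    then show "(\<Sum>n. ennreal (real (2 * K n * M n + 1)) * emeasure LebT (rotT \<omega> ` J n)) < \<infinity>"
      using J_sum_finite by (simp only:)
    fix B assume B: "B \<in> sets borel" "rotT (- \<omega>) -` B = B"
    have "rotT \<omega> -` B = rotT \<omega> -` (rotT (- \<omega>) -` B)" by (simp only: B(2))
    also have "\<dots> = B" by (auto simp: vimage_def)
    finally show "emeasure LebT B = 0 \<or> emeasure LebT B = 1" by (rule erg[OF B(1)])
  qed
  show ?thesis by (rule rectifiable)
qed

end

text \<open>The cylinder over an invariant base set is invariant under the skew product, and the
  graph measure projects to Lebesgue measure.\<close>

lemma ergodic_base:
  assumes \<phi>: "\<phi> \<in> measurable LebT borel" and erg: "inv_ergodic \<omega> G (graph_measure \<phi>)"
    and B: "B \<in> sets borel" "rotT \<omega> -` B = B"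
  shows "emeasure LebT B = 0 \<or> emeasure LebT B = 1"
proof -
  have fst: "fst \<in> borel_measurable (borel :: (T1 \<times> T1) measure)"
    by (intro borel_measurable_continuous_onI continuous_intros)
  have A: "fst -` B \<in> sets (borel :: (T1 \<times> T1) measure)" by (rule measurable_sets_borel[OF fst B(1)])
  have "fmap \<omega> G -` (fst -` B) = fst -` (rotT \<omega> -` B)" by (auto simp: fmap_def)
  then have "fmap \<omega> G -` (fst -` B) = fst -` B" by (simp only: B(2))
  then have "emeasure (graph_measure \<phi>) (fst -` B) = 0 \<or> emeasure (graph_measure \<phi>) (fst -` B) = 1"
    using erg A unfolding inv_ergodic_def by blast
  moreover have "emeasure (graph_measure \<phi>) (fst -` B) = emeasure LebT B"
    unfolding graph_measure_def using A by (subst emeasure_distr[OF graph_measurable[OF \<phi>]]) (auto simp: vimage_def)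
  ultimately show ?thesis by simp
qed

theorem theorem2p10:
  fixes \<omega> :: real and G :: "real \<Rightarrow> real \<Rightarrow> real" and \<phi>p \<phi>m :: "T1 \<Rightarrow> T1"
  assumes "\<omega> \<notin> \<rat>"
    and "in_V \<omega> G \<phi>p \<phi>m"
  shows "rectifiable_1_measure (graph_measure \<phi>p) \<and> rectifiable_1_measure (graph_measure \<phi>m)"
proof -
  obtain cm cp em ep N a b \<alpha> S \<kappa> K0 M \<epsilon> s where V: "F_omega \<omega> G" "Vcond_i G cm cp em ep N a b \<alpha> S"
    "Vcond_ii N a b \<alpha> \<kappa> K0 M \<epsilon> s"
    "Vcond_iii \<omega> N (crit \<omega> G (cl_arc cm cp) (cl_arc em ep) (\<Union>i<N. op_arc (a i) (b i)) M)
        (Kseq K0 \<kappa>) M \<epsilon>"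
    using assms(2) unfolding in_V_def by metis
  interpret V_data \<omega> G cm cp em ep N a b \<alpha> S \<kappa> K0 M \<epsilon> s
    by unfold_locales (fact V)+
  have p: "inv_graph \<omega> G \<phi>p" "lyap G \<phi>p < 0" and m: "inv_graph \<omega> G \<phi>m" "lyap G \<phi>m > 0"
    and "inv_ergodic \<omega> G (graph_measure \<phi>p)"
    using assms(2) by (auto simp: in_V_def SNA_def SNR_def)
  \<comment> \<open>A statement about the base only, so the ergodicity obtained from the attractor
    serves the repeller too.\<close>
  then have erg: "emeasure LebT B = 0 \<or> emeasure LebT B = 1" if "B \<in> sets borel" "rotT \<omega> -` B = B" for B
    using that by (intro ergodic_base[of \<phi>p \<omega> G]) (auto simp: inv_graph_def)
  show ?thesis
    using rectifiable_attractor[OF p erg] rectifiable_repeller[OF m erg] by blast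
qed

end
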